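(* Let $p\in(0,\infty]$, $q\in(0,\infty]$ and let $b$ be a slowly varying function. The space $L^{p,q,b}$ can be equipped with a Banach function norm equivalent to $\lVert\cdot\rVert_{p,q,b}$ if and only if $q\in[1,\infty]$ and one of the following conditions holds: (i) $p\in(1,\infty)$; (ii) $p=\infty$ and $\lVert t^{-1/q}b(t)\chi_{(0,1)}(t)\rVert_q<\infty$; (iii) $p=1$, $q=1$, and $b$ is equivalent to a non-increasing function on $(0,\infty)$.
   Context: $(R,\mu)$ is a $\sigma$-finite non-atomic measure space with $\mu(R)=\infty$; $M=M(R,\mu)$ is the set of extended complex-valued $\mu$-measurable functions on $R$ (identified when equal $\mu$-a.e.), $M_+$ its non-negative elements. For $f\in M$, $f^*(t)=\inf\{s\ge 0:\mu(\{|f|>s\})\le t\}$. Convention: $1/\infty=0$. Two non-negative functions or functionals $g,h$ are equivalent, $g\approx h$, if there are constants $0<c\le C<\infty$ with $cg\le h\le Cg$. A measurable $b:(0,\infty)\to(0,\infty)$ is slowly varying if for every $\varepsilon>0$ there are a non-decreasing function $b_\varepsilon$ and a non-increasing function $b_{-\varepsilon}$ with $t^\varepsilon b(t)\approx b_\varepsilon(t)$ and $t^{-\varepsilon}b(t)\approx b_{-\varepsilon}(t)$ on $(0,\infty)$. For $f\in M$, $\lVert f\rVert_{p,q,b}=\lVert t^{1/p-1/q}b(t)f^*(t)\rVert_q$, where $\lVert\cdot\rVert_q$ is the Lebesgue $L^q$ (quasi)norm over $(0,\infty)$ in the variable $t$, and $L^{p,q,b}=\{f\in M:\lVert f\rVert_{p,q,b}<\infty\}$.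 A functional $\lVert\cdot\rVert:M\to[0,\infty]$ with $\lVert f\rVert=\lVert\,|f|\,\rVert$ is a Banach function norm if on $M_+$: (P1) it is positively homogeneous, subadditive, and $\lVert f\rVert=0\iff f=0$ a.e.; (P2) $f\le g$ a.e. implies $\lVert f\rVert\le\lVert g\rVert$; (P3) $f_n\uparrow f$ a.e. implies $\lVert f_n\rVert\uparrow\lVert f\rVert$; (P4) $\lVert\chi_E\rVert<\infty$ whenever $\mu(E)<\infty$; (P5) for each $E$ with $\mu(E)<\infty$ there is $C_E<\infty$ with $\int_E f\,d\mu\le C_E\lVert f\rVert$ for all $f\in M_+$. *)

theory Defs
  imports "HOL-Analysis.Analysis" "HOL-Probability.Essential_Supremum"
begin

section \<open>Extended complex-valued measurable functions\<close>

datatype ecomplex = Finite complex | Infty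

primrec modulus :: "ecomplex \<Rightarrow> ennreal" where
  "modulus (Finite z) = ennreal (norm z)"
| "modulus Infty = \<infinity>"

definition ecomplex_of_ennreal :: "ennreal \<Rightarrow> ecomplex" where
  "ecomplex_of_ennreal x = (if x = \<infinity> then Infty else Finite (complex_of_real (enn2real x)))"

text \<open>The sigma-algebra generated by the Borel sets of the complex plane; it contains the
  singleton of \<open>Infty\<close> as the complement of the plane.\<close>
definition ecomplex_borel :: "ecomplex measure" where
  "ecomplex_borel = sigma UNIV ((`) Finite ` sets borel)"

text \<open>Functions are not quotiented by equality almost everywhere. Both the Lorentz--Karamata
  functional and (by monotonicity on non-negative functions) every Banach function norm
  take equal values on functions that agree almost everywhere.\<close>
definition Mfun :: "'a measure \<Rightarrow> ('a \<Rightarrow> ecomplex) set" where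
  "Mfun R = R \<rightarrow>\<^sub>M ecomplex_borel"

definition non_atomic :: "'a measure \<Rightarrow> bool" where
  "non_atomic R \<longleftrightarrow>
     (\<forall>A\<in>sets R. 0 < emeasure R A \<longrightarrow>
        (\<exists>B\<in>sets R. B \<subseteq> A \<and> 0 < emeasure R B \<and> emeasure R B < emeasure R A))"

section \<open>Equivalence and slowly varying functions\<close>

definition equivalent_on :: "'a set \<Rightarrow> ('a \<Rightarrow> ennreal) \<Rightarrow> ('a \<Rightarrow> ennreal) \<Rightarrow> bool" where
  "equivalent_on S g h \<longleftrightarrow>
     (\<exists>c C :: real. 0 < c \<and> c \<le> C \<and> (\<forall>x\<in>S. ennreal c * g x \<le> h x \<and> h x \<le> ennreal C * g x))"

text \<open>Only the values on \<open>{0<..}\<close> matter. The comparison functions may be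
  \<open>ennreal\<close>-valued: being equivalent to a positive real-valued function, they are
  automatically positive and finite on \<open>{0<..}\<close>.\<close>
definition slowly_varying :: "(real \<Rightarrow> real) \<Rightarrow> bool" where
  "slowly_varying b \<longleftrightarrow>
     b \<in> borel_measurable (lebesgue_on {0<..}) \<and>
     (\<forall>t>0. 0 < b t) \<and>
     (\<forall>\<epsilon>>0.
        (\<exists>g. mono_on {0<..} g \<and>
             equivalent_on {0<..} (\<lambda>t. ennreal (t powr \<epsilon> * b t)) g) \<and>
        (\<exists>g. antimono_on {0<..} g \<and>
             equivalent_on {0<..} (\<lambda>t. ennreal (t powr (- \<epsilon>) * b t)) g))"

section \<open>Lorentz--Karamata spaces\<close>

text \<open>The level \<open>s\<close> ranges over \<open>[0, \<infinity>]\<close> instead of \<open>[0, \<infinity>)\<close>; as the infimum of the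
  empty set is \<open>\<infinity>\<close>, this gives the same value.\<close>
definition rearrangement :: "'a measure \<Rightarrow> ('a \<Rightarrow> ecomplex) \<Rightarrow> real \<Rightarrow> ennreal" where
  "rearrangement R f t =
     Inf {s. emeasure R {x \<in> space R. modulus (f x) > s} \<le> ennreal t}"

text \<open>Real powers of extended non-negative numbers, used for positive exponents only.\<close>
definition epowr :: "ennreal \<Rightarrow> real \<Rightarrow> ennreal" where
  "epowr x r = (if x = \<infinity> then \<infinity> else ennreal (enn2real x powr r))"

definition Lq_norm :: "ennreal \<Rightarrow> (real \<Rightarrow> ennreal) \<Rightarrow> ennreal" where
  "Lq_norm q g =
     (if q = \<infinity> then esssup (lebesgue_on {0<..}) g
      else epowr (\<integral>\<^sup>+t. epowr (g t) (enn2real q) \<partial>lebesgue_on {0<..}) (1 / enn2real q))"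

text \<open>\<open>ennreal\<close> division gives \<open>1 / \<infinity> = 0\<close>, so \<open>recip p\<close> is \<open>1 / p\<close> for all
  \<open>p\<close> in \<open>(0, \<infinity>]\<close> with the usual convention.\<close>
definition recip :: "ennreal \<Rightarrow> real" where
  "recip p = enn2real (1 / p)"

definition LK_norm ::
  "'a measure \<Rightarrow> ennreal \<Rightarrow> ennreal \<Rightarrow> (real \<Rightarrow> real) \<Rightarrow> ('a \<Rightarrow> ecomplex) \<Rightarrow> ennreal" where
  "LK_norm R p q b f =
     Lq_norm q (\<lambda>t. ennreal (t powr (recip p - recip q) * b t) * rearrangement R f t)"

definition LK_space ::
  "'a measure \<Rightarrow> ennreal \<Rightarrow> ennreal \<Rightarrow> (real \<Rightarrow> real) \<Rightarrow> ('a \<Rightarrow> ecomplex) set" where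
  "LK_space R p q b = {f \<in> Mfun R. LK_norm R p q b f < \<infinity>}"

section \<open>Banach function norms\<close>

text \<open>The non-negative elements of \<open>Mfun R\<close> are the functions
  \<open>ecomplex_of_ennreal \<circ> g\<close> with \<open>g \<in> borel_measurable R\<close>; \<open>n g\<close> below is the norm of
  such an element. The function \<open>g\<close> is \<open>ennreal\<close>-valued so that the axioms can use
  the arithmetic, order and integral of \<open>ennreal\<close>.\<close>
definition banach_function_norm :: "'a measure \<Rightarrow> (('a \<Rightarrow> ecomplex) \<Rightarrow> ennreal) \<Rightarrow> bool" where
  "banach_function_norm R N \<longleftrightarrow>
     (let n = (\<lambda>g :: 'a \<Rightarrow> ennreal. N (ecomplex_of_ennreal \<circ> g)); Mp = borel_measurable R in
      (\<forall>f\<in>Mfun R. N f = n (modulus \<circ> f)) \<and>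
      (\<forall>a::real. 0 \<le> a \<longrightarrow> (\<forall>g\<in>Mp. n (\<lambda>x. ennreal a * g x) = ennreal a * n g)) \<and>
      (\<forall>g\<in>Mp. \<forall>h\<in>Mp. n (\<lambda>x. g x + h x) \<le> n g + n h) \<and>
      (\<forall>g\<in>Mp. n g = 0 \<longleftrightarrow> (AE x in R. g x = 0)) \<and>
      (\<forall>g\<in>Mp. \<forall>h\<in>Mp. (AE x in R. g x \<le> h x) \<longrightarrow> n g \<le> n h) \<and>
      (\<forall>u g. (\<forall>k::nat. u k \<in> Mp) \<and> g \<in> Mp \<and>
             (AE x in R. incseq (\<lambda>k. u k x) \<and> (\<lambda>k. u k x) \<longlonglongrightarrow> g x) \<longrightarrow>
             incseq (\<lambda>k. n (u k)) \<and> (\<lambda>k. n (u k)) \<longlonglongrightarrow> n g) \<and>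
      (\<forall>E\<in>sets R. emeasure R E < \<infinity> \<longrightarrow> n (indicator E) < \<infinity>) \<and>
      (\<forall>E\<in>sets R. emeasure R E < \<infinity> \<longrightarrow>
         (\<exists>C<\<infinity>. \<forall>g\<in>Mp. (\<integral>\<^sup>+x\<in>E. g x \<partial>R) \<le> C * n g)))"

end

theory Submission
  imports Defs
begin

text \<open>
  Slow variation makes \<open>\<parallel>f\<parallel>\<^bsub>p,q,b\<^esub>\<close> equivalent to the \<open>\<ell>\<^sup>q\<close>-norm over \<open>k \<in> \<int>\<close> of
  \<open>2\<^bsup>k/p\<^esup> b(2\<^bsup>k\<^esup>) f*(2\<^bsup>k\<^esup>)\<close>, so everything is decided at dyadic points.
  The functional \<open>K(t, f) = sup {\<integral>\<^sub>E |f| : \<mu>(E) \<le> t}\<close> is a seminorm with the Fatou property, being a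
  supremum of integrals, and \<open>K(2\<^bsup>j\<^esup>, f)\<close> is comparable with the sum of \<open>2\<^bsup>k\<^esup> f*(2\<^bsup>k\<^esup>)\<close> over \<open>k \<le> j\<close>.
  For \<open>p > 1\<close> and \<open>q \<ge> 1\<close> one replaces \<open>f*(2\<^bsup>k\<^esup>)\<close> by \<open>2\<^bsup>-k\<^esup> K(2\<^bsup>k\<^esup>, f)\<close> and applies a discrete Hardy
  inequality; for \<open>p = q = 1\<close> one writes the non-increasing weight as a sum of its increments.
  Conversely, if the functional is equivalent to a norm, then testing the triangle inequality on
  characteristic functions excludes \<open>q < 1\<close> (normalized characteristic functions of rapidly shrinking
  sets) and \<open>p < 1\<close>, and for \<open>p = 1\<close> makes \<open>b\<close> almost non-increasing (partitions into equal pieces).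
  If \<open>p = 1 < q\<close>, averaging cyclic shifts bounds sums of \<open>1 / b(2\<^bsup>k\<^esup>)\<close> so strongly that \<open>b\<close> would
  grow like a power.
\<close>

section \<open>Sequence quasi-norms\<close>

text \<open>Equivalence with a norm enters the converse in two forms: sums of any length are
  subadditive up to one constant \<open>A\<close> that does not depend on the number of summands,
  and sets of finite measure have characteristic functions of finite size. The bound q \<ge> 1 has
  to precede the other exclusions, because those rest on the triangle inequality in l^q. At p = 1
  the obstacle is that the geometric factor 2^(-(1 - 1/p) i) in Hardy's inequality stops decaying,
  so f*(t) can no longer be traded for K(t, f) / t. For q = 1 Tonelli's theorem takes over: the
  tails of the increments of a monotone weight restore the weight itself. Slow variation permits an
  error 2^(e |k - m|) for every e > 0. Wherever a geometric series has to converge, or growth has to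
  be contradicted, e is half of the available gap in the exponents. Condition (ii) says that
  characteristic functions have finite size when p is infinite. For finite p the weight 2^(k/p)
  b(2^k) decays geometrically as k tends to -\<infinity>, and finiteness is automatic.\<close>

lemma epowr_top [simp]: "epowr top r = top"
  by (simp add: epowr_def)

lemma epowr_ennreal: "0 \<le> x \<Longrightarrow> epowr (ennreal x) r = ennreal (x powr r)"
  by (simp add: epowr_def)

lemma epowr_0 [simp]: "epowr 0 r = 0"
  by (simp add: epowr_def)

lemma epowr_mono:
  assumes "0 < r" "x \<le> y"
  shows "epowr x r \<le> epowr y r"
proof (cases "y = \<infinity>")
  case False
  then obtain b where b: "y = ennreal b" "0 \<le> b" by (cases y) auto
  with assms obtain a where a: "x = ennreal a" "0 \<le> a" by (cases x) (auto simp: top_unique)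
  show ?thesis using assms a b by (simp add: epowr_ennreal powr_mono2)
qed simp

lemma epowr_epowr_inverse:
  assumes "0 < r"
  shows "epowr (epowr x r) (1 / r) = x"
proof (cases x)
  case (real a)
  then show ?thesis using assms by (simp add: epowr_ennreal powr_powr)
qed auto

lemma epowr_inverse_epowr:
  assumes "0 < r"
  shows "epowr (epowr x (1 / r)) r = x"
  using epowr_epowr_inverse[of "1 / r" x] assms by simp

text \<open>Power and root form a Galois connection; commutation with suprema in
  \<open>epowr_SUP\<close> then follows from order alone, including an empty index set and the value
  \<infinity>.\<close>

lemma epowr_le_iff:
  assumes "0 < r"
  shows "epowr x r \<le> y \<longleftrightarrow> x \<le> epowr y (1 / r)"
proof
  assume "epowr x r \<le> y"
  then have "epowr (epowr x r) (1 / r) \<le> epowr y (1 / r)" using assms by (intro epowr_mono) auto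
  then show "x \<le> epowr y (1 / r)" using assms by (simp add: epowr_epowr_inverse)
next
  assume "x \<le> epowr y (1 / r)"
  then have "epowr x r \<le> epowr (epowr y (1 / r)) r" using assms by (intro epowr_mono) auto
  then show "epowr x r \<le> y" using assms by (simp add: epowr_inverse_epowr)
qed

lemma epowr_mult:
  assumes "0 < r"
  shows "epowr (x * y) r = epowr x r * epowr y r"
proof (cases "x = 0 \<or> y = 0")
  case False
  show ?thesis
  proof (cases "x = \<infinity> \<or> y = \<infinity>")
    case True
    \<comment> \<open>With both factors nonzero the product is \<infinity>, so neither power on the
      right may vanish: \<open>0 * top = 0\<close> would spoil the identity.\<close>
    have pos: "epowr z r \<noteq> 0" if "z \<noteq> 0" for z
      using epowr_le_iff[OF assms, of z 0] that by auto
    have "epowr x r \<noteq> 0" "epowr y r \<noteq> 0" using False by (auto intro!: pos)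
    then show ?thesis using True False
      by (auto simp: ennreal_mult_top ennreal_top_mult)
  next
    case F: False
    obtain a where "x = ennreal a" "0 \<le> a" using F by (cases x) auto
    moreover obtain b where "y = ennreal b" "0 \<le> b" using F by (cases y) auto
    ultimately show ?thesis
      by (simp add: epowr_ennreal powr_mult flip: ennreal_mult)
  qed
qed auto

lemma epowr_SUP:
  assumes "0 < r"
  shows "epowr (SUP i\<in>I. x i) r = (SUP i\<in>I. epowr (x i) r)"
proof (rule antisym)
  have "(SUP i\<in>I. x i) \<le> epowr (SUP i\<in>I. epowr (x i) r) (1 / r)"
  proof (rule SUP_least)
    fix i assume "i \<in> I"
    then show "x i \<le> epowr (SUP i\<in>I. epowr (x i) r) (1 / r)"
      using assms by (auto simp: epowr_le_iff[symmetric] intro: SUP_upper)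
  qed
  then show "epowr (SUP i\<in>I. x i) r \<le> (SUP i\<in>I. epowr (x i) r)"
    by (simp add: epowr_le_iff[OF assms])
  show "(SUP i\<in>I. epowr (x i) r) \<le> epowr (SUP i\<in>I. x i) r"
    using assms by (intro SUP_least epowr_mono SUP_upper)
qed

text \<open>The sum is an integral over counting measure on the integers, so monotone convergence,
  Tonelli and reindexing are those of integrals. For \<open>q < 1\<close> the value is only a
  quasi-norm.\<close>

definition lq :: "ennreal \<Rightarrow> (int \<Rightarrow> ennreal) \<Rightarrow> ennreal" where
  "lq q x =
     (if q = \<infinity> then SUP k. x k
      else epowr (\<integral>\<^sup>+k. epowr (x k) (enn2real q) \<partial>count_space UNIV) (1 / enn2real q))"

lemma exponent_pos: "0 < q \<Longrightarrow> q \<noteq> \<infinity> \<Longrightarrow> 0 < enn2real q" for q :: ennreal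
  by (cases q) (auto simp: ennreal_less_zero_iff)

lemma exponent_pos_of_ge_1: "1 \<le> q \<Longrightarrow> 0 < q" for q :: ennreal
  using order_less_le_trans[OF zero_less_one] .

lemma lq_mono:
  assumes "0 < q" "\<And>k. x k \<le> y k"
  shows "lq q x \<le> lq q y"
proof (cases "q = \<infinity>")
  case True
  then show ?thesis using assms by (auto simp: lq_def intro!: SUP_mono)
next
  case False
  with assms exponent_pos have "0 < enn2real q" by blast
  with False assms show ?thesis
    by (auto simp: lq_def intro!: epowr_mono nn_integral_mono)
qed

lemma lq_cmult:
  assumes "0 < q"
  shows "lq q (\<lambda>k. c * x k) = c * lq q x"
proof (cases "q = \<infinity>")
  case True
  then show ?thesis by (simp add: lq_def SUP_mult_left_ennreal)
next
  case False
  with assms exponent_pos have "0 < enn2real q" by blast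
  with False assms show ?thesis
    by (simp add: lq_def epowr_mult nn_integral_cmult epowr_epowr_inverse)
qed

lemma lq_ge:
  assumes "0 < q"
  shows "x k \<le> lq q x"
proof (cases "q = \<infinity>")
  case True
  then show ?thesis by (auto simp: lq_def intro: SUP_upper)
next
  case False
  with assms exponent_pos have r: "0 < enn2real q" by blast
  have "epowr (x k) (enn2real q) \<le> (\<integral>\<^sup>+k. epowr (x k) (enn2real q) \<partial>count_space UNIV)"
    by (rule nn_integral_ge_point) simp
  with False r show ?thesis by (simp add: lq_def epowr_le_iff)
qed

lemma lq_SUP:
  fixes x :: "nat \<Rightarrow> int \<Rightarrow> ennreal"
  assumes "0 < q" "incseq x"
  shows "lq q (\<lambda>k. SUP n. x n k) = (SUP n. lq q (x n))"
proof (cases "q = \<infinity>")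
  case True
  then show ?thesis by (auto simp: lq_def intro: SUP_commute)
next
  case False
  with assms exponent_pos have r: "0 < enn2real q" by blast
  have "incseq (\<lambda>n k. epowr (x n k) (enn2real q))"
    using assms r by (auto simp: incseq_def le_fun_def intro!: epowr_mono)
  then have "(\<integral>\<^sup>+k. (SUP n. epowr (x n k) (enn2real q)) \<partial>count_space UNIV)
     = (SUP n. \<integral>\<^sup>+k. epowr (x n k) (enn2real q) \<partial>count_space UNIV)"
    by (rule nn_integral_monotone_convergence_SUP) simp
  with False r show ?thesis by (simp add: lq_def epowr_SUP)
qed

lemma lq_shift: "lq q (\<lambda>k. x (k + m)) = lq q x"
proof -
  have b: "bij_betw (\<lambda>k::int. k + m) UNIV UNIV"
    by (rule bij_betwI[where g="\<lambda>k. k - m"]) auto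
  have "(SUP k. x (k + m)) = (SUP k. x k)"
    using b bij_betw_imp_surj_on[OF b] by (metis image_image)
  moreover have *: "(\<integral>\<^sup>+k. f (k + m) \<partial>count_space UNIV) = (\<integral>\<^sup>+k. f k \<partial>count_space UNIV)" for f :: "int \<Rightarrow> ennreal"
    using nn_integral_bij_count_space[OF b] by simp
  ultimately show ?thesis by (simp add: lq_def *[of "\<lambda>k. epowr (x k) (enn2real q)"])
qed

lemma powr_le_self: "0 \<le> u \<Longrightarrow> u \<le> 1 \<Longrightarrow> 1 \<le> r \<Longrightarrow> u powr r \<le> u" for u r :: real
  using powr_mono'[of 1 r u] by (cases "u = 0") auto

text \<open>For positive arguments this is convexity of the power; if an argument vanishes, what
  remains is \<open>u powr r \<le> u\<close> for \<open>u \<le> 1\<close>.\<close>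

lemma powr_convex_combination:
  fixes x y :: real
  assumes "0 \<le> x" "0 \<le> y" "0 < u" "0 < v" "u + v = 1" "1 \<le> r"
  shows "(u * x + v * y) powr r \<le> u * x powr r + v * y powr r"
proof -
  have *: "(u * x) powr r \<le> u * x powr r" if "0 \<le> x" "0 < u" "u \<le> 1" for u x :: real
    using that powr_le_self[of u r] assms by (simp add: powr_mult mult_right_mono)
  consider "x = 0" | "y = 0" | "0 < x" "0 < y" using assms by linarith
  then show ?thesis
  proof cases
    case 3
    have "u = 1 - v" using assms by simp
    with 3 show ?thesis
      using convex_onD[OF powr_convex[OF \<open>1 \<le> r\<close>], of v x y] assms
      unfolding \<open>u = 1 - v\<close> by simp
  qed (use *[of y v] *[of x u] assms in auto)
qed

text \<open>Minkowski's inequality from convexity. With norms a and b, the sum x + y is a + b times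
  the convex combination of x / a and y / b with weights a / (a + b) and b / (a + b). Infinite norms
  are trivial, and a vanishing norm forces the zero sequence.\<close>

lemma lq_triangle:
  assumes "1 \<le> q"
  shows "lq q (\<lambda>k. x k + y k) \<le> lq q x + lq q y"
proof (cases "q = \<infinity>")
  case True
  then show ?thesis
    by (auto simp: lq_def intro!: SUP_least add_mono SUP_upper)
next
  case False
  define r where "r = enn2real q"
  have r: "1 \<le> r" using assms False unfolding r_def by (cases q) auto
  have q0: "0 < q" by (rule exponent_pos_of_ge_1[OF assms])
  show ?thesis
  proof (cases "lq q x = \<infinity> \<or> lq q y = \<infinity> \<or> lq q x = 0 \<or> lq q y = 0")
    case True
    have z: "z k = 0" if "lq q z = 0" for z k
      using lq_ge[OF q0, of z k] that by simp
    consider "lq q x = \<infinity>" | "lq q y = \<infinity>" | "lq q x = 0" | "lq q y = 0"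
      using True by blast
    then show ?thesis
    proof cases
      case 3
      then show ?thesis by (simp only: z add_0_left order_refl)
    next
      case 4
      then show ?thesis by (simp only: z add_0_right order_refl)
    qed simp_all
  next
    case F: False
    then obtain a where a: "lq q x = ennreal a" "0 < a" by (cases "lq q x") auto
    from F obtain b where b: "lq q y = ennreal b" "0 < b" by (cases "lq q y") auto
    define u v where "u = a / (a + b)" and "v = b / (a + b)"
    have uv: "0 < u" "0 < v" "u + v = 1"
      using a b by (auto simp: u_def v_def simp flip: add_divide_distrib)
    have abu: "(a + b) * u = a" "(a + b) * v = b"
      using a b by (auto simp: u_def v_def)
    have fin: "(\<integral>\<^sup>+k. epowr (z k) r \<partial>count_space UNIV) = ennreal (c powr r)"
      if "lq q z = ennreal c" "0 < c" for z c
    proof -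
      have "epowr (lq q z) r = (\<integral>\<^sup>+k. epowr (z k) r \<partial>count_space UNIV)"
        unfolding lq_def using False r by (simp add: r_def[symmetric] epowr_inverse_epowr)
      then show ?thesis using that by (simp add: epowr_ennreal)
    qed
    \<comment> \<open>Coefficients of the pointwise convexity bound: summed against the r-th powers
      of the norms they give (a + b)^r (u + v), and u + v = 1.\<close>
    define ca cb where "ca = (a + b) powr r * u / a powr r" and "cb = (a + b) powr r * v / b powr r"
    have c0: "0 \<le> ca" "0 \<le> cb" using uv by (auto simp: ca_def cb_def)
    have "epowr (x k + y k) r \<le> ennreal ca * epowr (x k) r + ennreal cb * epowr (y k) r" for k
    proof -
      have "x k \<le> ennreal a" "y k \<le> ennreal b" using lq_ge[OF q0] a b by metis+
      then obtain s t where s: "x k = ennreal s" "0 \<le> s" and t: "y k = ennreal t" "0 \<le> t"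
        by (cases "x k"; cases "y k") (auto simp: top_unique)
      have "(s + t) powr r = ((a + b) * (u * (s / a) + v * (t / b))) powr r"
        using uv a b by (simp add: distrib_left mult.assoc[symmetric] abu)
      also have "\<dots> = (a + b) powr r * (u * (s / a) + v * (t / b)) powr r"
        by (rule powr_mult)
      also have "\<dots> \<le> (a + b) powr r * (u * (s / a) powr r + v * (t / b) powr r)"
        using uv a b s t r by (intro mult_left_mono powr_convex_combination) auto
      also have "\<dots> = ca * s powr r + cb * t powr r"
        using a b s t by (simp add: ca_def cb_def powr_divide algebra_simps)
      finally have "(s + t) powr r \<le> ca * s powr r + cb * t powr r" .
      then have "ennreal ((s + t) powr r) \<le> ennreal (ca * s powr r + cb * t powr r)"
        by (rule ennreal_leI)
      also have "\<dots> = ennreal ca * ennreal (s powr r) + ennreal cb * ennreal (t powr r)"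
        using c0 by (simp add: ennreal_mult)
      finally show ?thesis using s t by (simp add: epowr_ennreal del: ennreal_plus flip: ennreal_plus)
    qed
    then have "(\<integral>\<^sup>+k. epowr (x k + y k) r \<partial>count_space UNIV)
       \<le> (\<integral>\<^sup>+k. ennreal ca * epowr (x k) r + ennreal cb * epowr (y k) r \<partial>count_space UNIV)"
      by (intro nn_integral_mono) auto
    also have "\<dots> = ennreal ca * ennreal (a powr r) + ennreal cb * ennreal (b powr r)"
      by (simp add: nn_integral_add nn_integral_cmult fin[OF a] fin[OF b])
    also have "\<dots> = ennreal ((a + b) powr r * (u + v))"
    proof -
      have "ca * a powr r + cb * b powr r = (a + b) powr r * (u + v)"
        using a b by (simp add: ca_def cb_def algebra_simps)
      then have "ennreal ((a + b) powr r * (u + v)) = ennreal (ca * a powr r + cb * b powr r)"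
        by simp
      then show ?thesis using c0 by (simp add: ennreal_mult)
    qed
    also have "\<dots> = epowr (ennreal (a + b)) r"
      using uv a b by (subst epowr_ennreal) auto
    finally have "(\<integral>\<^sup>+k. epowr (x k + y k) r \<partial>count_space UNIV) \<le> epowr (ennreal (a + b)) r" .
    then have "lq q (\<lambda>k. x k + y k) \<le> epowr (epowr (ennreal (a + b)) r) (1 / r)"
      using r False by (simp add: lq_def r_def[symmetric] epowr_mono)
    then show ?thesis using a b r by (simp add: epowr_epowr_inverse)
  qed
qed

lemma lq_zero: "0 < q \<Longrightarrow> lq q (\<lambda>_. 0) = 0"
  by (simp add: lq_def)

lemma lq_sum_le:
  assumes "1 \<le> q" "finite I"
  shows "lq q (\<lambda>k. \<Sum>i\<in>I. x i k) \<le> (\<Sum>i\<in>I. lq q (x i))"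
  using assms(2)
proof (induction I rule: finite_induct)
  case empty
  have "0 < q" by (rule exponent_pos_of_ge_1[OF assms(1)])
  then show ?case by (simp add: lq_zero)
next
  case (insert i I)
  then show ?case
    using lq_triangle[OF assms(1), of "x i" "\<lambda>k. \<Sum>i\<in>I. x i k"]
    by (auto intro: order_trans add_left_mono)
qed

lemma lq_suminf_le:
  fixes x :: "nat \<Rightarrow> int \<Rightarrow> ennreal"
  assumes "1 \<le> q"
  shows "lq q (\<lambda>k. \<Sum>i. x i k) \<le> (\<Sum>i. lq q (x i))"
proof -
  have q0: "0 < q" by (rule exponent_pos_of_ge_1[OF assms])
  have "lq q (\<lambda>k. \<Sum>i. x i k) = lq q (\<lambda>k. SUP n. \<Sum>i<n. x i k)"
    by (simp add: suminf_eq_SUP)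
  also have "\<dots> = (SUP n. lq q (\<lambda>k. \<Sum>i<n. x i k))"
    using q0 by (intro lq_SUP) (auto simp: incseq_def le_fun_def intro!: sum_mono2)
  also have "\<dots> \<le> (SUP n. \<Sum>i<n. lq q (x i))"
    by (intro SUP_mono) (auto intro!: lq_sum_le assms)
  also have "\<dots> = (\<Sum>i. lq q (x i))" by (simp add: suminf_eq_SUP)
  finally show ?thesis .
qed

text \<open>Besides normalizing unit vectors, this supplies the factor
  \<open>real n powr recip q\<close> that later limits harmonic sums of 1 / b.\<close>

lemma lq_indicator_finite:
  assumes "0 < q" "finite A" "A \<noteq> {}"
  shows "lq q (indicator A) = ennreal (card A powr recip q)"
proof (cases "q = \<infinity>")
  case True
  obtain a where "a \<in> A" using assms by blast
  have "(SUP k. indicator A k :: ennreal) = 1"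
  proof (rule antisym)
    have "(indicator A a :: ennreal) \<le> (SUP k. indicator A k)" by (rule SUP_upper) simp
    then show "1 \<le> (SUP k. indicator A k :: ennreal)" using \<open>a \<in> A\<close> by simp
  qed (auto intro!: SUP_least simp: indicator_def)
  then show ?thesis using True assms by (simp add: lq_def recip_def)
next
  case False
  have r: "0 < enn2real q" using False assms exponent_pos by blast
  have "recip q = 1 / enn2real q"
    using False assms r by (cases q) (auto simp: recip_def divide_ennreal[of 1, simplified])
  moreover have "(\<lambda>k. epowr (indicator A k) (enn2real q)) = indicator A"
    using r epowr_ennreal[of 1] by (auto simp: indicator_def fun_eq_iff)
  moreover have "(\<integral>\<^sup>+k. indicator A k \<partial>count_space UNIV) = ennreal (card A)"
    using assms by (simp add: emeasure_count_space ennreal_of_nat_eq_real_of_nat)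
  ultimately show ?thesis using False by (simp add: lq_def epowr_ennreal)
qed

section \<open>Non-atomic measures and rearrangements\<close>

lemma measure_le_of_emeasure_le:
  assumes "emeasure R B \<le> ennreal t" "0 \<le> t"
  shows "emeasure R B = ennreal (measure R B)" "measure R B \<le> t"
proof -
  show "emeasure R B = ennreal (measure R B)"
    using assms by (intro emeasure_eq_ennreal_measure) (auto simp: top_unique)
  with assms show "measure R B \<le> t" by simp
qed

text \<open>Of a proper part and its complement, one has at most half of the measure; repeated
  halving of a set of finite measure goes below any positive bound.\<close>

lemma non_atomic_small_subset:
  fixes R :: "'a measure"
  assumes na: "non_atomic R" and A: "A \<in> sets R" "0 < emeasure R A" and e: "0 < e"
  shows "\<exists>B\<in>sets R. B \<subseteq> A \<and> 0 < emeasure R B \<and> emeasure R B < ennreal e"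
proof -
  have half: "\<exists>C\<in>sets R. C \<subseteq> B \<and> 0 < emeasure R C \<and> 2 * emeasure R C \<le> emeasure R B"
    if B: "B \<in> sets R" "0 < emeasure R B" for B
  proof -
    obtain C where C: "C \<in> sets R" "C \<subseteq> B" "0 < emeasure R C" "emeasure R C < emeasure R B"
      using na B unfolding non_atomic_def by blast
    have eq: "emeasure R B = emeasure R C + emeasure R (B - C)"
      using C B by (subst plus_emeasure) (auto intro!: arg_cong[where f="emeasure R"])
    have pos: "0 < emeasure R (B - C)" using eq C(4) by (cases "emeasure R (B - C) = 0") (auto simp: zero_less_iff_neq_zero)
    show ?thesis
    proof (cases "emeasure R C \<le> emeasure R (B - C)")
      case True
      then have "2 * emeasure R C \<le> emeasure R B" unfolding eq by (simp add: mult_2 add_left_mono)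
      with C show ?thesis by blast
    next
      case False
      then have "2 * emeasure R (B - C) \<le> emeasure R B" unfolding eq by (simp add: mult_2 add_right_mono)
      with C B pos show ?thesis by (intro bexI[of _ "B - C"]) auto
    qed
  qed
  \<comment> \<open>Non-atomicity yields a subset of strictly smaller measure, hence of finite
    measure.\<close>
  obtain A0 where A0: "A0 \<in> sets R" "A0 \<subseteq> A" "0 < emeasure R A0" "emeasure R A0 < \<infinity>"
    using na A unfolding non_atomic_def by (metis infinity_ennreal_def top.not_eq_extremum order_less_le_trans order_top_class.top_greatest)
  have "\<exists>B\<in>sets R. B \<subseteq> A \<and> 0 < emeasure R B \<and> 2 ^ n * emeasure R B \<le> emeasure R A0" for n :: nat
  proof (induction n)
    case 0
    show ?case using A0 by auto
  next
    case (Suc n)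
    then obtain B where B: "B \<in> sets R" "B \<subseteq> A" "0 < emeasure R B" "2 ^ n * emeasure R B \<le> emeasure R A0" by blast
    from half[OF B(1,3)] obtain C where C: "C \<in> sets R" "C \<subseteq> B" "0 < emeasure R C" "2 * emeasure R C \<le> emeasure R B"
      by blast
    have "2 ^ Suc n * emeasure R C = 2 ^ n * (2 * emeasure R C)" by (simp add: mult.assoc mult.left_commute)
    also have "\<dots> \<le> 2 ^ n * emeasure R B" using C by (intro mult_left_mono) auto
    also have "\<dots> \<le> emeasure R A0" by fact
    finally show ?case using C B by blast
  qed
  moreover obtain a where a: "emeasure R A0 = ennreal a" "0 \<le> a" using A0 by (cases "emeasure R A0") auto
  moreover obtain n where n: "a / e < 2 ^ n" using real_arch_pow[of 2 "a / e"] by auto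
  ultimately obtain B where B: "B \<in> sets R" "B \<subseteq> A" "0 < emeasure R B" "2 ^ n * emeasure R B \<le> ennreal a" by metis
  have "emeasure R B < ennreal e"
  proof (rule ccontr)
    assume "\<not> ?thesis"
    then have "2 ^ n * ennreal e \<le> 2 ^ n * emeasure R B" by (intro mult_left_mono) auto
    also have "\<dots> \<le> ennreal a" by fact
    also have "2 ^ n * ennreal e = ennreal (2 ^ n * e)"
      using e by (simp add: ennreal_mult flip: ennreal_power)
    finally have "2 ^ n * e \<le> a" using a by simp
    then show False using n e by (simp add: field_simps)
  qed
  with B show ?thesis by blast
qed

text \<open>Sierpinski's theorem; the approximating chain of subsets is chosen greedily, each step
  exhausting at least half of what can still be added.\<close>
lemma non_atomic_subset_emeasure:
  fixes R :: "'a measure"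
  assumes na: "non_atomic R" and A: "A \<in> sets R" and t: "0 \<le> t" "ennreal t \<le> emeasure R A"
  shows "\<exists>B\<in>sets R. B \<subseteq> A \<and> emeasure R B = ennreal t"
proof -
  define P where "P B \<longleftrightarrow> B \<in> sets R \<and> B \<subseteq> A \<and> emeasure R B \<le> ennreal t" for B
  define Q where "Q B B' \<longleftrightarrow> B \<subseteq> B' \<and>
    (\<forall>C\<in>sets R. C \<subseteq> A - B \<longrightarrow> emeasure R C \<le> ennreal (t - measure R B) \<longrightarrow>
        measure R C \<le> 2 * (measure R B' - measure R B))" for B B'
  have step: "\<exists>B'. P B' \<and> Q B B'" if "P B" for B
  proof -
    have B: "B \<in> sets R" "B \<subseteq> A" "emeasure R B \<le> ennreal t" using that by (auto simp: P_def)
    then have Bfin: "emeasure R B = ennreal (measure R B)" and Bt: "measure R B \<le> t"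
      using t measure_le_of_emeasure_le by blast+
    define \<C> where "\<C> = {C \<in> sets R. C \<subseteq> A - B \<and> emeasure R C \<le> ennreal (t - measure R B)}"
    have Cm: "emeasure R C = ennreal (measure R C)" "measure R C \<le> t - measure R B" if "C \<in> \<C>" for C
      using measure_le_of_emeasure_le[of R C "t - measure R B"] that Bt by (auto simp: \<C>_def)
    have ne: "{} \<in> \<C>" using Bt by (auto simp: \<C>_def)
    define s where "s = (SUP C\<in>\<C>. measure R C)"
    have bdd: "bdd_above (measure R ` \<C>)" using Cm by (auto intro!: bdd_aboveI2)
    have s: "measure R C \<le> s" if "C \<in> \<C>" for C
      unfolding s_def using bdd that by (rule cSUP_upper2[OF _ _ order_refl])
    obtain C where C: "C \<in> \<C>" "s \<le> 2 * measure R C"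
    proof (cases "s \<le> 0")
      case True
      then show ?thesis using that[OF ne] by simp
    next
      case False
      then have "s / 2 < s" by simp
      then obtain C where "C \<in> \<C>" "s / 2 < measure R C"
        unfolding s_def using bdd ne by (subst (asm) less_cSUP_iff) auto
      then show ?thesis using that[of C] by simp
    qed
    have CR: "C \<in> sets R" "C \<subseteq> A - B" using C by (auto simp: \<C>_def)
    have "emeasure R (B \<union> C) = emeasure R B + emeasure R C"
      using B CR by (intro plus_emeasure[symmetric]) auto
    also have "\<dots> = ennreal (measure R B + measure R C)" using Bfin Cm[OF C(1)] by simp
    finally have em: "emeasure R (B \<union> C) = ennreal (measure R B + measure R C)" .
    then have mm: "measure R (B \<union> C) = measure R B + measure R C"
      by (subst measure_def, subst em, intro enn2real_ennreal) simp
    have "ennreal (measure R B + measure R C) \<le> ennreal t"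
      using Cm(2)[OF C(1)] by (intro ennreal_leI) simp
    moreover have "B \<union> C \<in> sets R" "B \<union> C \<subseteq> A" using B CR by auto
    ultimately have "P (B \<union> C)" unfolding P_def em by blast
    moreover have "Q B (B \<union> C)" unfolding Q_def mm
    proof (intro conjI ballI impI)
      fix D assume "D \<in> sets R" "D \<subseteq> A - B" "emeasure R D \<le> ennreal (t - measure R B)"
      then have "D \<in> \<C>" by (simp add: \<C>_def)
      then show "measure R D \<le> 2 * (measure R B + measure R C - measure R B)"
        using s[of D] C by simp
    qed simp
    ultimately show ?thesis by blast
  qed
  have "P {}" using t by (simp add: P_def)
  then obtain B where B: "\<And>n. P (B n)" "\<And>n. Q (B n) (B (Suc n))"
    using dependent_nat_choice[of "\<lambda>_. P" "\<lambda>_. Q"] step by metis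
  have inc: "incseq B" using B(2) by (intro incseq_SucI) (auto simp: Q_def)
  have BR: "B n \<in> sets R" "B n \<subseteq> A" "emeasure R (B n) \<le> ennreal t" for n using B(1)[of n] by (auto simp: P_def)
  define U where "U = (\<Union>n. B n)"
  have U: "U \<in> sets R" "U \<subseteq> A" unfolding U_def using BR by auto
  have "emeasure R U = (SUP n. emeasure R (B n))"
    unfolding U_def using BR inc by (intro SUP_emeasure_incseq[symmetric]) auto
  then have Ut: "emeasure R U \<le> ennreal t" using BR by (auto intro: SUP_least)
  have "emeasure R U = ennreal t"
  proof (rule ccontr)
    assume neq: "emeasure R U \<noteq> ennreal t"
    have Ufin: "emeasure R U = ennreal (measure R U)"
      using measure_le_of_emeasure_le(1)[OF Ut t(1)] .
    with Ut neq t have lt: "measure R U < t" by (metis ennreal_le_iff order_less_le)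
    have "0 < emeasure R (A - U)"
    proof (rule ccontr)
      assume "\<not> ?thesis"
      then have "emeasure R A \<le> emeasure R U"
        using U A plus_emeasure[of U R "A - U"] by (auto simp: Un_absorb1)
      with t(2) Ut neq show False by (meson antisym order_trans)
    qed
    with non_atomic_small_subset[OF na, of "A - U" "t - measure R U"] lt A U
    obtain C where C: "C \<in> sets R" "C \<subseteq> A - U" "0 < emeasure R C" "emeasure R C < ennreal (t - measure R U)"
      by auto
    have Cfin: "emeasure R C = ennreal (measure R C)"
      using measure_le_of_emeasure_le(1)[of R C "t - measure R U"] C lt by auto
    then have Cpos: "0 < measure R C" using C by (auto simp: zero_less_measure_iff)
    have BU: "measure R (B n) \<le> measure R U" for n
      using BR Ufin U unfolding U_def by (intro measure_mono_fmeasurable) (auto simp: fmeasurable_def less_top)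
    \<comment> \<open>The leftover set \<open>C\<close> fits at every stage, so each greedy step
      gains at least half of its measure; infinitely many such gains exceed
      \<open>t\<close>.\<close>
    have inc2: "measure R C \<le> 2 * (measure R (B (Suc n)) - measure R (B n))" for n
    proof -
      have "emeasure R C \<le> ennreal (t - measure R (B n))"
        using C(4) BU[of n] by (meson diff_left_mono ennreal_leI less_imp_le order_trans)
      moreover have "C \<subseteq> A - B n" using C(2) by (auto simp: U_def)
      ultimately show ?thesis using B(2)[of n] C(1) unfolding Q_def by blast
    qed
    have "n * measure R C \<le> 2 * measure R (B n)" for n :: nat
    proof (induction n)
      case (Suc n)
      then show ?case using inc2[of n] by (simp add: algebra_simps)
    qed simp
    then have "n * measure R C \<le> 2 * t" for n :: nat
      using BU[of n] lt by (smt (verit))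
    moreover obtain n :: nat where "2 * t < n * measure R C"
      using Cpos reals_Archimedean3 by blast
    ultimately show False by (meson not_less)
  qed
  with U show ?thesis by blast
qed

section \<open>The decreasing rearrangement and its comparison with the functional K\<close>

definition rearr :: "'a measure \<Rightarrow> ('a \<Rightarrow> ennreal) \<Rightarrow> real \<Rightarrow> ennreal" where
  "rearr R g t = Inf {s. emeasure R {x \<in> space R. g x > s} \<le> ennreal t}"

lemma rearr_le: "emeasure R {x \<in> space R. g x > s} \<le> ennreal t \<Longrightarrow> rearr R g t \<le> s"
  unfolding rearr_def by (auto intro: Inf_lower)

lemma less_rearr: "s < rearr R g t \<Longrightarrow> ennreal t < emeasure R {x \<in> space R. g x > s}"
  using rearr_le[of R s g t] by (meson leD leI)

lemma rearr_ge:
  assumes "\<And>s. s < c \<Longrightarrow> ennreal t < emeasure R {x \<in> space R. g x > s}"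
  shows "c \<le> rearr R g t"
  unfolding rearr_def
proof (rule Inf_greatest)
  fix s assume "s \<in> {s. emeasure R {x \<in> space R. g x > s} \<le> ennreal t}"
  then show "c \<le> s" using assms[of s] by (meson leD leI mem_Collect_eq)
qed

lemma rearr_antimono: "t \<le> t' \<Longrightarrow> rearr R g t' \<le> rearr R g t"
  unfolding rearr_def by (intro Inf_superset_mono) (auto intro: order_trans ennreal_leI)

text \<open>The infimum in \<open>rearr\<close> is attained: along admissible levels decreasing to
  it, the superlevel sets increase to the superlevel set of the infimum, and measure is continuous
  from below.\<close>

lemma emeasure_gt_rearr:
  assumes [measurable]: "g \<in> borel_measurable R"
  shows "emeasure R {x \<in> space R. g x > rearr R g t} \<le> ennreal t"
proof -
  let ?A = "{s. emeasure R {x \<in> space R. g x > s} \<le> ennreal t}"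
  have "top \<in> ?A" by simp
  then have "?A \<noteq> {}" by blast
  from ennreal_Inf_countable_INF[OF this] obtain f :: "nat \<Rightarrow> ennreal" where f: "decseq f" "range f \<subseteq> ?A" "Inf ?A = (INF i. f i)"
    by (elim exE conjE)
  have "{x \<in> space R. g x > rearr R g t} = (\<Union>n. {x \<in> space R. g x > f n})"
    unfolding rearr_def f(3) by (auto simp: INF_less_iff)
  also have "emeasure R \<dots> = (SUP n. emeasure R {x \<in> space R. g x > f n})"
    using f(1) by (intro SUP_emeasure_incseq[symmetric])
      (auto simp: incseq_def decseq_def intro: order_le_less_trans)
  also have "\<dots> \<le> ennreal t" using f(2) by (intro SUP_least) auto
  finally show ?thesis .
qed

text \<open>The functional K(t, f) of the overview. On a non-atomic space it is the integral of f*
  over (0, t), that is, t f**(t), Peetre's K-functional for the pair of L^1 and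
  L^\<infinity>.\<close>

definition maxint :: "'a measure \<Rightarrow> real \<Rightarrow> ('a \<Rightarrow> ennreal) \<Rightarrow> ennreal" where
  "maxint R t g = (SUP E\<in>{E \<in> sets R. emeasure R E \<le> ennreal t}. \<integral>\<^sup>+x\<in>E. g x \<partial>R)"

lemma maxint_ge: "E \<in> sets R \<Longrightarrow> emeasure R E \<le> ennreal t \<Longrightarrow> (\<integral>\<^sup>+x\<in>E. g x \<partial>R) \<le> maxint R t g"
  unfolding maxint_def by (rule SUP_upper) simp

lemma suminf_ennreal_Suc: "(\<Sum>i. f i) = f 0 + (\<Sum>i. f (Suc i))" for f :: "nat \<Rightarrow> ennreal"
  using sums_Suc[OF summable_sums[of "\<lambda>i. f (Suc i)"]] by (auto simp: sums_iff add.commute)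

lemma ennreal_le_suminf: "f m \<le> (\<Sum>i. f i)" for f :: "nat \<Rightarrow> ennreal"
  using sum_le_suminf[of f "{m}"] by simp

text \<open>The levels f*(2^(j - i)) increase with i. If g x exceeds the one with index 0, take the
  least index whose level reaches g x: the preceding index is a layer containing x, and its
  coefficient is the level just reached. Points above all levels lie in sets of measure at most 2^(j
  - i) for every i, hence in a null set.\<close>

lemma AE_le_layers:
  fixes j :: real
  assumes [measurable]: "g \<in> borel_measurable R"
  shows "AE x in R. g x \<le> rearr R g (2 powr j) +
    (\<Sum>i. rearr R g (2 powr (j - real i - 1)) * indicator {x \<in> space R. g x > rearr R g (2 powr (j - real i))} x)"
proof -
  define N where "N = (\<Inter>i. {x \<in> space R. g x > rearr R g (2 powr (j - real i))})"
  have N[measurable]: "N \<in> sets R" unfolding N_def by measurable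
  have le: "emeasure R N \<le> ennreal (2 powr (j - real i))" for i
  proof -
    have "emeasure R N \<le> emeasure R {x \<in> space R. g x > rearr R g (2 powr (j - real i))}"
      unfolding N_def by (intro emeasure_mono) auto
    also have "\<dots> \<le> ennreal (2 powr (j - real i))" by (rule emeasure_gt_rearr) simp
    finally show ?thesis .
  qed
  have "(\<lambda>i. 2 powr (j - real i)) \<longlonglongrightarrow> 0" by real_asymp
  then have "(\<lambda>i. ennreal (2 powr (j - real i))) \<longlonglongrightarrow> ennreal 0" by (intro tendsto_ennrealI)
  then have "emeasure R N \<le> ennreal 0" using le by (intro LIMSEQ_le_const) auto
  then have "N \<in> null_sets R" by (auto simp: null_sets_def)
  then have "AE x in R. x \<notin> N" by (rule AE_not_in)
  then show ?thesis
  proof (rule AE_mp, intro AE_I2 impI)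
    fix x assume x: "x \<in> space R" "x \<notin> N"
    let ?f = "\<lambda>i. rearr R g (2 powr (j - real i - 1)) * indicator {x \<in> space R. g x > rearr R g (2 powr (j - real i))} x"
    show "g x \<le> rearr R g (2 powr j) + (\<Sum>i. ?f i)"
    proof (cases "g x \<le> rearr R g (2 powr j)")
      case True
      then show ?thesis by (simp add: add_increasing2)
    next
      case False
      define n where "n = (LEAST i. g x \<le> rearr R g (2 powr (j - real i)))"
      have ex: "\<exists>i. g x \<le> rearr R g (2 powr (j - real i))" using x by (auto simp: N_def not_less)
      have n: "g x \<le> rearr R g (2 powr (j - real n))" unfolding n_def using ex by (rule LeastI_ex)
      with False have "n \<noteq> 0" by (cases n) auto
      then obtain m where m: "n = Suc m" by (cases n) auto
      have "\<not> g x \<le> rearr R g (2 powr (j - real m))"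
        using not_less_Least[of m "\<lambda>i. g x \<le> rearr R g (2 powr (j - real i))"] m unfolding n_def by simp
      with n m x have "g x \<le> ?f m" by (simp add: algebra_simps)
      also have "\<dots> \<le> (\<Sum>i. ?f i)" by (rule ennreal_le_suminf)
      finally show ?thesis by (simp add: add_increasing)
    qed
  qed
qed

text \<open>Layer i has measure at most 2^(j - i) but carries the level with index i + 1. Writing
  2^(j - i) as twice 2^(j - i - 1) realigns the two, which is the origin of the factor 2.\<close>

lemma maxint_le:
  fixes j :: real
  assumes [measurable]: "g \<in> borel_measurable R"
  shows "maxint R (2 powr j) g \<le> 2 * (\<Sum>i. ennreal (2 powr (j - real i)) * rearr R g (2 powr (j - real i)))"
  unfolding maxint_def
proof (rule SUP_least)
  let ?a = "\<lambda>i. rearr R g (2 powr (j - real i))"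
  let ?G = "\<lambda>i. {x \<in> space R. g x > ?a i}"
  let ?c = "\<lambda>i. ennreal (2 powr (j - real i))"
  fix E assume "E \<in> {E \<in> sets R. emeasure R E \<le> ennreal (2 powr j)}"
  then have [measurable]: "E \<in> sets R" and E: "emeasure R E \<le> ennreal (2 powr j)" by auto
  have b: "rearr R g (2 powr (j - real i - 1)) = ?a (Suc i)" for i by (simp add: algebra_simps)
  have "(\<integral>\<^sup>+x\<in>E. g x \<partial>R) \<le> (\<integral>\<^sup>+x. ?a 0 * indicator E x + (\<Sum>i. ?a (Suc i) * indicator (?G i) x) \<partial>R)"
    using AE_le_layers[OF assms, of j] unfolding b
    by (intro nn_integral_mono_AE) (auto simp: indicator_def)
  also have "\<dots> = ?a 0 * emeasure R E + (\<Sum>i. ?a (Suc i) * emeasure R (?G i))"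
    by (simp add: nn_integral_add nn_integral_suminf nn_integral_cmult)
  also have "\<dots> \<le> ?a 0 * ?c 0 + (\<Sum>i. ?a (Suc i) * ?c i)"
    using E by (intro add_mono suminf_le mult_left_mono emeasure_gt_rearr) auto
  also have "\<dots> \<le> 2 * (?a 0 * ?c 0) + (\<Sum>i. 2 * (?a (Suc i) * ?c (Suc i)))"
  proof (intro add_mono suminf_le)
    have "?c i = 2 * ?c (Suc i)" for i
    proof -
      have "2 powr (j - real i) = 2 * 2 powr (j - real (Suc i))" by (simp add: powr_diff powr_add)
      then show ?thesis by (simp add: ennreal_mult)
    qed
    then show "?a (Suc i) * ?c i \<le> 2 * (?a (Suc i) * ?c (Suc i))" for i
      by (simp add: mult.left_commute)
    show "?a 0 * ?c 0 \<le> 2 * (?a 0 * ?c 0)" by (simp add: mult_2 add_increasing)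
  qed auto
  also have "\<dots> = (\<Sum>i. 2 * (?c i * ?a i))"
    using suminf_ennreal_Suc[of "\<lambda>i. 2 * (?c i * ?a i)"] by (simp add: mult.commute add.commute)
  finally show "(\<integral>\<^sup>+x\<in>E. g x \<partial>R) \<le> 2 * (\<Sum>i. ?c i * ?a i)" by simp
qed

text \<open>The levels are halved because \<open>{x. g x \<ge> rearr R g t}\<close> may have measure less than \<open>t\<close>, and
  truncated because \<open>rearr R g t\<close> may be infinite.\<close>
lemma layered_set:
  fixes j :: real
  assumes na: "non_atomic R" and inf: "emeasure R (space R) = \<infinity>"
    and [measurable]: "g \<in> borel_measurable R" and M: "0 \<le> M"
  shows "\<exists>E\<in>sets R. emeasure R E = ennreal (2 powr j) \<and>
    (\<Sum>i<n. ennreal (2 powr (j - real i - 1)) * min (ennreal (1/2) * rearr R g (2 powr (j - real i))) (ennreal M))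
      \<le> (\<integral>\<^sup>+x\<in>E. g x \<partial>R)"
proof (induction n arbitrary: j)
  case 0
  then show ?case using non_atomic_subset_emeasure[OF na, of "space R" "2 powr j"] inf by auto
next
  case (Suc n)
  from Suc.IH[of "j - 1"] obtain E where E[measurable]: "E \<in> sets R"
    and Em: "emeasure R E = ennreal (2 powr (j - 1))"
    and Eint: "(\<Sum>i<n. ennreal (2 powr (j - 1 - real i - 1)) *
        min (ennreal (1/2) * rearr R g (2 powr (j - 1 - real i))) (ennreal M)) \<le> (\<integral>\<^sup>+x\<in>E. g x \<partial>R)" by blast
  define a where "a = rearr R g (2 powr j)"
  define s where "s = min (ennreal (1/2) * a) (ennreal M)"
  define F where "F = {x \<in> space R. g x \<ge> s}"
  have [measurable]: "F \<in> sets R" unfolding F_def by measurable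
  have F: "ennreal (2 powr j) \<le> emeasure R F"
  proof (cases "a = 0")
    case True
    then show ?thesis using inf by (simp add: F_def s_def)
  next
    case False
    have "s < a"
    proof (cases a)
      case (real r)
      then have "0 < r" using False by (cases "r = 0") auto
      have "s \<le> ennreal (1/2) * a" by (simp only: s_def min.cobounded1)
      also have "\<dots> = ennreal (1/2 * r)"
        unfolding real using \<open>0 < r\<close> by (intro ennreal_mult[symmetric]) auto
      also have "\<dots> < a" using real \<open>0 < r\<close> by (simp add: ennreal_lessI)
      finally show ?thesis .
    next
      case top
      have "s \<le> ennreal M" by (simp add: s_def)
      also have "\<dots> < a" using top by simp
      finally show ?thesis .
    qed
    then have "ennreal (2 powr j) \<le> emeasure R {x \<in> space R. g x > s}"
      unfolding a_def by (intro less_imp_le less_rearr)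
    also have "\<dots> \<le> emeasure R F" unfolding F_def by (intro emeasure_mono) auto
    finally show ?thesis .
  qed
  \<comment> \<open>\<open>F\<close> has measure at least 2^j and \<open>E\<close> only 2^(j - 1),
    so there is room in \<open>F - E\<close> for a new piece of measure 2^(j - 1) on which g is at
    least s.\<close>
  have "ennreal (2 powr (j - 1)) + ennreal (2 powr (j - 1)) = ennreal (2 powr j)"
    by (simp add: powr_diff flip: ennreal_plus)
  also have "\<dots> \<le> emeasure R ((F - E) \<union> E)"
    using F by (rule order_trans) (intro emeasure_mono, auto)
  also have "\<dots> \<le> emeasure R (F - E) + ennreal (2 powr (j - 1))"
    unfolding Em[symmetric] by (rule emeasure_subadditive) auto
  finally have "ennreal (2 powr (j - 1)) \<le> emeasure R (F - E)"
    by (simp add: add.commute)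
  from non_atomic_subset_emeasure[OF na _ _ this]
  obtain D where [measurable]: "D \<in> sets R" and D: "D \<subseteq> F - E" "emeasure R D = ennreal (2 powr (j - 1))"
    by auto
  have "emeasure R (E \<union> D) = ennreal (2 powr (j - 1)) + ennreal (2 powr (j - 1))"
    using D Em by (subst plus_emeasure[symmetric]) auto
  then have m: "emeasure R (E \<union> D) = ennreal (2 powr j)"
    by (simp add: powr_diff flip: ennreal_plus)
  have eq: "(\<Sum>i<n. ennreal (2 powr (j - 1 - real i - 1)) * min (ennreal (1/2) * rearr R g (2 powr (j - 1 - real i))) (ennreal M))
    = (\<Sum>i<n. ennreal (2 powr (j - real (Suc i) - 1)) * min (ennreal (1/2) * rearr R g (2 powr (j - real (Suc i)))) (ennreal M))"
    by (intro sum.cong) (auto simp: algebra_simps)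
  have "(\<Sum>i<Suc n. ennreal (2 powr (j - real i - 1)) * min (ennreal (1/2) * rearr R g (2 powr (j - real i))) (ennreal M))
    \<le> s * emeasure R D + (\<integral>\<^sup>+x\<in>E. g x \<partial>R)"
    unfolding sum.lessThan_Suc_shift D using Eint unfolding eq
    by (intro add_mono) (auto simp: s_def a_def mult.commute)
  also have "\<dots> = (\<integral>\<^sup>+x. s * indicator D x + g x * indicator E x \<partial>R)"
    by (simp add: nn_integral_add nn_integral_cmult)
  also have "\<dots> \<le> (\<integral>\<^sup>+x\<in>E \<union> D. g x \<partial>R)"
    using D by (intro nn_integral_mono) (auto simp: indicator_def F_def)
  finally show ?case using m by (intro bexI[of _ "E \<union> D"]) auto
qed

text \<open>The constant 4 undoes two halvings in \<open>layered_set\<close>, one of the measures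
  and one of the levels. If all levels are finite, \<open>M\<close> is taken so large that the
  truncation is void; if one is infinite, suitable \<open>M\<close> push the supremum above every
  finite \<open>k\<close>.\<close>

lemma maxint_lower:
  fixes j :: real
  assumes na: "non_atomic R" and inf: "emeasure R (space R) = \<infinity>"
    and g: "g \<in> borel_measurable R"
  shows "(\<Sum>i<n. ennreal (2 powr (j - real i)) * rearr R g (2 powr (j - real i))) \<le> 4 * maxint R (2 powr j) g"
proof -
  let ?a = "\<lambda>i. rearr R g (2 powr (j - real i))"
  have trunc: "(\<Sum>i<n. ennreal (2 powr (j - real i - 1)) * min (ennreal (1/2) * ?a i) (ennreal M)) \<le> maxint R (2 powr j) g"
    if "0 \<le> M" for M
    using layered_set[OF na inf g that, where j=j and n=n] maxint_ge[of _ R "2 powr j" g]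
    by (metis (no_types, lifting) order_refl order_trans)
  show ?thesis
  proof (cases "\<exists>i<n. ?a i = top")
    case True
    then obtain i where i: "i < n" "?a i = top" by blast
    have "maxint R (2 powr j) g = top"
    proof (rule ccontr)
      assume "\<not> ?thesis"
      then obtain k where k: "maxint R (2 powr j) g = ennreal k" "0 \<le> k" by (cases "maxint R (2 powr j) g") auto
      define c where "c = 2 powr (j - real i - 1)"
      have c: "0 < c" by (simp add: c_def)
      have "ennreal c * min (ennreal (1/2) * ?a i) (ennreal ((k + 1) / c))
         \<le> (\<Sum>i<n. ennreal (2 powr (j - real i - 1)) * min (ennreal (1/2) * ?a i) (ennreal ((k + 1) / c)))"
        unfolding c_def using i by (intro member_le_sum) auto
      also have "\<dots> \<le> ennreal k" unfolding k(1)[symmetric] using k c by (intro trunc) auto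
      finally have "ennreal (k + 1) \<le> ennreal k"
        using i c k by (simp add: ennreal_mult_top flip: ennreal_mult)
      then show False using k by (simp del: ennreal_plus)
    qed
    then show ?thesis by (simp add: ennreal_mult_top)
  next
    case False
    define S where "S = (\<Sum>i<n. ennreal (1/2) * ?a i)"
    have "ennreal (1/2) * ?a i < top" if "i < n" for i
      using False that by (intro ennreal_mult_less_top[THEN iffD2] disjI2 conjI ennreal_less_top) (auto simp: less_top)
    then have "S < top" unfolding S_def by simp
    then obtain M where M: "S = ennreal M" "0 \<le> M" by (cases S) auto
    have le: "ennreal (1/2) * ?a i \<le> ennreal M" if "i < n" for i
      unfolding M(1)[symmetric] S_def using that by (intro member_le_sum) auto
    have h: "ennreal (2 powr (j - real i - 1)) * (ennreal (1/2) * ?a i) = ennreal (1/4) * (ennreal (2 powr (j - real i)) * ?a i)" for i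
    proof -
      have "2 powr (j - real i - 1) * (1/2) = 1/4 * 2 powr (j - real i)" by (simp add: powr_diff)
      then have "ennreal (2 powr (j - real i - 1)) * ennreal (1/2) = ennreal (1/4) * ennreal (2 powr (j - real i))"
        by (metis ennreal_mult powr_ge_zero zero_le_divide_1_iff zero_le_numeral)
      then show ?thesis by (simp only: mult.assoc[symmetric])
    qed
    have "(\<Sum>i<n. ennreal (2 powr (j - real i)) * ?a i)
       = 4 * (\<Sum>i<n. ennreal (1/4) * (ennreal (2 powr (j - real i)) * ?a i))"
    proof -
      have "4 * ennreal (1/4) = 1"
        using ennreal_mult[of 4 "1/4"] by simp
      then show ?thesis
        unfolding sum_distrib_left[symmetric] mult.assoc[symmetric, of 4 "ennreal (1/4)"] by simp
    qed
    also have "(\<Sum>i<n. ennreal (1/4) * (ennreal (2 powr (j - real i)) * ?a i)) =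
       (\<Sum>i<n. ennreal (2 powr (j - real i - 1)) * min (ennreal (1/2) * ?a i) (ennreal M))"
      by (intro sum.cong refl, subst min_absorb1) (auto simp only: lessThan_iff h intro: le)
    also have "\<dots> \<le> maxint R (2 powr j) g" by (rule trunc) fact
    finally show ?thesis by (simp add: mult_left_mono)
  qed
qed

section \<open>Seminorms with the Fatou property\<close>

text \<open>The axioms that survive suprema and weighted l^q sums: (P1) without definiteness, (P2),
  and the nontrivial half of (P3), the other half being monotonicity. Definiteness, (P4) and (P5)
  depend on the particular functional.\<close>

definition fatou_seminorm :: "'a measure \<Rightarrow> (('a \<Rightarrow> ennreal) \<Rightarrow> ennreal) \<Rightarrow> bool" where
  "fatou_seminorm R n \<longleftrightarrow>
     (\<forall>a::real. 0 \<le> a \<longrightarrow> (\<forall>g\<in>borel_measurable R. n (\<lambda>x. ennreal a * g x) = ennreal a * n g)) \<and>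
     (\<forall>g\<in>borel_measurable R. \<forall>h\<in>borel_measurable R. n (\<lambda>x. g x + h x) \<le> n g + n h) \<and>
     (\<forall>g\<in>borel_measurable R. \<forall>h\<in>borel_measurable R. (AE x in R. g x \<le> h x) \<longrightarrow> n g \<le> n h) \<and>
     (\<forall>u g. (\<forall>k::nat. u k \<in> borel_measurable R) \<and> g \<in> borel_measurable R \<and>
        (AE x in R. incseq (\<lambda>k. u k x) \<and> (\<lambda>k. u k x) \<longlonglongrightarrow> g x) \<longrightarrow> n g \<le> (SUP k. n (u k)))"

lemma
  assumes "fatou_seminorm R n"
  shows fatou_seminorm_cmult: "0 \<le> a \<Longrightarrow> g \<in> borel_measurable R \<Longrightarrow> n (\<lambda>x. ennreal a * g x) = ennreal a * n g"
    and fatou_seminorm_add: "g \<in> borel_measurable R \<Longrightarrow> h \<in> borel_measurable R \<Longrightarrow> n (\<lambda>x. g x + h x) \<le> n g + n h"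
    and fatou_seminorm_mono: "g \<in> borel_measurable R \<Longrightarrow> h \<in> borel_measurable R \<Longrightarrow> AE x in R. g x \<le> h x \<Longrightarrow> n g \<le> n h"
    and fatou_seminorm_SUP_ge: "(\<And>k::nat. u k \<in> borel_measurable R) \<Longrightarrow> g \<in> borel_measurable R \<Longrightarrow>
        AE x in R. incseq (\<lambda>k. u k x) \<and> (\<lambda>k. u k x) \<longlonglongrightarrow> g x \<Longrightarrow> n g \<le> (SUP k. n (u k))"
  using assms unfolding fatou_seminorm_def by blast+

lemma fatou_seminorm_incseq:
  assumes n: "fatou_seminorm R n" and u: "\<And>k::nat. u k \<in> borel_measurable R"
    and lim: "AE x in R. incseq (\<lambda>k. u k x) \<and> (\<lambda>k. u k x) \<longlonglongrightarrow> g x"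
  shows "incseq (\<lambda>k. n (u k))"
proof (rule incseq_SucI)
  fix k
  have "AE x in R. u k x \<le> u (Suc k) x" using lim by eventually_elim (auto simp: incseq_def)
  then show "n (u k) \<le> n (u (Suc k))" by (intro fatou_seminorm_mono[OF n] u)
qed

lemma fatou_seminorm_set_integral:
  fixes R :: "'a measure"
  assumes [measurable]: "E \<in> sets R"
  shows "fatou_seminorm R (\<lambda>g. \<integral>\<^sup>+x\<in>E. g x \<partial>R)"
  unfolding fatou_seminorm_def
proof (intro conjI allI ballI impI)
  fix a :: real and g :: "'a \<Rightarrow> ennreal" assume [measurable]: "g \<in> borel_measurable R"
  show "(\<integral>\<^sup>+x\<in>E. ennreal a * g x \<partial>R) = ennreal a * (\<integral>\<^sup>+x\<in>E. g x \<partial>R)"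
    by (simp add: mult.assoc nn_integral_cmult)
next
  fix g h :: "'a \<Rightarrow> ennreal" assume [measurable]: "g \<in> borel_measurable R" "h \<in> borel_measurable R"
  show "(\<integral>\<^sup>+x\<in>E. g x + h x \<partial>R) \<le> (\<integral>\<^sup>+x\<in>E. g x \<partial>R) + (\<integral>\<^sup>+x\<in>E. h x \<partial>R)"
    by (simp add: distrib_right nn_integral_add)
next
  fix g h :: "'a \<Rightarrow> ennreal" assume "AE x in R. g x \<le> h x"
  then show "(\<integral>\<^sup>+x\<in>E. g x \<partial>R) \<le> (\<integral>\<^sup>+x\<in>E. h x \<partial>R)"
    by (intro nn_integral_mono_AE) (auto elim!: eventually_mono intro: mult_right_mono)
next
  fix u :: "nat \<Rightarrow> 'a \<Rightarrow> ennreal" and g :: "'a \<Rightarrow> ennreal"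
  assume "(\<forall>k. u k \<in> borel_measurable R) \<and> g \<in> borel_measurable R \<and>
        (AE x in R. incseq (\<lambda>k. u k x) \<and> (\<lambda>k. u k x) \<longlonglongrightarrow> g x)"
  then have [measurable]: "\<And>k. u k \<in> borel_measurable R" "g \<in> borel_measurable R"
    and ae: "AE x in R. incseq (\<lambda>k. u k x) \<and> (\<lambda>k. u k x) \<longlonglongrightarrow> g x" by auto
  have "(\<integral>\<^sup>+x\<in>E. g x \<partial>R) = (\<integral>\<^sup>+x. (SUP k. u k x * indicator E x) \<partial>R)"
  proof (rule nn_integral_cong_AE)
    show "AE x in R. g x * indicator E x = (SUP k. u k x * indicator E x)"
      using ae
    proof eventually_elim
      case (elim x)
      then have "g x = (SUP k. u k x)" using LIMSEQ_SUP LIMSEQ_unique by blast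
      then show ?case by (simp add: SUP_mult_right_ennreal)
    qed
  qed
  also have "\<dots> = (SUP k. \<integral>\<^sup>+x\<in>E. u k x \<partial>R)"
    using ae
    by (intro nn_integral_monotone_convergence_SUP_AE)
      (auto elim!: eventually_mono simp: incseq_def intro!: mult_right_mono)
  finally show "(\<integral>\<^sup>+x\<in>E. g x \<partial>R) \<le> (SUP k. \<integral>\<^sup>+x\<in>E. u k x \<partial>R)" by simp
qed

lemma fatou_seminorm_SUP:
  fixes R :: "'a measure"
  assumes n: "\<And>i. i \<in> I \<Longrightarrow> fatou_seminorm R (n i)"
  shows "fatou_seminorm R (\<lambda>g. SUP i\<in>I. n i g)"
  unfolding fatou_seminorm_def
proof (intro conjI allI ballI impI)
  fix a :: real and g :: "'a \<Rightarrow> ennreal" assume "0 \<le> a" "g \<in> borel_measurable R"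
  then show "(SUP i\<in>I. n i (\<lambda>x. ennreal a * g x)) = ennreal a * (SUP i\<in>I. n i g)"
    unfolding SUP_mult_left_ennreal by (intro SUP_cong refl fatou_seminorm_cmult[OF n])
next
  fix g h :: "'a \<Rightarrow> ennreal" assume *: "g \<in> borel_measurable R" "h \<in> borel_measurable R"
  show "(SUP i\<in>I. n i (\<lambda>x. g x + h x)) \<le> (SUP i\<in>I. n i g) + (SUP i\<in>I. n i h)"
  proof (rule SUP_least)
    fix i assume "i \<in> I"
    then have "n i (\<lambda>x. g x + h x) \<le> n i g + n i h" by (rule fatou_seminorm_add[OF n *])
    also have "\<dots> \<le> (SUP i\<in>I. n i g) + (SUP i\<in>I. n i h)"
      using \<open>i \<in> I\<close> by (intro add_mono SUP_upper)
    finally show "n i (\<lambda>x. g x + h x) \<le> (SUP i\<in>I. n i g) + (SUP i\<in>I. n i h)" .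
  qed
next
  fix g h :: "'a \<Rightarrow> ennreal"
  assume "g \<in> borel_measurable R" "h \<in> borel_measurable R" "AE x in R. g x \<le> h x"
  then show "(SUP i\<in>I. n i g) \<le> (SUP i\<in>I. n i h)"
    by (intro SUP_mono) (auto intro: fatou_seminorm_mono[OF n])
next
  fix u :: "nat \<Rightarrow> 'a \<Rightarrow> ennreal" and g :: "'a \<Rightarrow> ennreal"
  assume *: "(\<forall>k. u k \<in> borel_measurable R) \<and> g \<in> borel_measurable R \<and>
        (AE x in R. incseq (\<lambda>k. u k x) \<and> (\<lambda>k. u k x) \<longlonglongrightarrow> g x)"
  have "(SUP i\<in>I. n i g) \<le> (SUP i\<in>I. SUP k. n i (u k))"
  proof (rule SUP_mono)
    fix i assume "i \<in> I"
    with * show "\<exists>j\<in>I. n i g \<le> (SUP k. n j (u k))"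
      by (intro bexI[of _ i] fatou_seminorm_SUP_ge[OF n]) blast+
  qed
  also have "\<dots> = (SUP k. SUP i\<in>I. n i (u k))" by (rule SUP_commute)
  finally show "(SUP i\<in>I. n i g) \<le> (SUP k. SUP i\<in>I. n i (u k))" .
qed

text \<open>Subadditivity is Minkowski's inequality, where \<open>q \<ge> 1\<close> enters; the
  Fatou property is monotone convergence in l^q.\<close>

lemma fatou_seminorm_lq:
  fixes R :: "'a measure"
  assumes q: "1 \<le> q" and n: "\<And>k. fatou_seminorm R (n k)"
  shows "fatou_seminorm R (\<lambda>g. lq q (\<lambda>k. c k * n k g))"
  unfolding fatou_seminorm_def
proof (intro conjI allI ballI impI)
  have q0: "0 < q" by (rule exponent_pos_of_ge_1[OF q])
  {
    fix a :: real and g :: "'a \<Rightarrow> ennreal" assume "0 \<le> a" "g \<in> borel_measurable R"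
    then show "lq q (\<lambda>k. c k * n k (\<lambda>x. ennreal a * g x)) = ennreal a * lq q (\<lambda>k. c k * n k g)"
      by (simp add: fatou_seminorm_cmult[OF n] lq_cmult[OF q0, symmetric] mult.left_commute)
  next
    fix g h :: "'a \<Rightarrow> ennreal" assume *: "g \<in> borel_measurable R" "h \<in> borel_measurable R"
    have "lq q (\<lambda>k. c k * n k (\<lambda>x. g x + h x)) \<le> lq q (\<lambda>k. c k * n k g + c k * n k h)"
      using fatou_seminorm_add[OF n *] by (intro lq_mono[OF q0]) (auto simp flip: distrib_left intro: mult_left_mono)
    also have "\<dots> \<le> lq q (\<lambda>k. c k * n k g) + lq q (\<lambda>k. c k * n k h)" by (rule lq_triangle[OF q])
    finally show "lq q (\<lambda>k. c k * n k (\<lambda>x. g x + h x)) \<le> lq q (\<lambda>k. c k * n k g) + lq q (\<lambda>k. c k * n k h)" .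
  next
    fix g h :: "'a \<Rightarrow> ennreal"
    assume "g \<in> borel_measurable R" "h \<in> borel_measurable R" "AE x in R. g x \<le> h x"
    then show "lq q (\<lambda>k. c k * n k g) \<le> lq q (\<lambda>k. c k * n k h)"
      by (intro lq_mono[OF q0] mult_left_mono fatou_seminorm_mono[OF n]) auto
  next
    fix u :: "nat \<Rightarrow> 'a \<Rightarrow> ennreal" and g :: "'a \<Rightarrow> ennreal"
    assume *: "(\<forall>k. u k \<in> borel_measurable R) \<and> g \<in> borel_measurable R \<and>
          (AE x in R. incseq (\<lambda>k. u k x) \<and> (\<lambda>k. u k x) \<longlonglongrightarrow> g x)"
    then have inc: "incseq (\<lambda>m. n k (u m))" for k
      by (intro fatou_seminorm_incseq[OF n, where g=g]) auto
    have "lq q (\<lambda>k. c k * n k g) \<le> lq q (\<lambda>k. SUP m. c k * n k (u m))"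
      unfolding SUP_mult_left_ennreal[symmetric]
      using * by (intro lq_mono[OF q0] mult_left_mono fatou_seminorm_SUP_ge[OF n]) auto
    also have "\<dots> = (SUP m. lq q (\<lambda>k. c k * n k (u m)))"
      using inc by (intro lq_SUP[OF q0]) (auto simp: incseq_def le_fun_def intro!: mult_left_mono)
    finally show "lq q (\<lambda>k. c k * n k g) \<le> (SUP m. lq q (\<lambda>k. c k * n k (u m)))" .
  }
qed

lemma fatou_seminorm_maxint: "fatou_seminorm R (maxint R t)"
  unfolding maxint_def by (intro fatou_seminorm_SUP fatou_seminorm_set_integral) auto

section \<open>From seminorms on non-negative functions to Banach function norms\<close>

lemma modulus_ecomplex_of_ennreal [simp]: "modulus (ecomplex_of_ennreal x) = x"
  by (cases x) (auto simp: ecomplex_of_ennreal_def)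

text \<open>Sublevel sets at levels below \<open>top\<close> avoid \<open>Infty\<close> and are
  images of Borel sets of the plane, which are the generators of
  \<open>ecomplex_borel\<close>.\<close>

lemma borel_measurable_modulus: "modulus \<in> borel_measurable ecomplex_borel"
proof (rule borel_measurableI_le)
  have space: "space ecomplex_borel = UNIV" by (simp add: ecomplex_borel_def space_measure_of_conv)
  fix y :: ennreal
  show "{x \<in> space ecomplex_borel. modulus x \<le> y} \<in> sets ecomplex_borel"
  proof (cases "y = top")
    case True
    then show ?thesis by (metis (mono_tags, lifting) Collect_cong Collect_mem_eq sets.top top_greatest)
  next
    case False
    have "{x. modulus x \<le> y} = Finite ` {z. ennreal (norm z) \<le> y}"
    proof (rule set_eqI)
      fix x show "x \<in> {x. modulus x \<le> y} \<longleftrightarrow> x \<in> Finite ` {z. ennreal (norm z) \<le> y}"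
        using False by (cases x) (auto simp: top_unique)
    qed
    moreover have "{z::complex. ennreal (norm z) \<le> y} \<in> sets borel" by measurable
    ultimately show ?thesis unfolding space by (simp add: ecomplex_borel_def)
  qed
qed

lemma measurable_ecomplex_of_ennreal: "ecomplex_of_ennreal \<in> borel \<rightarrow>\<^sub>M ecomplex_borel"
  unfolding ecomplex_borel_def
proof (rule measurable_measure_of)
  fix y :: "ecomplex set" assume "y \<in> (`) Finite ` sets borel"
  then obtain B where B[measurable]: "B \<in> sets borel" and y: "y = Finite ` B" by auto
  have "ecomplex_of_ennreal -` y \<inter> space borel = {x. x \<noteq> top \<and> complex_of_real (enn2real x) \<in> B}"
    by (auto simp: y ecomplex_of_ennreal_def split: if_splits)
  also have "\<dots> \<in> sets borel" by measurable
  finally show "ecomplex_of_ennreal -` y \<inter> space borel \<in> sets borel" .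
qed auto

lemma modulus_comp_measurable: "f \<in> Mfun R \<Longrightarrow> modulus \<circ> f \<in> borel_measurable R"
  unfolding Mfun_def by (rule measurable_comp[OF _ borel_measurable_modulus])

lemma ecomplex_comp_Mfun: "g \<in> borel_measurable R \<Longrightarrow> ecomplex_of_ennreal \<circ> g \<in> Mfun R"
  unfolding Mfun_def by (rule measurable_comp[OF _ measurable_ecomplex_of_ennreal])

lemma modulus_comp_ecomplex [simp]: "modulus \<circ> (ecomplex_of_ennreal \<circ> g) = g"
  by (simp add: fun_eq_iff)

text \<open>Control of \<open>maxint\<close> at powers of 2 gives (P5), since every finite measure
  lies below such a power. Definiteness then follows from sigma-finiteness: if n g = 0, the
  integrals of g over the sets of a countable cover vanish.\<close>

lemma banach_function_norm_of_seminorm: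
  assumes sf: "sigma_finite_measure R" and n: "fatou_seminorm R n"
    and fin: "\<And>E. E \<in> sets R \<Longrightarrow> emeasure R E < \<infinity> \<Longrightarrow> n (indicator E) < \<infinity>"
    and int: "\<And>j::int. \<exists>C<\<infinity>. \<forall>g\<in>borel_measurable R. maxint R (2 powr j) g \<le> C * n g"
  shows "banach_function_norm R (\<lambda>f. n (modulus \<circ> f))"
proof -
  interpret sigma_finite_measure R by fact
  have P5: "\<exists>C<\<infinity>. \<forall>g\<in>borel_measurable R. (\<integral>\<^sup>+x\<in>E. g x \<partial>R) \<le> C * n g"
    if E: "E \<in> sets R" "emeasure R E < \<infinity>" for E
  proof -
    obtain e where e: "emeasure R E = ennreal e" "0 \<le> e" using E by (cases "emeasure R E") auto
    obtain j :: nat where "e < 2 ^ j" using real_arch_pow[of 2 e] by auto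
    then have "emeasure R E \<le> ennreal (2 powr (int j))"
      using e by (simp add: powr_realpow)
    then show ?thesis using int[of "int j"] maxint_ge[OF E(1), of "2 powr (int j)"]
      by (meson order_trans)
  qed
  have zero: "n g = 0 \<longleftrightarrow> (AE x in R. g x = 0)" if g[measurable]: "g \<in> borel_measurable R" for g
  proof
    assume n0: "n g = 0"
    obtain A :: "nat \<Rightarrow> 'a set" where A: "range A \<subseteq> sets R" "(\<Union>i. A i) = space R" "\<And>i. emeasure R (A i) \<noteq> \<infinity>"
      using sigma_finite by blast
    have "AE x in R. g x * indicator (A i) x = 0" for i
    proof -
      have [measurable]: "A i \<in> sets R" using A by auto
      obtain C where "(\<integral>\<^sup>+x\<in>A i. g x \<partial>R) \<le> C * n g"
        using P5[of "A i"] g A(3)[of i] unfolding infinity_ennreal_def less_top by (metis \<open>A i \<in> sets R\<close>)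
      then have "(\<integral>\<^sup>+x\<in>A i. g x \<partial>R) = 0" using n0 by simp
      then show ?thesis by (subst (asm) nn_integral_0_iff_AE) auto
    qed
    then have "AE x in R. \<forall>i. g x * indicator (A i) x = 0" by (subst AE_all_countable) blast
    then show "AE x in R. g x = 0"
    proof (rule AE_mp, intro AE_I2 impI)
      fix x assume "x \<in> space R" "\<forall>i. g x * indicator (A i) x = 0"
      moreover from \<open>x \<in> space R\<close> A(2) obtain i where "x \<in> A i" by blast
      ultimately show "g x = 0" by (metis indicator_simps(1) mult.right_neutral)
    qed
  next
    assume "AE x in R. g x = 0"
    then have "n g \<le> n (\<lambda>x. ennreal 0 * g x)"
      by (intro fatou_seminorm_mono[OF n]) (auto elim: eventually_mono)
    also have "\<dots> = ennreal 0 * n g" by (rule fatou_seminorm_cmult[OF n _ g]) simp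
    finally show "n g = 0" by simp
  qed
  show ?thesis
    unfolding banach_function_norm_def Let_def modulus_comp_ecomplex
  proof (intro conjI allI ballI impI)
    fix u :: "nat \<Rightarrow> 'a \<Rightarrow> ennreal" and g :: "'a \<Rightarrow> ennreal"
    assume *: "(\<forall>k. u k \<in> borel_measurable R) \<and> g \<in> borel_measurable R \<and>
          (AE x in R. incseq (\<lambda>k. u k x) \<and> (\<lambda>k. u k x) \<longlonglongrightarrow> g x)"
    then show inc: "incseq (\<lambda>k. n (u k))"
      by (intro fatou_seminorm_incseq[OF n, where g=g]) auto
    have "n (u k) \<le> n g" for k
    proof (rule fatou_seminorm_mono[OF n])
      from * have "AE x in R. incseq (\<lambda>k. u k x) \<and> (\<lambda>k. u k x) \<longlonglongrightarrow> g x" by simp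
      then show "AE x in R. u k x \<le> g x" by eventually_elim (auto intro: incseq_le)
    qed (use * in auto)
    then have "(SUP k. n (u k)) = n g"
      using * by (intro antisym SUP_least fatou_seminorm_SUP_ge[OF n]) auto
    then show "(\<lambda>k. n (u k)) \<longlonglongrightarrow> n g" using LIMSEQ_SUP[OF inc] by simp
  qed (use fatou_seminorm_cmult[OF n] fatou_seminorm_add[OF n] fatou_seminorm_mono[OF n] zero fin P5 in auto)
qed

section \<open>Discretization\<close>

lemma ennreal_mult_leD:
  assumes "ennreal c * ennreal x \<le> ennreal C * ennreal y" "0 \<le> c" "0 \<le> x" "0 \<le> C" "0 \<le> y"
  shows "c * x \<le> C * y"
proof -
  have "ennreal (c * x) \<le> ennreal (C * y)"
    using assms by (simp only: ennreal_mult)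
  then show ?thesis using assms by simp
qed

text \<open>A Potter-type bound: the non-decreasing comparison function for t^e b(t) handles
  \<open>s \<le> t\<close>, the non-increasing one for t^(-e) b(t) handles
  \<open>s > t\<close>.\<close>

lemma slowly_varying_bound:
  assumes sv: "slowly_varying b" and "0 < e"
  shows "\<exists>C>0. \<forall>s>0. \<forall>t>0. b s \<le> C * max (s / t) (t / s) powr e * b t"
proof -
  have pos: "0 < b t" if "0 < t" for t using sv that by (simp add: slowly_varying_def)
  obtain g where g: "mono_on {0<..} g" "equivalent_on {0<..} (\<lambda>t. ennreal (t powr e * b t)) g"
    using sv \<open>0 < e\<close> unfolding slowly_varying_def by blast
  obtain h where h: "antimono_on {0<..} h" "equivalent_on {0<..} (\<lambda>t. ennreal (t powr (- e) * b t)) h"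
    using sv \<open>0 < e\<close> unfolding slowly_varying_def by blast
  obtain c1 C1 where c1: "0 < c1" "c1 \<le> C1"
    and g': "\<And>t. 0 < t \<Longrightarrow> ennreal c1 * ennreal (t powr e * b t) \<le> g t"
      "\<And>t. 0 < t \<Longrightarrow> g t \<le> ennreal C1 * ennreal (t powr e * b t)"
    using g(2) unfolding equivalent_on_def by auto
  obtain c2 C2 where c2: "0 < c2" "c2 \<le> C2"
    and h': "\<And>t. 0 < t \<Longrightarrow> ennreal c2 * ennreal (t powr (- e) * b t) \<le> h t"
      "\<And>t. 0 < t \<Longrightarrow> h t \<le> ennreal C2 * ennreal (t powr (- e) * b t)"
    using h(2) unfolding equivalent_on_def by auto
  define C where "C = C1 / c1 + C2 / c2"
  have C: "0 < C" "C1 / c1 \<le> C" "C2 / c2 \<le> C" using c1 c2 by (auto simp: C_def add_pos_pos)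
  have "b s \<le> C * max (s / t) (t / s) powr e * b t" if st: "0 < s" "0 < t" for s t
  proof -
    have *: "C' * x powr e * b t \<le> C * max (s / t) (t / s) powr e * b t"
      if "C' \<le> C" "0 \<le> x" "x \<le> max (s / t) (t / s)" for C' x
      using that C st pos[of t] \<open>0 < e\<close> by (intro mult_mono powr_mono2) auto
    show ?thesis
    proof (cases "s \<le> t")
      case True
      have "ennreal c1 * ennreal (s powr e * b s) \<le> ennreal C1 * ennreal (t powr e * b t)"
        using g'(1)[of s] g'(2)[of t] monotone_onD[OF g(1), of s t] st True by (auto intro: order_trans)
      then have "c1 * (s powr e * b s) \<le> C1 * (t powr e * b t)"
        using c1 st pos by (intro ennreal_mult_leD) (auto simp: less_imp_le)
      then have "b s \<le> C1 / c1 * (t / s) powr e * b t"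
        using c1 st by (simp add: powr_divide field_simps)
      with *[of "C1 / c1" "t / s"] C st show ?thesis by simp
    next
      case False
      have "ennreal c2 * ennreal (s powr (- e) * b s) \<le> ennreal C2 * ennreal (t powr (- e) * b t)"
        using h'(1)[of s] h'(2)[of t] monotone_onD[OF h(1), of t s] st False by (auto intro: order_trans)
      then have "c2 * (s powr (- e) * b s) \<le> C2 * (t powr (- e) * b t)"
        using c2 st pos by (intro ennreal_mult_leD) (auto simp: less_imp_le)
      then have "b s \<le> C2 / c2 * (s / t) powr e * b t"
        using c2 st by (simp add: powr_divide powr_minus field_simps)
      with *[of "C2 / c2" "s / t"] C st show ?thesis by simp
    qed
  qed
  with C show ?thesis by blast
qed

lemma slowly_varying_dyadic:
  assumes sv: "slowly_varying b" and "0 < e"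
  shows "\<exists>C>0. \<forall>k m :: real. b (2 powr k) \<le> C * 2 powr (e * \<bar>k - m\<bar>) * b (2 powr m)"
proof -
  obtain C where C: "0 < C" "\<And>s t. 0 < s \<Longrightarrow> 0 < t \<Longrightarrow> b s \<le> C * max (s / t) (t / s) powr e * b t"
    using slowly_varying_bound[OF assms] by blast
  have "max ((2::real) powr k / 2 powr m) (2 powr m / 2 powr k) = 2 powr \<bar>k - m\<bar>" for k m :: real
    by (simp add: powr_diff[symmetric] max_def)
  then have "b (2 powr k) \<le> C * 2 powr (e * \<bar>k - m\<bar>) * b (2 powr m)" for k m :: real
    using C(2)[of "2 powr k" "2 powr m"] by (simp add: powr_powr mult.commute)
  with C show ?thesis by blast
qed

lemma slowly_varying_doubling:
  assumes sv: "slowly_varying b"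
  shows "\<exists>C\<ge>1. \<forall>s>0. \<forall>t>0. s \<le> 2 * t \<longrightarrow> t \<le> 2 * s \<longrightarrow> s powr \<alpha> * b s \<le> C * (t powr \<alpha> * b t)"
proof -
  obtain C where C: "0 < C" "\<And>s t. 0 < s \<Longrightarrow> 0 < t \<Longrightarrow> b s \<le> C * max (s / t) (t / s) powr 1 * b t"
    using slowly_varying_bound[OF sv, of 1] by auto
  have pos: "0 < b t" if "0 < t" for t using sv that by (simp add: slowly_varying_def)
  \<comment> \<open>The factor with \<alpha> bounds the quotient of the powers, and
    \<open>C * 2\<close> the quotient of the values of \<open>b\<close>, for points within a factor
    2 of each other.\<close>
  define C' where "C' = max 1 (2 powr \<bar>\<alpha>\<bar> * (C * 2))"
  have "s powr \<alpha> * b s \<le> C' * (t powr \<alpha> * b t)" if st: "0 < s" "0 < t" "s \<le> 2 * t" "t \<le> 2 * s" for s t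
  proof -
    have "s powr \<alpha> \<le> 2 powr \<bar>\<alpha>\<bar> * t powr \<alpha>"
    proof (cases "0 \<le> \<alpha>")
      case True
      have "s powr \<alpha> \<le> (2 * t) powr \<alpha>" using st True by (intro powr_mono2) auto
      then show ?thesis using True st by (simp add: powr_mult)
    next
      case False
      have "s powr \<alpha> \<le> (t / 2) powr \<alpha>" using st False by (intro powr_mono2') auto
      then show ?thesis using False st by (simp add: powr_divide powr_minus field_simps)
    qed
    moreover have "b s \<le> C * 2 * b t"
    proof -
      have "b s \<le> C * max (s / t) (t / s) * b t" using C(2)[of s t] st by (simp add: le_max_iff_disj)
      also have "\<dots> \<le> C * 2 * b t"
        using st C pos[of t] by (intro mult_right_mono mult_left_mono) (auto simp: field_simps)
      finally show ?thesis .
    qed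
    ultimately have "s powr \<alpha> * b s \<le> (2 powr \<bar>\<alpha>\<bar> * t powr \<alpha>) * (C * 2 * b t)"
      using st pos[of s] by (intro mult_mono) auto
    also have "\<dots> = (2 powr \<bar>\<alpha>\<bar> * (C * 2)) * (t powr \<alpha> * b t)" by simp
    also have "\<dots> \<le> C' * (t powr \<alpha> * b t)"
      unfolding C'_def using st pos[of t] by (intro mult_right_mono) auto
    finally show ?thesis .
  qed
  then show ?thesis by (intro exI[of _ C']) (auto simp: C'_def)
qed

lemma log_floor_dyadic:
  fixes t :: real
  assumes "0 < t"
  shows "2 powr \<lfloor>log 2 t\<rfloor> \<le> t" "t < 2 powr (\<lfloor>log 2 t\<rfloor> + 1)"
proof -
  have "2 powr \<lfloor>log 2 t\<rfloor> \<le> 2 powr (log 2 t)" by (intro powr_mono) auto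
  then show "2 powr \<lfloor>log 2 t\<rfloor> \<le> t" using assms by simp
  have "2 powr (log 2 t) < 2 powr (\<lfloor>log 2 t\<rfloor> + 1)" by (intro powr_less_mono) auto
  then show "t < 2 powr (\<lfloor>log 2 t\<rfloor> + 1)" using assms by simp
qed

lemma dyadic_interval_iff:
  fixes t :: real and k :: int
  assumes "0 < t"
  shows "t \<in> {2 powr k..<2 powr (k + 1)} \<longleftrightarrow> k = \<lfloor>log 2 t\<rfloor>"
proof -
  have "2 powr (real_of_int k) \<le> t \<longleftrightarrow> k \<le> log 2 t" using assms by (simp add: le_log_iff)
  moreover have "t < 2 powr (real_of_int k + 1) \<longleftrightarrow> log 2 t < k + 1" using assms by (simp add: log_less_iff)
  ultimately show ?thesis by (auto simp: eq_commute[of k] floor_eq_iff)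
qed

text \<open>The step function is a sum over k of multiples of indicators of dyadic intervals, only
  one of which is nonzero at each t; exchanging sum and integral leaves the lengths 2^k.\<close>

lemma nn_integral_dyadic_step:
  "(\<integral>\<^sup>+t. G \<lfloor>log 2 t\<rfloor> \<partial>lebesgue_on {0<..}) = (\<integral>\<^sup>+k. G k * ennreal (2 powr k) \<partial>count_space UNIV)"
  for G :: "int \<Rightarrow> ennreal"
proof -
  let ?I = "\<lambda>k::int. {2 powr k..<2 powr (k + 1)}"
  have "(\<integral>\<^sup>+t. G \<lfloor>log 2 t\<rfloor> \<partial>lebesgue_on {0<..})
      = (\<integral>\<^sup>+t. (\<integral>\<^sup>+k. G k * indicator (?I k) t \<partial>count_space UNIV) \<partial>lebesgue_on {0<..})"
  proof (rule nn_integral_cong)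
    fix t :: real assume "t \<in> space (lebesgue_on {0<..})"
    then have t: "0 < t" by (simp add: space_restrict_space)
    have "(\<lambda>k. G k * indicator (?I k) t) = (\<lambda>k. G \<lfloor>log 2 t\<rfloor> * indicator {\<lfloor>log 2 t\<rfloor>} k)"
      using dyadic_interval_iff[OF t] by (auto simp: fun_eq_iff indicator_def)
    then show "G \<lfloor>log 2 t\<rfloor> = (\<integral>\<^sup>+k. G k * indicator (?I k) t \<partial>count_space UNIV)"
      by (simp add: nn_integral_cmult)
  qed
  also have "\<dots> = (\<integral>\<^sup>+k. (\<integral>\<^sup>+t. G k * indicator (?I k) t \<partial>lebesgue_on {0<..}) \<partial>count_space UNIV)"
    by (intro nn_integral_count_space_nn_integral)
      (auto intro!: borel_measurable_times_ennreal measurable_restrict_space1 measurable_completion)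
  also have "\<dots> = (\<integral>\<^sup>+k. G k * ennreal (2 powr k) \<partial>count_space UNIV)"
  proof (rule nn_integral_cong)
    fix k :: int
    have sub: "?I k \<subseteq> {0<..}" by (auto intro: order_less_le_trans[of 0 "2 powr real_of_int k"])
    have Is: "?I k \<in> sets (lebesgue_on {0<..})"
      using sub by (intro sets_restrict_space_iff[THEN iffD2]) auto
    have "emeasure (lebesgue_on {0<..}) (?I k) = ennreal (2 powr k)"
      using sub by (subst emeasure_restrict_space) (auto simp: powr_add)
    then show "(\<integral>\<^sup>+t. G k * indicator (?I k) t \<partial>lebesgue_on {0<..}) = G k * ennreal (2 powr k)"
      by (simp only: nn_integral_cmult_indicator[OF Is])
  qed
  finally show ?thesis .
qed

lemma recip_eq: "0 < q \<Longrightarrow> q \<noteq> \<infinity> \<Longrightarrow> recip q = 1 / enn2real q"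
  by (cases q) (auto simp: recip_def divide_ennreal[of 1, simplified])

lemma antimono_on_measurable_lebesgue_on:
  fixes u :: "real \<Rightarrow> ennreal"
  assumes "antimono_on {0<..} u"
  shows "u \<in> borel_measurable (lebesgue_on {0<..})"
proof (rule borel_measurableI_le)
  fix y
  have "is_interval {t \<in> {0<..}. u t \<le> y}"
    unfolding is_interval_1 using monotone_onD[OF assms] by (auto intro: order_trans)
  then have "{t \<in> {0<..}. u t \<le> y} \<in> sets borel" by (rule real_interval_borel_measurable)
  then show "{t \<in> space (lebesgue_on {0<..}). u t \<le> y} \<in> sets (lebesgue_on {0<..})"
    by (subst sets_restrict_space_iff) (auto simp: space_restrict_space)
qed

text \<open>On a dyadic interval the weight is constant up to \<open>C\<close>, and u lies between
  its values at the right and the left end. The exponent \<open>- recip q\<close> turns dt into dt /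
  t, which gives every dyadic interval comparable mass. The lower bound refers to right ends, and
  shift invariance of l^q realigns it.\<close>

lemma Lq_norm_dyadic:
  assumes sv: "slowly_varying b" and q: "0 < q"
  shows "\<exists>c>0. \<exists>C>0. \<forall>u. antimono_on {0<..} u \<longrightarrow>
    ennreal c * lq q (\<lambda>k. ennreal (2 powr (\<alpha> * k) * b (2 powr k)) * u (2 powr k))
      \<le> Lq_norm q (\<lambda>t. ennreal (t powr (\<alpha> - recip q) * b t) * u t) \<and>
    Lq_norm q (\<lambda>t. ennreal (t powr (\<alpha> - recip q) * b t) * u t)
      \<le> ennreal C * lq q (\<lambda>k. ennreal (2 powr (\<alpha> * k) * b (2 powr k)) * u (2 powr k))"
proof -
  have pos: "0 < b t" if "0 < t" for t using sv that by (simp add: slowly_varying_def)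
  obtain C where C: "1 \<le> C" "\<And>s t. 0 < s \<Longrightarrow> 0 < t \<Longrightarrow> s \<le> 2 * t \<Longrightarrow> t \<le> 2 * s \<Longrightarrow>
      s powr \<alpha> * b s \<le> C * (t powr \<alpha> * b t)"
    using slowly_varying_doubling[OF sv, of \<alpha>] by blast
  define w where "w k = 2 powr (\<alpha> * real_of_int k) * b (2 powr real_of_int k)" for k :: int
  have w: "w k = (2 powr real_of_int k) powr \<alpha> * b (2 powr real_of_int k)" for k
    by (simp add: w_def powr_powr mult.commute)
  have w0: "0 \<le> w k" for k using pos[of "2 powr k"] by (simp add: w_def less_imp_le)
  have up: "ennreal (t powr \<alpha> * b t) * u t \<le> ennreal C * (ennreal (w \<lfloor>log 2 t\<rfloor>) * u (2 powr \<lfloor>log 2 t\<rfloor>))"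
    if u: "antimono_on {0<..} u" and t: "0 < t" for u :: "real \<Rightarrow> ennreal" and t
  proof -
    let ?k = "\<lfloor>log 2 t\<rfloor>"
    have "t powr \<alpha> * b t \<le> C * w ?k"
      unfolding w using log_floor_dyadic[OF t] t by (intro C(2)) (auto simp: powr_add)
    moreover have "u t \<le> u (2 powr ?k)"
      using monotone_onD[OF u, of "2 powr ?k" t] log_floor_dyadic[OF t] t by simp
    ultimately have "ennreal (t powr \<alpha> * b t) * u t \<le> ennreal (C * w ?k) * u (2 powr ?k)"
      by (intro mult_mono[where 'a=ennreal] ennreal_leI) auto
    then show ?thesis using C w0 by (simp add: ennreal_mult mult.assoc)
  qed
  have low: "ennreal (1 / C) * (ennreal (w (\<lfloor>log 2 t\<rfloor> + 1)) * u (2 powr (\<lfloor>log 2 t\<rfloor> + 1)))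
      \<le> ennreal (t powr \<alpha> * b t) * u t"
    if u: "antimono_on {0<..} u" and t: "0 < t" for u :: "real \<Rightarrow> ennreal" and t
  proof -
    let ?k = "\<lfloor>log 2 t\<rfloor>"
    have "w (?k + 1) \<le> C * (t powr \<alpha> * b t)"
      unfolding w using log_floor_dyadic[OF t] t by (intro C(2)) (auto simp: powr_add)
    then have "1 / C * w (?k + 1) \<le> t powr \<alpha> * b t" using C by (simp add: field_simps)
    moreover have "u (2 powr (?k + 1)) \<le> u t"
      using monotone_onD[OF u, of t "2 powr (?k + 1)"] log_floor_dyadic[OF t] t by simp
    ultimately have "ennreal (1 / C * w (?k + 1)) * u (2 powr (?k + 1)) \<le> ennreal (t powr \<alpha> * b t) * u t"
      by (intro mult_mono[where 'a=ennreal] ennreal_leI) auto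
    moreover have "ennreal (1 / C * w (?k + 1)) = ennreal (1 / C) * ennreal (w (?k + 1))"
      using C w0[of "?k + 1"] by (intro ennreal_mult) auto
    ultimately show ?thesis by (simp only: mult.assoc)
  qed
  show ?thesis unfolding w_def[symmetric]
  proof (cases "q = \<infinity>")
    case True
    have r0: "recip q = 0" using True by (simp add: recip_def)
    have le: "ennreal (1 / C) * lq q (\<lambda>k. ennreal (w k) * u (2 powr k))
        \<le> Lq_norm q (\<lambda>t. ennreal (t powr (\<alpha> - recip q) * b t) * u t)"
      and ge: "Lq_norm q (\<lambda>t. ennreal (t powr (\<alpha> - recip q) * b t) * u t)
        \<le> ennreal C * lq q (\<lambda>k. ennreal (w k) * u (2 powr k))"
      if u: "antimono_on {0<..} u" for u :: "real \<Rightarrow> ennreal"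
    proof -
      let ?F = "\<lambda>t. ennreal (t powr \<alpha> * b t) * u t"
      \<comment> \<open>Almost everywhere bounds determine \<open>esssup\<close> only for measurable
        functions; the value is \<open>top\<close> otherwise.\<close>
      have [measurable]: "u \<in> borel_measurable (lebesgue_on {0<..})"
        by (rule antimono_on_measurable_lebesgue_on[OF u])
      have [measurable]: "b \<in> borel_measurable (lebesgue_on {0<..})"
        using sv by (simp add: slowly_varying_def)
      have [measurable]: "(\<lambda>t. t powr \<alpha>) \<in> borel_measurable (lebesgue_on {0<..})"
        by (intro measurable_restrict_space1 measurable_completion) auto
      have F: "?F \<in> borel_measurable (lebesgue_on {0<..})" by measurable
      have "AE t in lebesgue_on {0<..}. ?F t \<le> ennreal C * (SUP k. ennreal (w k) * u (2 powr k))"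
      proof (rule AE_I2)
        fix t :: real assume "t \<in> space (lebesgue_on {0<..})"
        then have t: "0 < t" by (simp add: space_restrict_space)
        show "?F t \<le> ennreal C * (SUP k. ennreal (w k) * u (2 powr k))"
          by (rule order_trans[OF up[OF u t]]) (intro mult_left_mono SUP_upper, auto)
      qed
      then have "esssup (lebesgue_on {0<..}) ?F \<le> ennreal C * (SUP k. ennreal (w k) * u (2 powr k))"
        by (rule esssup_I[OF F])
      then show "Lq_norm q (\<lambda>t. ennreal (t powr (\<alpha> - recip q) * b t) * u t)
        \<le> ennreal C * lq q (\<lambda>k. ennreal (w k) * u (2 powr k))"
        unfolding Lq_norm_def lq_def if_P[OF True] r0 by simp
      \<comment> \<open>Otherwise the interval [2^(k - 1), 2^k), on which \<open>low\<close> bounds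
        the function from below by this value, would be a null set.\<close>
      have "ennreal (1 / C) * (ennreal (w k) * u (2 powr k)) \<le> esssup (lebesgue_on {0<..}) ?F" for k
      proof (rule ccontr)
        assume not: "\<not> ?thesis"
        let ?I = "{2 powr (k - 1)..<2 powr k} :: real set"
        have sub: "?I \<subseteq> {0<..}" by (auto intro: order_less_le_trans[of 0 "2 powr (real_of_int k - 1)"])
        have "AE t in lebesgue_on {0<..}. t \<notin> ?I"
          using esssup_AE[of ?F "lebesgue_on {0<..}"]
        proof (rule AE_mp, intro AE_I2 impI notI)
          fix t assume le: "?F t \<le> esssup (lebesgue_on {0<..}) ?F" and t: "t \<in> ?I"
          have t0: "0 < t" using sub t by auto
          have "k - 1 = \<lfloor>log 2 t\<rfloor>" using dyadic_interval_iff[OF t0, of "k - 1"] t by simp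
          then have "\<lfloor>log 2 t\<rfloor> + 1 = k" by simp
          with low[OF u t0] have "ennreal (1 / C) * (ennreal (w k) * u (2 powr k)) \<le> ?F t"
            by (metis of_int_add of_int_1)
          with le not show False by (meson order_trans)
        qed
        then have "?I \<in> null_sets (lebesgue_on {0<..})"
          using sub by (subst AE_iff_null_sets) (auto simp: sets_restrict_space_iff)
        then have "emeasure (lebesgue_on {0<..}) ?I = 0" by auto
        moreover have "emeasure (lebesgue_on {0<..}) ?I = ennreal (2 powr (k - 1))"
          using sub by (subst emeasure_restrict_space) (auto simp: powr_diff)
        ultimately show False by simp
      qed
      then show "ennreal (1 / C) * lq q (\<lambda>k. ennreal (w k) * u (2 powr k))
        \<le> Lq_norm q (\<lambda>t. ennreal (t powr (\<alpha> - recip q) * b t) * u t)"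
        unfolding lq_def if_P[OF True] Lq_norm_def r0 SUP_mult_left_ennreal by (auto intro: SUP_least)
    qed
    show "\<exists>c>0. \<exists>C>0. \<forall>u. antimono_on {0<..} u \<longrightarrow>
      ennreal c * lq q (\<lambda>k. ennreal (w k) * u (2 powr k))
        \<le> Lq_norm q (\<lambda>t. ennreal (t powr (\<alpha> - recip q) * b t) * u t) \<and>
      Lq_norm q (\<lambda>t. ennreal (t powr (\<alpha> - recip q) * b t) * u t)
        \<le> ennreal C * lq q (\<lambda>k. ennreal (w k) * u (2 powr k))"
      using C(1) by (intro exI[of _ "1 / C"] exI[of _ C] conjI allI impI le ge) auto
  next
    case False
    define r where "r = enn2real q"
    have r: "0 < r" using q False exponent_pos unfolding r_def by blast
    have rq: "recip q = 1 / r" using q False by (simp add: recip_eq r_def)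
    \<comment> \<open>The interval [2^k, 2^(k + 1)) has length 2^k, and 1 / t is at least 2^(-k - 1)
      there: this leaves 1/2 for each index. The factor \<open>1 / C\<close> is the loss in the
      weight.\<close>
    define c where "c = (1 / 2) powr (1 / r) * (1 / C)"
    have le: "ennreal c * lq q (\<lambda>k. ennreal (w k) * u (2 powr k))
        \<le> Lq_norm q (\<lambda>t. ennreal (t powr (\<alpha> - recip q) * b t) * u t)"
      and ge: "Lq_norm q (\<lambda>t. ennreal (t powr (\<alpha> - recip q) * b t) * u t)
        \<le> ennreal C * lq q (\<lambda>k. ennreal (w k) * u (2 powr k))"
      if u: "antimono_on {0<..} u" for u :: "real \<Rightarrow> ennreal"
    proof -
      define x where "x k = ennreal (w k) * u (2 powr real_of_int k)" for k :: int
      let ?F = "\<lambda>t. ennreal (t powr (\<alpha> - recip q) * b t) * u t"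
      have F: "epowr (?F t) r = ennreal (1 / t) * epowr (ennreal (t powr \<alpha> * b t) * u t) r" if t: "0 < t" for t
      proof -
        have "t powr (\<alpha> - recip q) * b t = t powr (- (1 / r)) * (t powr \<alpha> * b t)"
          unfolding rq by (simp add: powr_diff powr_minus_divide)
        also have "ennreal \<dots> = ennreal (t powr (- (1 / r))) * ennreal (t powr \<alpha> * b t)"
          using pos[OF t] by (intro ennreal_mult) (auto simp: less_imp_le)
        finally have "?F t = ennreal (t powr (- (1 / r))) * (ennreal (t powr \<alpha> * b t) * u t)"
          by (simp only: mult.assoc)
        moreover have "epowr (ennreal (t powr (- (1 / r)))) r = ennreal (1 / t)"
        proof -
          have "(t powr (- (1 / r))) powr r = t powr (- 1)" unfolding powr_powr using r by simp
          also have "\<dots> = 1 / t" using t by (simp add: powr_minus_divide)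
          finally show ?thesis by (subst epowr_ennreal) auto
        qed
        ultimately show ?thesis using r by (simp add: epowr_mult)
      qed
      have "(\<integral>\<^sup>+t. epowr (?F t) r \<partial>lebesgue_on {0<..})
          \<le> (\<integral>\<^sup>+t. (\<lambda>k::int. ennreal (2 powr (- k)) * epowr (ennreal C * x k) r) \<lfloor>log 2 t\<rfloor> \<partial>lebesgue_on {0<..})"
      proof (rule nn_integral_mono)
        fix t :: real assume "t \<in> space (lebesgue_on {0<..})"
        then have t: "0 < t" by (simp add: space_restrict_space)
        have inv: "1 / t \<le> 2 powr (- \<lfloor>log 2 t\<rfloor>)"
          using log_floor_dyadic[OF t] t by (simp add: powr_minus_divide divide_left_mono)
        show "epowr (?F t) r \<le> (\<lambda>k::int. ennreal (2 powr (- k)) * epowr (ennreal C * x k) r) \<lfloor>log 2 t\<rfloor>"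
          unfolding F[OF t] x_def by (rule mult_mono[OF ennreal_leI[OF inv] epowr_mono[OF r up[OF u t]]]) auto
      qed
      also have "\<dots> = (\<integral>\<^sup>+k. epowr (ennreal C * x k) r \<partial>count_space UNIV)"
      proof (subst nn_integral_dyadic_step, rule nn_integral_cong)
        fix k :: int
        have "ennreal (2 powr (- k)) * ennreal (2 powr k) = 1"
          by (simp flip: ennreal_mult powr_add)
        then show "ennreal (2 powr (- k)) * epowr (ennreal C * x k) r * ennreal (2 powr k) = epowr (ennreal C * x k) r"
          by (metis mult.commute mult.left_commute mult.right_neutral)
      qed
      finally have "Lq_norm q ?F \<le> lq q (\<lambda>k. ennreal C * x k)"
        unfolding Lq_norm_def lq_def if_not_P[OF False] r_def[symmetric] using r by (intro epowr_mono) auto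
      then show "Lq_norm q ?F \<le> ennreal C * lq q (\<lambda>k. ennreal (w k) * u (2 powr k))"
        by (simp add: lq_cmult[OF q] x_def)
      have "ennreal (1 / 2) * (\<integral>\<^sup>+k. epowr (ennreal (1 / C) * x (k + 1)) r \<partial>count_space UNIV)
         = (\<integral>\<^sup>+t. (\<lambda>k::int. ennreal (2 powr (- k - 1)) * epowr (ennreal (1 / C) * x (k + 1)) r) \<lfloor>log 2 t\<rfloor> \<partial>lebesgue_on {0<..})"
      proof (subst nn_integral_dyadic_step, subst nn_integral_cmult[symmetric], simp, rule nn_integral_cong)
        fix k :: int
        have "ennreal (2 powr (- k - 1)) * ennreal (2 powr k) = ennreal (2 powr (- k - 1) * 2 powr k)"
          by (intro ennreal_mult[symmetric]) auto
        also have "2 powr (- k - 1) * 2 powr k = (1 / 2 :: real)" by (simp add: powr_minus flip: powr_add)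
        finally have "ennreal (2 powr (- k - 1)) * ennreal (2 powr k) = ennreal (1 / 2)" .
        then show "ennreal (1 / 2) * epowr (ennreal (1 / C) * x (k + 1)) r
            = ennreal (2 powr (- k - 1)) * epowr (ennreal (1 / C) * x (k + 1)) r * ennreal (2 powr k)"
          by (metis mult.commute mult.left_commute)
      qed
      also have "\<dots> \<le> (\<integral>\<^sup>+t. epowr (?F t) r \<partial>lebesgue_on {0<..})"
      proof (rule nn_integral_mono)
        fix t :: real assume "t \<in> space (lebesgue_on {0<..})"
        then have t: "0 < t" by (simp add: space_restrict_space)
        have "2 powr (- \<lfloor>log 2 t\<rfloor> - 1) = 1 / 2 powr (\<lfloor>log 2 t\<rfloor> + 1)"
          by (simp add: powr_minus_divide[symmetric])
        also have "\<dots> \<le> 1 / t"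
          using log_floor_dyadic[OF t] t by (intro divide_left_mono) auto
        finally have inv: "2 powr (- \<lfloor>log 2 t\<rfloor> - 1) \<le> 1 / t" .
        have "epowr (ennreal (1 / C) * x (\<lfloor>log 2 t\<rfloor> + 1)) r \<le> epowr (ennreal (t powr \<alpha> * b t) * u t) r"
          using low[OF u t] by (intro epowr_mono[OF r]) (simp add: x_def)
        with inv show "(\<lambda>k::int. ennreal (2 powr (- k - 1)) * epowr (ennreal (1 / C) * x (k + 1)) r) \<lfloor>log 2 t\<rfloor> \<le> epowr (?F t) r"
          unfolding F[OF t] by (intro mult_mono[where 'a=ennreal] ennreal_leI) auto
      qed
      finally have "epowr (ennreal (1 / 2)) (1 / r) * lq q (\<lambda>k. ennreal (1 / C) * x (k + 1)) \<le> Lq_norm q ?F"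
        unfolding Lq_norm_def lq_def if_not_P[OF False] r_def[symmetric] using r
        by (subst epowr_mult[symmetric]) (auto intro: epowr_mono)
      moreover have "lq q (\<lambda>k. ennreal (1 / C) * x (k + 1)) = ennreal (1 / C) * lq q x"
        by (simp only: lq_cmult[OF q] lq_shift)
      moreover have "epowr (ennreal (1 / 2)) (1 / r) * (ennreal (1 / C) * lq q x) = ennreal c * lq q x"
      proof -
        have "epowr (ennreal (1 / 2)) (1 / r) = ennreal ((1 / 2) powr (1 / r))"
          by (intro epowr_ennreal) simp
        moreover have "ennreal c = ennreal ((1 / 2) powr (1 / r)) * ennreal (1 / C)"
          unfolding c_def using C(1) by (intro ennreal_mult) auto
        ultimately show ?thesis by (simp only: mult.assoc)
      qed
      ultimately show "ennreal c * lq q (\<lambda>k. ennreal (w k) * u (2 powr k)) \<le> Lq_norm q ?F"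
        unfolding x_def by simp
    qed
    show "\<exists>c>0. \<exists>C>0. \<forall>u. antimono_on {0<..} u \<longrightarrow>
      ennreal c * lq q (\<lambda>k. ennreal (w k) * u (2 powr k))
        \<le> Lq_norm q (\<lambda>t. ennreal (t powr (\<alpha> - recip q) * b t) * u t) \<and>
      Lq_norm q (\<lambda>t. ennreal (t powr (\<alpha> - recip q) * b t) * u t)
        \<le> ennreal C * lq q (\<lambda>k. ennreal (w k) * u (2 powr k))"
      using C(1) by (intro exI[of _ c] exI[of _ C] conjI allI impI le ge) (auto simp: c_def)
  qed
qed

section \<open>Dyadic weights, characteristic functions and Hardy's inequality\<close>

definition dyadic_weight :: "real \<Rightarrow> (real \<Rightarrow> real) \<Rightarrow> int \<Rightarrow> real" where
  "dyadic_weight \<alpha> b k = 2 powr (\<alpha> * k) * b (2 powr k)"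

text \<open>The discretized functional that replaces \<open>LK_norm\<close> from here on. The weight
  is a parameter because the exclusion of \<open>q < 1\<close> concerns every positive
  weight.\<close>

definition dyadic_norm :: "'a measure \<Rightarrow> ennreal \<Rightarrow> (int \<Rightarrow> real) \<Rightarrow> ('a \<Rightarrow> ennreal) \<Rightarrow> ennreal" where
  "dyadic_norm R q w g = lq q (\<lambda>k. ennreal (w k) * rearr R g (2 powr k))"

lemma LK_norm_dyadic:
  assumes sv: "slowly_varying b" and q: "0 < q"
  shows "\<exists>c>0. \<exists>C>0. \<forall>f.
    ennreal c * dyadic_norm R q (dyadic_weight (recip p) b) (modulus \<circ> f) \<le> LK_norm R p q b f \<and>
    LK_norm R p q b f \<le> ennreal C * dyadic_norm R q (dyadic_weight (recip p) b) (modulus \<circ> f)"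
proof -
  have eq: "rearrangement R f = rearr R (modulus \<circ> f)" for f
    by (simp add: fun_eq_iff rearrangement_def rearr_def)
  have "antimono_on {0<..} (rearr R g)" for g :: "'a \<Rightarrow> ennreal"
    by (intro monotone_onI rearr_antimono)
  with Lq_norm_dyadic[OF sv q, of "recip p"] show ?thesis
    unfolding LK_norm_def dyadic_norm_def dyadic_weight_def eq by meson
qed

lemma dyadic_weight_pos: "slowly_varying b \<Longrightarrow> 0 < dyadic_weight \<alpha> b k"
  by (simp add: dyadic_weight_def slowly_varying_def)

lemma dyadic_weight_bound:
  fixes e :: real
  assumes sv: "slowly_varying b" and "0 < e"
  shows "\<exists>C>0. \<forall>k m :: int. dyadic_weight \<alpha> b k \<le>
     C * 2 powr (\<alpha> * (k - m) + e * \<bar>k - m\<bar>) * dyadic_weight \<alpha> b m"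
proof -
  obtain C where C: "0 < C" "\<And>k m :: real. b (2 powr k) \<le> C * 2 powr (e * \<bar>k - m\<bar>) * b (2 powr m)"
    using slowly_varying_dyadic[OF assms] by blast
  have "dyadic_weight \<alpha> b k \<le> C * 2 powr (\<alpha> * (k - m) + e * \<bar>k - m\<bar>) * dyadic_weight \<alpha> b m" for k m
  proof -
    have "dyadic_weight \<alpha> b k \<le> 2 powr (\<alpha> * k) * (C * 2 powr (e * \<bar>real_of_int k - m\<bar>) * b (2 powr m))"
      unfolding dyadic_weight_def by (intro mult_left_mono C) auto
    also have "2 powr (\<alpha> * real_of_int k) = 2 powr (\<alpha> * (k - m)) * 2 powr (\<alpha> * m)"
      by (simp add: algebra_simps flip: powr_add)
    finally show ?thesis by (simp add: dyadic_weight_def powr_add mult_ac)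
  qed
  with C show ?thesis by blast
qed

lemma suminf_geometric_ennreal:
  assumes "0 \<le> c" "0 < d"
  shows "(\<Sum>i. ennreal (c * 2 powr (- (d * real i)))) = ennreal (c / (1 - 2 powr (- d)))"
proof -
  define r :: real where "r = 2 powr (- d)"
  have r: "0 < r" "r < 1" using assms powr_less_mono[of "- d" 0 "2::real"] by (auto simp: r_def)
  have "2 powr (- (d * real i)) = r ^ i" for i :: nat
    unfolding r_def by (simp add: powr_powr flip: powr_realpow)
  moreover have "(\<lambda>i. c * r ^ i) sums (c * (1 / (1 - r)))"
    using r by (intro sums_mult geometric_sums) auto
  ultimately show ?thesis
    using assms r by (intro suminf_ennreal_eq) (auto simp: r_def[symmetric])
qed

lemma lq_single: "0 < q \<Longrightarrow> lq q (\<lambda>k. c * indicator {j} k) = c"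
  by (subst lq_cmult) (simp_all add: lq_indicator_finite)

text \<open>The l^q norm is at most the l^1 norm: expand into multiples of unit vectors and apply
  the triangle inequality.\<close>

lemma lq_lessThan_le_suminf:
  assumes q: "1 \<le> q"
  shows "lq q (\<lambda>k. x k * indicator {..<m} k) \<le> (\<Sum>i. x (m - 1 - int i))"
proof -
  have q0: "0 < q" by (rule exponent_pos_of_ge_1[OF q])
  have "lq q (\<lambda>k. x k * indicator {..<m} k) \<le> lq q (\<lambda>k. \<Sum>i. x (m - 1 - int i) * indicator {m - 1 - int i} k)"
  proof (rule lq_mono[OF q0])
    fix k
    show "x k * indicator {..<m} k \<le> (\<Sum>i. x (m - 1 - int i) * indicator {m - 1 - int i} k)"
    proof (cases "k < m")
      case True
      then have "m - 1 - int (nat (m - 1 - k)) = k" by simp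
      then show ?thesis
        using ennreal_le_suminf[of "\<lambda>i. x (m - 1 - int i) * indicator {m - 1 - int i} k" "nat (m - 1 - k)"] True by simp
    qed simp
  qed
  also have "\<dots> \<le> (\<Sum>i. lq q (\<lambda>k. x (m - 1 - int i) * indicator {m - 1 - int i} k))" by (rule lq_suminf_le[OF q])
  also have "\<dots> = (\<Sum>i. x (m - 1 - int i))" by (simp only: lq_single[OF q0])
  finally show ?thesis .
qed

text \<open>Slow variation may consume half of the exponent \<alpha>; the weight still decays like
  2^(-\<alpha> i / 2) to the left, and a geometric series bounds the norm by its last term. This
  makes a characteristic function of a set of measure 2^m have size at most a constant times the
  weight at m.\<close>

lemma lq_dyadic_weight_lessThan:
  assumes sv: "slowly_varying b" and q: "1 \<le> q" and \<alpha>: "0 < \<alpha>"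
  shows "\<exists>C>0. \<forall>m. lq q (\<lambda>k. ennreal (dyadic_weight \<alpha> b k) * indicator {..<m} k) \<le> ennreal (C * dyadic_weight \<alpha> b m)"
proof -
  let ?w = "dyadic_weight \<alpha> b"
  obtain C where C: "0 < C" "\<And>k m :: int. ?w k \<le> C * 2 powr (\<alpha> * (k - m) + \<alpha> / 2 * \<bar>k - m\<bar>) * ?w m"
    using dyadic_weight_bound[OF sv half_gt_zero[OF \<alpha>]] by blast
  have "lq q (\<lambda>k. ennreal (?w k) * indicator {..<m} k) \<le> ennreal (C / (1 - 2 powr (- (\<alpha> / 2))) * ?w m)" for m
  proof -
    have w0: "0 < ?w m" by (rule dyadic_weight_pos[OF sv])
    have "lq q (\<lambda>k. ennreal (?w k) * indicator {..<m} k) \<le> (\<Sum>i. ennreal (?w (m - 1 - int i)))"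
      by (rule lq_lessThan_le_suminf[OF q])
    also have "\<dots> \<le> (\<Sum>i. ennreal (C * ?w m * 2 powr (- (\<alpha> / 2 * real i))))"
    proof (intro suminf_le ennreal_leI)
      fix i
      have "\<alpha> * real_of_int (m - 1 - int i - m) + \<alpha> / 2 * real_of_int \<bar>m - 1 - int i - m\<bar>
          = - (\<alpha> / 2 * (real i + 1))" by (simp add: field_simps)
      then have "?w (m - 1 - int i) \<le> C * 2 powr (- (\<alpha> / 2 * (real i + 1))) * ?w m"
        using C(2)[of "m - 1 - int i" m] by (simp only:)
      also have "\<dots> \<le> C * 2 powr (- (\<alpha> / 2 * real i)) * ?w m"
        using C(1) w0 \<alpha> by (intro mult_right_mono mult_left_mono powr_mono) auto
      finally show "?w (m - 1 - int i) \<le> C * ?w m * 2 powr (- (\<alpha> / 2 * real i))" by (simp add: mult_ac)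
    qed auto
    also have "\<dots> = ennreal (C * ?w m / (1 - 2 powr (- (\<alpha> / 2))))"
      using \<alpha> C w0 by (intro suminf_geometric_ennreal) auto
    finally show ?thesis by (simp add: mult_ac)
  qed
  moreover have "2 powr (- (\<alpha> / 2)) < (1::real)" using powr_less_mono[of "- (\<alpha> / 2)" 0 "2::real"] \<alpha> by simp
  ultimately show ?thesis using C by (intro exI[of _ "C / (1 - 2 powr (- (\<alpha> / 2)))"]) auto
qed

text \<open>Moving the cut-off adds finitely many terms. Thus a condition near 0, as in (ii), gives
  finiteness for all sets of finite measure.\<close>

lemma lq_lessThan_finite:
  assumes q: "1 \<le> q" and 0: "lq q (\<lambda>k. ennreal (w k) * indicator {..<0} k) < \<infinity>"
  shows "lq q (\<lambda>k. ennreal (w k) * indicator {..<m} k) < \<infinity>"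
proof -
  have q0: "0 < q" by (rule exponent_pos_of_ge_1[OF q])
  have "lq q (\<lambda>k. ennreal (w k) * indicator {..<m} k)
      \<le> lq q (\<lambda>k. ennreal (w k) * indicator {..<0} k + (\<Sum>j\<in>{0..<m}. ennreal (w j) * indicator {j} k))"
  proof (rule lq_mono[OF q0])
    fix k
    show "ennreal (w k) * indicator {..<m} k
        \<le> ennreal (w k) * indicator {..<0} k + (\<Sum>j\<in>{0..<m}. ennreal (w j) * indicator {j} k)"
    proof (cases "0 \<le> k \<and> k < m")
      case True
      then have "ennreal (w k) * indicator {k} k \<le> (\<Sum>j\<in>{0..<m}. ennreal (w j) * indicator {j} k)"
        by (intro member_le_sum) auto
      then show ?thesis using True by simp
    qed (auto simp: indicator_def)
  qed
  also have "\<dots> \<le> lq q (\<lambda>k. ennreal (w k) * indicator {..<0} k) +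
       (\<Sum>j\<in>{0..<m}. lq q (\<lambda>k. ennreal (w j) * indicator {j} k))"
    by (rule order_trans[OF lq_triangle[OF q]]) (intro add_left_mono lq_sum_le q, simp)
  also have "\<dots> < \<infinity>" using 0 by (simp add: lq_single[OF q0])
  finally show ?thesis .
qed

lemma rearr_indicator_le:
  assumes "E \<in> sets R"
  shows "rearr R (\<lambda>x. c * indicator E x) t \<le> (if emeasure R E \<le> ennreal t then 0 else c)"
proof (cases "emeasure R E \<le> ennreal t")
  case True
  have "emeasure R {x \<in> space R. c * indicator E x > 0} \<le> emeasure R E"
    using assms by (intro emeasure_mono) (auto simp: indicator_def split: if_splits)
  then have "rearr R (\<lambda>x. c * indicator E x) t \<le> 0" using True by (intro rearr_le) (rule order_trans)
  then show ?thesis by simp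
next
  case False
  have "{x \<in> space R. c * indicator E x > c} = {}" by (auto simp: indicator_def)
  then have "emeasure R {x \<in> space R. c * indicator E x > c} \<le> ennreal t" by (simp only: emeasure_empty zero_le)
  then have "rearr R (\<lambda>x. c * indicator E x) t \<le> c" by (rule rearr_le)
  with False show ?thesis by simp
qed

text \<open>The index m itself is excluded because the rearrangement of the characteristic function
  of a set of measure t vanishes at t.\<close>

lemma dyadic_norm_indicator_le:
  assumes q: "0 < q" and E: "E \<in> sets R" "emeasure R E \<le> ennreal (2 powr (real_of_int m))"
  shows "dyadic_norm R q w (\<lambda>x. c * indicator E x) \<le> c * lq q (\<lambda>k. ennreal (w k) * indicator {..<m} k)"
  unfolding dyadic_norm_def lq_cmult[OF q, symmetric]
proof (rule lq_mono[OF q])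
  fix k
  have "rearr R (\<lambda>x. c * indicator E x) (2 powr k) \<le> c * indicator {..<m} k"
  proof (cases "k < m")
    case False
    then have "2 powr real_of_int m \<le> (2::real) powr k" by (intro powr_mono) auto
    then have "emeasure R E \<le> ennreal (2 powr k)" using E(2) by (rule_tac order_trans) (auto intro: ennreal_leI)
    with rearr_indicator_le[OF E(1), of c "2 powr k"] show ?thesis by simp
  qed (use rearr_indicator_le[OF E(1), of c "2 powr k"] in \<open>auto split: if_splits\<close>)
  then show "ennreal (w k) * rearr R (\<lambda>x. c * indicator E x) (2 powr k) \<le> c * (ennreal (w k) * indicator {..<m} k)"
    by (subst mult.left_commute) (rule mult_left_mono, auto)
qed

text \<open>By \<open>maxint_le\<close> the k-th term on the left is at most a sum over i of 2^(-i)
  times weight at k times f*(2^(k - i)). Moving the weight to index k - i costs 2^((\<alpha> + d)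
  i), so each shift contributes a factor 2^(-d i); Minkowski's inequality and shift invariance sum
  these up.\<close>

lemma dyadic_hardy:
  assumes sv: "slowly_varying b" and q: "1 \<le> q" and \<alpha>: "\<alpha> < 1"
  shows "\<exists>C>0. \<forall>g\<in>borel_measurable R.
     lq q (\<lambda>k. ennreal (dyadic_weight \<alpha> b k * 2 powr (- real_of_int k)) * maxint R (2 powr k) g)
       \<le> ennreal C * dyadic_norm R q (dyadic_weight \<alpha> b) g"
proof -
  let ?w = "dyadic_weight \<alpha> b"
  \<comment> \<open>Half of the gap 1 - \<alpha>: slow variation uses up d, and decay of order 2^(-d
    i) remains.\<close>
  define d where "d = (1 - \<alpha>) / 2"
  have d: "0 < d" using \<alpha> by (simp add: d_def)
  have q0: "0 < q" by (rule exponent_pos_of_ge_1[OF q])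
  obtain C where C: "0 < C" "\<And>k m :: int. ?w k \<le> C * 2 powr (\<alpha> * (k - m) + d * \<bar>k - m\<bar>) * ?w m"
    using dyadic_weight_bound[OF sv d] by blast
  have w0: "0 \<le> ?w k" for k using dyadic_weight_pos[OF sv, of \<alpha> k] by simp
  define D where "D = 2 * C / (1 - 2 powr (- d))"
  have "2 powr (- d) < (1::real)" using powr_less_mono[of "- d" 0 "2::real"] d by simp
  then have D: "0 < D" using C by (simp add: D_def)
  have "lq q (\<lambda>k. ennreal (?w k * 2 powr (- real_of_int k)) * maxint R (2 powr k) g) \<le> ennreal D * dyadic_norm R q ?w g"
    if g: "g \<in> borel_measurable R" for g
  proof -
    define a where "a k = rearr R g (2 powr (real_of_int k))" for k
    define c where "c i = 2 * C * 2 powr (- (d * real i))" for i :: nat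
    have c0: "0 \<le> c i" for i using C by (simp add: c_def)
    have "ennreal (?w k * 2 powr (- real_of_int k)) * maxint R (2 powr k) g
        \<le> (\<Sum>i. ennreal (c i) * (ennreal (?w (k + - int i)) * a (k + - int i)))" for k
    proof -
      have "ennreal (?w k * 2 powr (- real_of_int k)) * maxint R (2 powr k) g
         \<le> ennreal (?w k * 2 powr (- real_of_int k)) * (2 * (\<Sum>i. ennreal (2 powr (k - real i)) * a (k - int i)))"
        unfolding a_def using maxint_le[OF g, of "real_of_int k"] by (intro mult_left_mono) auto
      also have "\<dots> = (\<Sum>i. ennreal (?w k * 2 powr (- real_of_int k)) * (2 * (ennreal (2 powr (k - real i)) * a (k - int i))))"
        by simp
      also have "\<dots> \<le> (\<Sum>i. ennreal (c i) * (ennreal (?w (k + - int i)) * a (k + - int i)))"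
      proof (rule suminf_le)
        fix i
        have "?w k * 2 powr (- real_of_int k) * (2 * 2 powr (k - real i)) = 2 * 2 powr (- real i) * ?w k"
          by (simp add: mult_ac flip: powr_add)
        also have "\<dots> \<le> 2 * 2 powr (- real i) * (C * 2 powr ((\<alpha> + d) * i) * ?w (k - int i))"
          using C(2)[of k "k - int i"] by (intro mult_left_mono) (auto simp: algebra_simps)
        also have "\<dots> = c i * ?w (k - int i)"
        proof -
          have "- real i + (\<alpha> + d) * i = - (d * i)" by (simp add: d_def field_simps)
          then have "2 powr (- real i) * 2 powr ((\<alpha> + d) * i) = 2 powr (- (d * i))"
            by (simp flip: powr_add)
          then show ?thesis unfolding c_def by (simp add: mult_ac)
        qed
        finally have "ennreal (?w k * 2 powr (- real_of_int k) * (2 * 2 powr (k - real i))) \<le> ennreal (c i * ?w (k - int i))"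
          by (rule ennreal_leI)
        also have "ennreal (?w k * 2 powr (- real_of_int k) * (2 * 2 powr (k - real i))) =
            ennreal (?w k * 2 powr (- real_of_int k)) * (2 * ennreal (2 powr (k - real i)))"
          using w0 by (simp add: ennreal_mult)
        also have "ennreal (c i * ?w (k - int i)) = ennreal (c i) * ennreal (?w (k - int i))"
          using w0 c0 by (simp add: ennreal_mult)
        finally have "ennreal (?w k * 2 powr (- real_of_int k)) * (2 * ennreal (2 powr (k - real i))) * a (k - int i)
           \<le> ennreal (c i) * ennreal (?w (k - int i)) * a (k - int i)" by (rule mult_right_mono) simp
        then show "ennreal (?w k * 2 powr (- real_of_int k)) * (2 * (ennreal (2 powr (k - real i)) * a (k - int i)))
            \<le> ennreal (c i) * (ennreal (?w (k + - int i)) * a (k + - int i))"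
          by (simp add: mult.assoc)
      qed auto
      finally show ?thesis .
    qed
    then have "lq q (\<lambda>k. ennreal (?w k * 2 powr (- real_of_int k)) * maxint R (2 powr k) g)
       \<le> lq q (\<lambda>k. \<Sum>i. ennreal (c i) * (ennreal (?w (k + - int i)) * a (k + - int i)))"
      by (rule lq_mono[OF q0])
    also have "\<dots> \<le> (\<Sum>i. lq q (\<lambda>k. ennreal (c i) * (ennreal (?w (k + - int i)) * a (k + - int i))))"
      by (rule lq_suminf_le[OF q])
    also have "\<dots> = (\<Sum>i. ennreal (c i) * dyadic_norm R q ?w g)"
    proof (intro arg_cong[where f=suminf] ext)
      fix i
      show "lq q (\<lambda>k. ennreal (c i) * (ennreal (?w (k + - int i)) * a (k + - int i))) = ennreal (c i) * dyadic_norm R q ?w g"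
        using lq_shift[of q "\<lambda>k. ennreal (?w k) * a k" "- int i"]
        by (simp only: lq_cmult[OF q0] a_def dyadic_norm_def)
    qed
    also have "\<dots> = ennreal D * dyadic_norm R q ?w g"
    proof -
      have "(\<Sum>i. ennreal (c i)) = ennreal D"
        unfolding c_def D_def using C(1) d by (intro suminf_geometric_ennreal) auto
      then show ?thesis by (simp only: ennreal_suminf_multc)
    qed
    finally show ?thesis .
  qed
  with D show ?thesis by blast
qed

section \<open>Sufficiency\<close>

text \<open>Common end of all sufficiency cases: \<open>fin\<close> yields (P4) by way of
  characteristic functions, \<open>int\<close> yields (P5) and definiteness, and the discretization
  carries the equivalence back to \<open>LK_norm\<close>.\<close>

lemma normable_of_seminorm:
  assumes sf: "sigma_finite_measure R" and sv: "slowly_varying b" and q: "1 \<le> q"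
    and n: "fatou_seminorm R n" and c: "0 < c" "0 < C"
    and eqv: "\<And>g. g \<in> borel_measurable R \<Longrightarrow>
       ennreal c * n g \<le> dyadic_norm R q (dyadic_weight (recip p) b) g \<and>
       dyadic_norm R q (dyadic_weight (recip p) b) g \<le> ennreal C * n g"
    and fin: "lq q (\<lambda>k. ennreal (dyadic_weight (recip p) b k) * indicator {..<0} k) < \<infinity>"
    and int: "\<And>j::int. \<exists>D. \<forall>g\<in>borel_measurable R. maxint R (2 powr j) g \<le> ennreal D * n g"
  shows "\<exists>N. banach_function_norm R N \<and> LK_space R p q b = {f \<in> Mfun R. N f < \<infinity>} \<and>
              equivalent_on (Mfun R) N (LK_norm R p q b)"
proof -
  let ?w = "dyadic_weight (recip p) b"
  have q0: "0 < q" by (rule exponent_pos_of_ge_1[OF q])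
  define N where "N f = n (modulus \<circ> f)" for f
  have "banach_function_norm R N"
    unfolding N_def
  proof (rule banach_function_norm_of_seminorm[OF sf n])
    fix E assume E: "E \<in> sets R" "emeasure R E < \<infinity>"
    obtain e where e: "emeasure R E = ennreal e" "0 \<le> e" using E by (cases "emeasure R E") auto
    obtain j :: nat where "e < 2 ^ j" using real_arch_pow[of 2 e] by auto
    then have "emeasure R E \<le> ennreal (2 powr (real_of_int (int j)))"
      using e by (simp add: powr_realpow)
    from dyadic_norm_indicator_le[OF q0 E(1) this, of ?w 1]
    have "dyadic_norm R q ?w (indicator E) < \<infinity>"
      using lq_lessThan_finite[OF q fin, of "int j"] by (auto intro: order_le_less_trans)
    moreover have "ennreal c * n (indicator E) \<le> dyadic_norm R q ?w (indicator E)"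
      using eqv[of "indicator E"] E by simp
    ultimately have "ennreal c * n (indicator E) < \<infinity>" by (rule_tac order_le_less_trans)
    then show "n (indicator E) < \<infinity>" using c by (auto simp: ennreal_mult_less_top)
  next
    fix j :: int
    show "\<exists>C<\<infinity>. \<forall>g\<in>borel_measurable R. maxint R (2 powr j) g \<le> C * n g"
      using int[of j] by (metis ennreal_less_top infinity_ennreal_def)
  qed
  moreover obtain c1 C1 where c1: "0 < c1" "0 < C1"
    and LK: "\<And>f. ennreal c1 * dyadic_norm R q ?w (modulus \<circ> f) \<le> LK_norm R p q b f"
      "\<And>f. LK_norm R p q b f \<le> ennreal C1 * dyadic_norm R q ?w (modulus \<circ> f)"
    using LK_norm_dyadic[OF sv q0] by meson
  \<comment> \<open>The maximum in the upper constant provides the \<open>c \<le> C\<close> demanded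
    by \<open>equivalent_on\<close>.\<close>
  have lo: "ennreal (c1 * c) * N f \<le> LK_norm R p q b f"
    and up: "LK_norm R p q b f \<le> ennreal (max (c1 * c) (C1 * C)) * N f" if f: "f \<in> Mfun R" for f
  proof -
    have g: "modulus \<circ> f \<in> borel_measurable R" by (rule modulus_comp_measurable[OF f])
    have "ennreal (c1 * c) * N f = ennreal c1 * (ennreal c * n (modulus \<circ> f))"
      using c c1 by (simp add: N_def ennreal_mult mult.assoc)
    also have "\<dots> \<le> ennreal c1 * dyadic_norm R q ?w (modulus \<circ> f)"
      using eqv[OF g] by (intro mult_left_mono) auto
    also have "\<dots> \<le> LK_norm R p q b f" by (rule LK)
    finally show "ennreal (c1 * c) * N f \<le> LK_norm R p q b f" .
    have "LK_norm R p q b f \<le> ennreal C1 * dyadic_norm R q ?w (modulus \<circ> f)" by (rule LK)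
    also have "\<dots> \<le> ennreal C1 * (ennreal C * n (modulus \<circ> f))"
      using eqv[OF g] by (intro mult_left_mono) auto
    also have "\<dots> = ennreal (C1 * C) * N f" using c c1 by (simp add: N_def ennreal_mult mult.assoc)
    also have "\<dots> \<le> ennreal (max (c1 * c) (C1 * C)) * N f" by (intro mult_right_mono ennreal_leI) auto
    finally show "LK_norm R p q b f \<le> ennreal (max (c1 * c) (C1 * C)) * N f" .
  qed
  have pos: "0 < c1 * c" using c c1 by simp
  have "equivalent_on (Mfun R) N (LK_norm R p q b)"
    unfolding equivalent_on_def using lo up pos
    by (intro exI[of _ "c1 * c"] exI[of _ "max (c1 * c) (C1 * C)"]) auto
  moreover have "LK_space R p q b = {f \<in> Mfun R. N f < \<infinity>}"
  proof -
    have "LK_norm R p q b f < \<infinity> \<longleftrightarrow> N f < \<infinity>" if f: "f \<in> Mfun R" for f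
    proof
      assume "LK_norm R p q b f < \<infinity>"
      then have "ennreal (c1 * c) * N f < \<infinity>" using lo[OF f] by (rule_tac order_le_less_trans)
      then show "N f < \<infinity>" using pos by (auto simp: ennreal_mult_less_top)
    next
      assume "N f < \<infinity>"
      then have "ennreal (max (c1 * c) (C1 * C)) * N f < \<infinity>" by (simp add: ennreal_mult_less_top)
      then show "LK_norm R p q b f < \<infinity>" using up[OF f] by (rule_tac order_le_less_trans)
    qed
    then show ?thesis by (auto simp: LK_space_def)
  qed
  ultimately show ?thesis by blast
qed

text \<open>Serves (i) and (ii) alike; they differ only in how \<open>fin\<close> is verified. The
  bound from below is t f*(t) \<le> 4 K(t, f), the one-term case of \<open>maxint_lower\<close>; the
  bound from above is Hardy's inequality.\<close>

lemma normable_recip_less_1: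
  assumes sf: "sigma_finite_measure R" and na: "non_atomic R" and inf: "emeasure R (space R) = \<infinity>"
    and sv: "slowly_varying b" and q: "1 \<le> q" and p: "recip p < 1"
    and fin: "lq q (\<lambda>k. ennreal (dyadic_weight (recip p) b k) * indicator {..<0} k) < \<infinity>"
  shows "\<exists>N. banach_function_norm R N \<and> LK_space R p q b = {f \<in> Mfun R. N f < \<infinity>} \<and>
              equivalent_on (Mfun R) N (LK_norm R p q b)"
proof -
  let ?w = "dyadic_weight (recip p) b"
  define n where "n g = lq q (\<lambda>k. ennreal (?w k * 2 powr (- real_of_int k)) * maxint R (2 powr k) g)" for g
  have q0: "0 < q" by (rule exponent_pos_of_ge_1[OF q])
  have n: "fatou_seminorm R n"
    unfolding n_def by (intro fatou_seminorm_lq q fatou_seminorm_maxint)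
  obtain C where C: "0 < C" "\<And>g. g \<in> borel_measurable R \<Longrightarrow> n g \<le> ennreal C * dyadic_norm R q ?w g"
    using dyadic_hardy[OF sv q p] unfolding n_def by blast
  have w0: "0 < ?w k" for k by (rule dyadic_weight_pos[OF sv])
  have low: "dyadic_norm R q ?w g \<le> ennreal 4 * n g" if g: "g \<in> borel_measurable R" for g
    unfolding dyadic_norm_def n_def lq_cmult[OF q0, symmetric]
  proof (rule lq_mono[OF q0])
    fix k
    have "ennreal (?w k) = ennreal (?w k * 2 powr (- real_of_int k)) * ennreal (2 powr k)"
      using w0[of k] by (simp add: powr_minus flip: ennreal_mult)
    then have "ennreal (?w k) * rearr R g (2 powr k) = ennreal (?w k * 2 powr (- real_of_int k)) * (ennreal (2 powr k) * rearr R g (2 powr k))"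
      by (simp only: mult.assoc)
    also have "\<dots> \<le> ennreal (?w k * 2 powr (- real_of_int k)) * (4 * maxint R (2 powr k) g)"
      using maxint_lower[OF na inf g, where n=1 and j="real_of_int k"] by (intro mult_left_mono) auto
    finally show "ennreal (?w k) * rearr R g (2 powr k)
       \<le> ennreal 4 * (ennreal (?w k * 2 powr (- real_of_int k)) * maxint R (2 powr k) g)"
      by (simp add: mult_ac)
  qed
  show ?thesis
  proof (rule normable_of_seminorm[OF sf sv q n _ _ _ fin, where c="1 / C" and C=4])
    fix g :: "'a \<Rightarrow> ennreal" assume g: "g \<in> borel_measurable R"
    have "ennreal (1 / C) * n g \<le> ennreal (1 / C) * (ennreal C * dyadic_norm R q ?w g)"
      using C(2)[OF g] by (intro mult_left_mono) auto
    also have "\<dots> = ennreal (1 / C * C) * dyadic_norm R q ?w g"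
      using C(1) by (subst ennreal_mult) (auto simp: mult.assoc)
    also have "\<dots> = dyadic_norm R q ?w g" using C(1) by simp
    finally show "ennreal (1 / C) * n g \<le> dyadic_norm R q ?w g \<and> dyadic_norm R q ?w g \<le> ennreal 4 * n g"
      using low[OF g] by simp
  next
    fix j :: int
    \<comment> \<open>A single term of the l^q expression already controls \<open>maxint\<close> at
      2^j.\<close>
    define D where "D = ?w j * 2 powr (- real_of_int j)"
    have D: "0 < D" using w0 by (simp add: D_def)
    have "maxint R (2 powr j) g \<le> ennreal (1 / D) * n g" for g
    proof -
      have "maxint R (2 powr j) g = ennreal (1 / D * D) * maxint R (2 powr j) g" using D by simp
      also have "\<dots> = ennreal (1 / D) * (ennreal D * maxint R (2 powr j) g)"
        using D by (subst ennreal_mult) (auto simp: mult.assoc)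
      also have "\<dots> \<le> ennreal (1 / D) * n g"
        unfolding n_def D_def by (intro mult_left_mono lq_ge[OF q0]) auto
      finally show ?thesis .
    qed
    then show "\<exists>D. \<forall>g\<in>borel_measurable R. maxint R (2 powr j) g \<le> ennreal D * n g" by blast
  qed (use C in auto)
qed

section \<open>The limiting case p = q = 1\<close>

lemma nn_integral_int_atMost:
  "(\<integral>\<^sup>+k. x k * indicator {..J} k \<partial>count_space UNIV) = (\<Sum>i. x (J - int i))" for x :: "int \<Rightarrow> ennreal"
proof -
  have b: "bij_betw (\<lambda>i. J - int i) UNIV {..J}"
    by (rule bij_betwI[where g="\<lambda>k. nat (J - k)"]) auto
  have "(\<integral>\<^sup>+k. x k * indicator {..J} k \<partial>count_space UNIV) = (\<integral>\<^sup>+k. x k \<partial>count_space {..J})"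
    by (subst nn_integral_count_space_indicator[of "{..J}"]) auto
  also have "\<dots> = (\<integral>\<^sup>+i. x (J - int i) \<partial>count_space UNIV)"
    by (rule nn_integral_bij_count_space[OF b, symmetric])
  finally show ?thesis by (simp add: nn_integral_count_space_nat)
qed

text \<open>Exhausting the integers by left half-lines gives each partial sum a top index, where the
  summation by parts can start.\<close>

lemma nn_integral_int_SUP:
  "(\<integral>\<^sup>+k. x k \<partial>count_space UNIV) = (SUP n::nat. \<Sum>i. x (int n - int i))" for x :: "int \<Rightarrow> ennreal"
proof -
  have "x k = (SUP n::nat. x k * indicator {..int n} k)" for k
  proof (rule antisym)
    show "x k \<le> (SUP n::nat. x k * indicator {..int n} k)"
      by (rule SUP_upper2[of "nat k"]) auto
  qed (auto intro!: SUP_least simp: indicator_def)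
  then have "(\<integral>\<^sup>+k. x k \<partial>count_space UNIV) = (\<integral>\<^sup>+k. (SUP n::nat. x k * indicator {..int n} k) \<partial>count_space UNIV)"
    by simp
  also have "\<dots> = (SUP n::nat. \<integral>\<^sup>+k. x k * indicator {..int n} k \<partial>count_space UNIV)"
    by (rule nn_integral_monotone_convergence_SUP) (auto simp: incseq_def le_fun_def indicator_def)
  finally show ?thesis by (simp only: nn_integral_int_atMost)
qed

lemma lq_1: "lq 1 x = (\<integral>\<^sup>+k. x k \<partial>count_space UNIV)"
proof -
  have "epowr y 1 = y" for y by (cases y) (auto simp: epowr_ennreal)
  then show ?thesis by (simp add: lq_def)
qed

lemma dyadic_weight_1: "slowly_varying b \<Longrightarrow>
    ennreal (dyadic_weight 1 b k) = ennreal (b (2 powr k)) * ennreal (2 powr k)"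
  unfolding dyadic_weight_def slowly_varying_def
  by (subst ennreal_mult[symmetric]) (auto simp: less_imp_le mult.commute)

lemma dyadic_norm_1: "slowly_varying b \<Longrightarrow> dyadic_norm R 1 (dyadic_weight 1 b) g =
    (\<integral>\<^sup>+k. ennreal (b (2 powr (real_of_int k))) * (ennreal (2 powr k) * rearr R g (2 powr k)) \<partial>count_space UNIV)"
  unfolding dyadic_norm_def lq_1 by (simp add: dyadic_weight_1 mult.assoc)

text \<open>Summation by parts without subtraction: exchanging a triangular double sum turns partial
  sums of c into tails of f.\<close>

lemma sum_triangle_swap:
  fixes c f M :: "nat \<Rightarrow> ennreal"
  assumes "\<And>i. i \<le> n \<Longrightarrow> (\<Sum>m\<in>{i..n}. f m) \<le> M i"
  shows "(\<Sum>m\<le>n. f m * (\<Sum>i\<le>m. c i)) \<le> (\<Sum>i\<le>n. c i * M i)"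
proof -
  have "(\<Sum>m\<le>n. f m * (\<Sum>i\<le>m. c i)) = (\<Sum>m\<le>n. \<Sum>i\<le>n. if i \<le> m then c i * f m else 0)"
  proof (intro sum.cong refl)
    fix m assume "m \<in> {..n}"
    then have "{i \<in> {..n}. i \<le> m} = {..m}" by auto
    then show "f m * (\<Sum>i\<le>m. c i) = (\<Sum>i\<le>n. if i \<le> m then c i * f m else 0)"
      unfolding sum.inter_filter[OF finite_atMost, symmetric]
      by (simp add: sum_distrib_left mult.commute)
  qed
  also have "\<dots> = (\<Sum>i\<le>n. \<Sum>m\<le>n. if i \<le> m then c i * f m else 0)" by (rule sum.swap)
  also have "\<dots> \<le> (\<Sum>i\<le>n. c i * M i)"
  proof (rule sum_mono)
    fix i assume i: "i \<in> {..n}"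
    then have "{m \<in> {..n}. i \<le> m} = {i..n}" by auto
    then have "(\<Sum>m\<le>n. if i \<le> m then c i * f m else 0) = c i * (\<Sum>m\<in>{i..n}. f m)"
      unfolding sum.inter_filter[OF finite_atMost, symmetric] by (simp add: sum_distrib_left)
    also have "\<dots> \<le> c i * M i" using i assms by (intro mult_left_mono) auto
    finally show "(\<Sum>m\<le>n. if i \<le> m then c i * f m else 0) \<le> c i * M i" .
  qed
  finally show ?thesis .
qed

text \<open>In the limiting case the norm is a supremum of combinations \<open>\<Sum>j. c j * maxint R (2^j) g\<close>
  whose tails \<open>\<Sum>j\<ge>k. c j\<close> are dominated by \<open>b (2^k)\<close>; Abel summation turns such a combination
  back into the discretized functional.\<close>
lemma normable_1:
  assumes sf: "sigma_finite_measure R" and na: "non_atomic R" and inf: "emeasure R (space R) = \<infinity>"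
    and sv: "slowly_varying b" and p: "recip p = 1"
    and mono: "\<exists>h. antimono_on {0<..} h \<and> equivalent_on {0<..} (\<lambda>t. ennreal (b t)) h"
  shows "\<exists>N. banach_function_norm R N \<and> LK_space R p 1 b = {f \<in> Mfun R. N f < \<infinity>} \<and>
              equivalent_on (Mfun R) N (LK_norm R p 1 b)"
proof -
  let ?w = "dyadic_weight 1 b"
  define \<beta> where "\<beta> k = b (2 powr (real_of_int k))" for k
  have \<beta>0: "0 < \<beta> k" for k using sv by (simp add: \<beta>_def slowly_varying_def)
  obtain h c0 C0 where h: "antimono_on {0<..} h" and c0: "0 < c0" "c0 \<le> C0"
    and hb: "\<And>t. 0 < t \<Longrightarrow> ennreal c0 * ennreal (b t) \<le> h t" "\<And>t. 0 < t \<Longrightarrow> h t \<le> ennreal C0 * ennreal (b t)"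
    using mono unfolding equivalent_on_def by auto
  define \<eta> where "\<eta> k = enn2real (h (2 powr (real_of_int k)))" for k
  have \<eta>_eq: "h (2 powr (real_of_int k)) = ennreal (\<eta> k)" for k
  proof -
    have "h (2 powr k) \<le> ennreal (C0 * \<beta> k)"
      using hb(2)[of "2 powr k"] c0 \<beta>0[of k] by (simp add: \<beta>_def ennreal_mult)
    then have "h (2 powr k) < top" by (rule order_le_less_trans) simp
    then show ?thesis by (simp add: \<eta>_def)
  qed
  have \<eta>0: "0 \<le> \<eta> k" for k by (simp add: \<eta>_def)
  have \<eta>_mono: "\<eta> m \<le> \<eta> k" if "k \<le> m" for k m
  proof -
    have "h (2 powr m) \<le> h (2 powr k)"
      using that by (intro monotone_onD[OF h]) auto
    then show ?thesis using \<eta>0 by (simp add: \<eta>_eq)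
  qed
  have \<eta>_low: "c0 * \<beta> k \<le> \<eta> k" and \<eta>_up: "\<eta> k \<le> C0 * \<beta> k" for k
  proof -
    have "ennreal (c0 * \<beta> k) \<le> ennreal (\<eta> k)" "ennreal (\<eta> k) \<le> ennreal (C0 * \<beta> k)"
      using hb[of "2 powr k"] c0 \<beta>0[of k] \<eta>_eq[of k] by (auto simp: \<beta>_def ennreal_mult)
    then show "c0 * \<beta> k \<le> \<eta> k" "\<eta> k \<le> C0 * \<beta> k" using \<eta>0[of k] c0 \<beta>0[of k] by auto
  qed
  \<comment> \<open>A whole class of coefficients instead of the increments of \<eta> alone: if
    \<eta> has a positive limit at \<infinity>, the increments miss it, whereas members of this
    class may put the remaining mass at any index.\<close>
  define T where "T = {c :: int \<Rightarrow> ennreal. \<forall>k. (\<integral>\<^sup>+j. c j * indicator {k..} j \<partial>count_space UNIV) \<le> ennreal (\<beta> k)}"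
  define n where "n g = (SUP c\<in>T. lq 1 (\<lambda>j. c j * maxint R (2 powr j) g))" for g
  have n: "fatou_seminorm R n"
    unfolding n_def by (intro fatou_seminorm_SUP fatou_seminorm_lq fatou_seminorm_maxint) auto
  define f where "f g k = ennreal (2 powr (real_of_int k)) * rearr R g (2 powr (real_of_int k))" for g k
  have dn: "dyadic_norm R 1 ?w g = (\<integral>\<^sup>+k. ennreal (\<beta> k) * f g k \<partial>count_space UNIV)" for g
    unfolding f_def \<beta>_def by (rule dyadic_norm_1[OF sv])
  have mi: "maxint R (2 powr j) g \<le> 2 * (\<Sum>i. f g (j - int i))" if "g \<in> borel_measurable R" for g j
    using maxint_le[OF that, of "real_of_int j"] by (simp add: f_def)
  have upper: "n g \<le> 2 * dyadic_norm R 1 ?w g" if g: "g \<in> borel_measurable R" for g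
    unfolding n_def
  proof (rule SUP_least)
    fix c assume c: "c \<in> T"
    have "lq 1 (\<lambda>j. c j * maxint R (2 powr j) g)
        \<le> (\<integral>\<^sup>+j. c j * (2 * (\<integral>\<^sup>+k. f g k * indicator {..j} k \<partial>count_space UNIV)) \<partial>count_space UNIV)"
      unfolding lq_1 nn_integral_int_atMost by (intro nn_integral_mono mult_left_mono mi g) auto
    also have "\<dots> = (\<integral>\<^sup>+j. \<integral>\<^sup>+k. 2 * (c j * f g k * indicator {..j} k) \<partial>count_space UNIV \<partial>count_space UNIV)"
      by (simp add: nn_integral_cmult[symmetric] mult_ac)
    also have "\<dots> = (\<integral>\<^sup>+k. \<integral>\<^sup>+j. 2 * (c j * f g k * indicator {..j} k) \<partial>count_space UNIV \<partial>count_space UNIV)"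
      by (intro nn_integral_count_space_nn_integral) auto
    \<comment> \<open>After the exchange the inner sum is the tail of c from k on, which membership
      in \<open>T\<close> bounds by \<open>\<beta> k\<close>.\<close>
    also have "\<dots> = (\<integral>\<^sup>+k. 2 * (f g k * (\<integral>\<^sup>+j. c j * indicator {k..} j \<partial>count_space UNIV)) \<partial>count_space UNIV)"
      by (intro nn_integral_cong) (auto simp: nn_integral_cmult[symmetric] indicator_def mult.commute intro!: nn_integral_cong)
    also have "\<dots> \<le> (\<integral>\<^sup>+k. 2 * (f g k * ennreal (\<beta> k)) \<partial>count_space UNIV)"
      using c by (intro nn_integral_mono mult_left_mono) (auto simp: T_def)
    also have "\<dots> = 2 * dyadic_norm R 1 ?w g"
      unfolding dn by (subst nn_integral_cmult) (auto simp: mult.commute)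
    finally show "lq 1 (\<lambda>j. c j * maxint R (2 powr j) g) \<le> 2 * dyadic_norm R 1 ?w g" .
  qed
  have fin_low: "(\<Sum>m\<le>N. ennreal (\<beta> (J - int m)) * f g (J - int m)) \<le> ennreal (4 * C0 / c0) * n g"
    if g: "g \<in> borel_measurable R" for g J N
  proof -
    \<comment> \<open>The term with i = 0 places all of \<open>\<eta> J\<close> at J, so that the
      sums telescope to \<open>\<eta> (J - int m)\<close>; division by C0 keeps the tails below
      \<beta>.\<close>
    define d where "d i = (if i = 0 then \<eta> J else \<eta> (J - int i) - \<eta> (J - int i + 1)) / C0" for i :: nat
    have d0: "0 \<le> d i" for i using \<eta>_mono[of "J - int i" "J - int i + 1"] \<eta>0 c0 by (auto simp: d_def)
    have ds: "(\<Sum>i\<le>m. d i) = \<eta> (J - int m) / C0" for m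
    proof (induction m)
      case (Suc m)
      have "J - int (Suc m) + 1 = J - int m" by simp
      then have "d (Suc m) = (\<eta> (J - int (Suc m)) - \<eta> (J - int m)) / C0" by (simp only: d_def) simp
      then show ?case using Suc by (simp add: diff_divide_distrib)
    qed (simp add: d_def)
    have dse: "(\<Sum>i\<le>m. ennreal (d i)) = ennreal (\<eta> (J - int m) / C0)" for m
      using d0 ds by simp
    define c where "c j = (if j \<le> J then ennreal (d (nat (J - j))) else 0)" for j
    have "(\<integral>\<^sup>+j. c j * indicator {k..} j \<partial>count_space UNIV) \<le> ennreal (\<beta> k)" for k
    proof -
      have "(\<integral>\<^sup>+j. c j * indicator {k..} j \<partial>count_space UNIV)
        = (\<integral>\<^sup>+j. (c j * indicator {k..} j) * indicator {..J} j \<partial>count_space UNIV)"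
        by (intro nn_integral_cong) (auto simp: c_def indicator_def)
      also have "\<dots> = (\<Sum>i. c (J - int i) * indicator {k..} (J - int i))" by (rule nn_integral_int_atMost)
      also have "\<dots> = (\<Sum>i. ennreal (d i) * indicator {k..} (J - int i))" by (simp add: c_def)
      also have "\<dots> \<le> ennreal (\<beta> k)"
      proof (cases "k \<le> J")
        case True
        have "(\<Sum>i. ennreal (d i) * indicator {k..} (J - int i))
          = (\<Sum>i\<le>nat (J - k). ennreal (d i) * indicator {k..} (J - int i))"
          using True by (intro suminf_finite) auto
        also have "\<dots> = (\<Sum>i\<le>nat (J - k). ennreal (d i))"
          using True by (intro sum.cong) auto
        also have "\<dots> = ennreal (\<eta> k / C0)" using True by (simp add: dse)
        also have "\<dots> \<le> ennreal (\<beta> k)" using \<eta>_up[of k] c0 by (intro ennreal_leI) (simp add: field_simps)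
        finally show ?thesis .
      next
        case False
        then have "(\<lambda>i. ennreal (d i) * indicator {k..} (J - int i)) = (\<lambda>_. 0)" by (auto simp: fun_eq_iff)
        then show ?thesis by simp
      qed
      finally show ?thesis .
    qed
    then have cT: "c \<in> T" by (simp add: T_def)
    define M where "M i = 4 * maxint R (2 powr (real_of_int (J - int i))) g" for i :: nat
    have "(\<Sum>m\<in>{i..N}. f g (J - int m)) \<le> M i" if "i \<le> N" for i
    proof -
      have "(\<Sum>m\<in>{i..N}. f g (J - int m)) = (\<Sum>l<N - i + 1. f g (J - int i - int l))"
        using that by (intro sum.reindex_bij_witness[where i="\<lambda>l. l + i" and j="\<lambda>m. m - i"]) (auto simp: algebra_simps)
      also have "\<dots> \<le> M i"
        using maxint_lower[OF na inf g, where n="N - i + 1" and j="real_of_int (J - int i)"]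
        by (simp add: f_def M_def)
      finally show ?thesis .
    qed
    then have "(\<Sum>m\<le>N. f g (J - int m) * (\<Sum>i\<le>m. ennreal (d i))) \<le> (\<Sum>i\<le>N. ennreal (d i) * M i)"
      by (rule sum_triangle_swap)
    also have "\<dots> \<le> (\<Sum>i. ennreal (d i) * M i)"
      by (intro sum_le_suminf) auto
    also have "\<dots> = (\<Sum>i. 4 * (c (J - int i) * maxint R (2 powr (real_of_int (J - int i))) g))"
      by (simp add: c_def M_def mult_ac)
    also have "\<dots> = 4 * (\<integral>\<^sup>+j. c j * maxint R (2 powr j) g * indicator {..J} j \<partial>count_space UNIV)"
      by (simp add: nn_integral_int_atMost)
    also have "\<dots> \<le> 4 * lq 1 (\<lambda>j. c j * maxint R (2 powr j) g)"
      unfolding lq_1 by (intro mult_left_mono nn_integral_mono) (auto simp: indicator_def)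
    also have "\<dots> \<le> 4 * n g"
      unfolding n_def using cT by (intro mult_left_mono SUP_upper) auto
    finally have le: "(\<Sum>m\<le>N. f g (J - int m) * ennreal (\<eta> (J - int m) / C0)) \<le> 4 * n g" by (simp only: dse)
    have "(\<Sum>m\<le>N. ennreal (\<beta> (J - int m)) * f g (J - int m))
      \<le> (\<Sum>m\<le>N. ennreal (C0 / c0) * (f g (J - int m) * ennreal (\<eta> (J - int m) / C0)))"
    proof (rule sum_mono)
      fix m
      have "\<beta> (J - int m) \<le> C0 / c0 * (\<eta> (J - int m) / C0)"
        using \<eta>_low[of "J - int m"] c0 by (simp add: field_simps)
      then have "ennreal (\<beta> (J - int m)) \<le> ennreal (C0 / c0 * (\<eta> (J - int m) / C0))" by (rule ennreal_leI)
      also have "\<dots> = ennreal (C0 / c0) * ennreal (\<eta> (J - int m) / C0)"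
        using c0 \<eta>0 by (intro ennreal_mult) auto
      finally show "ennreal (\<beta> (J - int m)) * f g (J - int m)
         \<le> ennreal (C0 / c0) * (f g (J - int m) * ennreal (\<eta> (J - int m) / C0))"
        by (simp only: mult.commute[of "f g (J - int m)"] mult.assoc[symmetric]) (rule mult_right_mono, auto)
    qed
    also have "\<dots> \<le> ennreal (C0 / c0) * (4 * n g)"
      unfolding sum_distrib_left[symmetric] by (rule mult_left_mono[OF le]) simp
    also have "\<dots> = ennreal (4 * C0 / c0) * n g"
    proof -
      have "ennreal (4 * C0 / c0) = ennreal (C0 / c0 * 4)" by (simp add: mult.commute)
      also have "\<dots> = ennreal (C0 / c0) * ennreal 4" using c0 by (intro ennreal_mult) auto
      finally show ?thesis by (simp add: mult.assoc)
    qed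
    finally show ?thesis .
  qed
  have lower: "dyadic_norm R 1 ?w g \<le> ennreal (4 * C0 / c0) * n g" if g: "g \<in> borel_measurable R" for g
    unfolding dn nn_integral_int_SUP
  proof (rule SUP_least)
    fix K :: nat
    show "(\<Sum>i. ennreal (\<beta> (int K - int i)) * f g (int K - int i)) \<le> ennreal (4 * C0 / c0) * n g"
      unfolding suminf_eq_SUP
    proof (rule SUP_least)
      fix N :: nat
      have "(\<Sum>i<N. ennreal (\<beta> (int K - int i)) * f g (int K - int i))
         \<le> (\<Sum>i\<le>N. ennreal (\<beta> (int K - int i)) * f g (int K - int i))" by (intro sum_mono2) auto
      also have "\<dots> \<le> ennreal (4 * C0 / c0) * n g" by (rule fin_low[OF g])
      finally show "(\<Sum>i<N. ennreal (\<beta> (int K - int i)) * f g (int K - int i)) \<le> ennreal (4 * C0 / c0) * n g" .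
    qed
  qed
  have maxn: "maxint R (2 powr j) g \<le> ennreal (8 * C0 * C0 / (c0 * c0 * \<beta> j)) * n g"
    if g: "g \<in> borel_measurable R" for g j
  proof -
    \<comment> \<open>Almost monotonicity gives \<open>1 \<le> D * \<beta> k\<close> for every
      \<open>k \<le> j\<close>, so one constant dominates all terms that bound \<open>maxint\<close>
      at 2^j.\<close>
    define D where "D = C0 / (c0 * \<beta> j)"
    have D: "0 < D" using c0 \<beta>0 by (simp add: D_def)
    have "f g (j - int i) \<le> ennreal D * (ennreal (\<beta> (j - int i)) * f g (j - int i))" for i
    proof -
      have "c0 * \<beta> j \<le> C0 * \<beta> (j - int i)"
        using \<eta>_low[of j] \<eta>_up[of "j - int i"] \<eta>_mono[of "j - int i" j] by simp
      then have "1 \<le> D * \<beta> (j - int i)" using c0 \<beta>0[of j] by (simp add: D_def field_simps)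
      then have "1 \<le> ennreal (D * \<beta> (j - int i))" by simp
      also have "\<dots> = ennreal D * ennreal (\<beta> (j - int i))"
        using D \<beta>0[of "j - int i"] by (intro ennreal_mult) auto
      finally have "1 * f g (j - int i) \<le> (ennreal D * ennreal (\<beta> (j - int i))) * f g (j - int i)"
        by (rule mult_right_mono) simp
      then show ?thesis by (simp add: mult.assoc)
    qed
    then have "(\<Sum>i. f g (j - int i)) \<le> (\<Sum>i. ennreal D * (ennreal (\<beta> (j - int i)) * f g (j - int i)))"
      by (intro suminf_le) auto
    also have "\<dots> = ennreal D * (\<integral>\<^sup>+k. ennreal (\<beta> k) * f g k * indicator {..j} k \<partial>count_space UNIV)"
      by (simp add: nn_integral_int_atMost)
    also have "\<dots> \<le> ennreal D * dyadic_norm R 1 ?w g"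
      unfolding dn by (intro mult_left_mono nn_integral_mono) (auto simp: indicator_def)
    finally have "maxint R (2 powr j) g \<le> 2 * (ennreal D * dyadic_norm R 1 ?w g)"
      using mi[OF g, of j] by (meson mult_left_mono order_trans zero_le)
    also have "\<dots> \<le> 2 * (ennreal D * (ennreal (4 * C0 / c0) * n g))"
      using lower[OF g] by (intro mult_left_mono) auto
    also have "\<dots> = ennreal (2 * (D * (4 * C0 / c0))) * n g"
    proof -
      have "ennreal (2 * (D * (4 * C0 / c0))) = ennreal 2 * (ennreal D * ennreal (4 * C0 / c0))"
        using D c0 by (subst ennreal_mult, simp, simp, subst ennreal_mult) auto
      then show ?thesis by (simp add: mult.assoc)
    qed
    also have "2 * (D * (4 * C0 / c0)) = 8 * C0 * C0 / (c0 * c0 * \<beta> j)" by (simp add: D_def mult_ac)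
    finally show ?thesis .
  qed
  have fin: "lq 1 (\<lambda>k. ennreal (?w k) * indicator {..<0} k) < \<infinity>"
    using lq_dyadic_weight_lessThan[OF sv, of 1 1] by (auto intro: order_le_less_trans)
  show ?thesis
  proof (rule normable_of_seminorm[OF sf sv _ n, where c="1 / 2" and C="4 * C0 / c0"])
    fix g :: "'a \<Rightarrow> ennreal" assume g: "g \<in> borel_measurable R"
    have "ennreal (1 / 2) * n g \<le> ennreal (1 / 2) * (2 * dyadic_norm R 1 ?w g)"
      using upper[OF g] by (intro mult_left_mono) auto
    also have "\<dots> = (ennreal (1 / 2) * ennreal 2) * dyadic_norm R 1 ?w g" by (simp add: mult.assoc)
    also have "ennreal (1 / 2) * ennreal 2 = 1" by (subst ennreal_mult[symmetric]) auto
    finally show "ennreal (1 / 2) * n g \<le> dyadic_norm R 1 (dyadic_weight (recip p) b) g \<and>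
        dyadic_norm R 1 (dyadic_weight (recip p) b) g \<le> ennreal (4 * C0 / c0) * n g"
      using lower[OF g] p by simp
  qed (use c0 fin p maxn in auto)
qed

section \<open>Necessity\<close>

text \<open>Passing to the norm and back is paid for once for the whole sum, so \<open>A\<close>
  does not depend on the number of summands. Every exclusion below exploits this by letting that
  number grow.\<close>

lemma necessary_dyadic:
  assumes sv: "slowly_varying b" and q: "0 < q"
    and bfn: "banach_function_norm R N" and eqv: "equivalent_on (Mfun R) N (LK_norm R p q b)"
  shows "\<exists>A>0. \<forall>(G :: nat \<Rightarrow> 'a \<Rightarrow> ennreal) n. (\<forall>i. G i \<in> borel_measurable R) \<longrightarrow>
      dyadic_norm R q (dyadic_weight (recip p) b) (\<lambda>x. \<Sum>i<n. G i x)
        \<le> ennreal A * (\<Sum>i<n. dyadic_norm R q (dyadic_weight (recip p) b) (G i))"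
    and "\<And>E. E \<in> sets R \<Longrightarrow> emeasure R E < \<infinity> \<Longrightarrow>
      dyadic_norm R q (dyadic_weight (recip p) b) (indicator E) < \<infinity>"
proof -
  let ?d = "dyadic_norm R q (dyadic_weight (recip p) b)"
  define n where "n g = N (ecomplex_of_ennreal \<circ> g)" for g :: "'a \<Rightarrow> ennreal"
  note b = bfn[unfolded banach_function_norm_def Let_def, folded n_def]
  have hom: "n (\<lambda>x. ennreal a * g x) = ennreal a * n g" if "0 \<le> a" "g \<in> borel_measurable R" for a g
    by (rule b[THEN conjunct2, THEN conjunct1, rule_format, OF that])
  have add: "n (\<lambda>x. g x + h x) \<le> n g + n h" if "g \<in> borel_measurable R" "h \<in> borel_measurable R" for g h
    by (rule b[THEN conjunct2, THEN conjunct2, THEN conjunct1, rule_format, OF that])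
  have fin: "n (indicator E) < \<infinity>" if "E \<in> sets R" "emeasure R E < \<infinity>" for E
    by (rule b[THEN conjunct2, THEN conjunct2, THEN conjunct2, THEN conjunct2, THEN conjunct2, THEN conjunct2,
          THEN conjunct1, rule_format, OF that])
  have zero: "n (\<lambda>x. 0) = 0" using hom[of 0 "\<lambda>x. 0"] by simp
  have sum: "n (\<lambda>x. \<Sum>i<m. G i x) \<le> (\<Sum>i<m. n (G i))" if [measurable]: "\<And>i. G i \<in> borel_measurable R"
    for G :: "nat \<Rightarrow> 'a \<Rightarrow> ennreal" and m
  proof (induction m)
    case (Suc m)
    have "n (\<lambda>x. (\<Sum>i<m. G i x) + G m x) \<le> n (\<lambda>x. \<Sum>i<m. G i x) + n (G m)" by (intro add) auto
    also have "\<dots> \<le> (\<Sum>i<m. n (G i)) + n (G m)" using Suc by (intro add_right_mono)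
    finally show ?case by simp
  qed (simp add: zero)
  obtain c C where c: "0 < c" "c \<le> C"
    and N: "\<And>f. f \<in> Mfun R \<Longrightarrow> ennreal c * N f \<le> LK_norm R p q b f"
      "\<And>f. f \<in> Mfun R \<Longrightarrow> LK_norm R p q b f \<le> ennreal C * N f"
    using eqv unfolding equivalent_on_def by auto
  obtain c1 C1 where c1: "0 < c1" "0 < C1"
    and LK: "\<And>f. ennreal c1 * ?d (modulus \<circ> f) \<le> LK_norm R p q b f"
      "\<And>f. LK_norm R p q b f \<le> ennreal C1 * ?d (modulus \<circ> f)"
    using LK_norm_dyadic[OF sv q] by meson
  have cancel: "x \<le> ennreal (D / a) * y" if "ennreal a * x \<le> ennreal D * y" "0 < a" "0 \<le> D" for a D x y
  proof -
    have "x = ennreal (1 / a * a) * x" using that by simp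
    also have "\<dots> = ennreal (1 / a) * (ennreal a * x)"
      using that by (subst ennreal_mult) (auto simp: mult.assoc)
    also have "\<dots> \<le> ennreal (1 / a) * (ennreal D * y)" using that by (intro mult_left_mono) auto
    also have "\<dots> = ennreal (1 / a * D) * y"
      using that by (subst ennreal_mult) (auto simp: mult.assoc)
    finally show ?thesis by simp
  qed
  have dn: "?d g \<le> ennreal (C / c1) * n g" and nd: "n g \<le> ennreal (C1 / c) * ?d g"
    if "g \<in> borel_measurable R" for g
  proof -
    have f: "ecomplex_of_ennreal \<circ> g \<in> Mfun R" by (rule ecomplex_comp_Mfun[OF that])
    show "?d g \<le> ennreal (C / c1) * n g"
      using LK(1)[of "ecomplex_of_ennreal \<circ> g"] N(2)[OF f] c c1
      unfolding modulus_comp_ecomplex n_def by (intro cancel) (auto intro: order_trans)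
    show "n g \<le> ennreal (C1 / c) * ?d g"
      using LK(2)[of "ecomplex_of_ennreal \<circ> g"] N(1)[OF f] c c1
      unfolding modulus_comp_ecomplex n_def by (intro cancel) (auto intro: order_trans)
  qed
  have "?d (\<lambda>x. \<Sum>i<m. G i x) \<le> ennreal (C / c1 * (C1 / c)) * (\<Sum>i<m. ?d (G i))"
    if G[measurable]: "\<And>i. G i \<in> borel_measurable R" for G :: "nat \<Rightarrow> 'a \<Rightarrow> ennreal" and m
  proof -
    have "?d (\<lambda>x. \<Sum>i<m. G i x) \<le> ennreal (C / c1) * n (\<lambda>x. \<Sum>i<m. G i x)" by (intro dn) auto
    also have "\<dots> \<le> ennreal (C / c1) * (\<Sum>i<m. n (G i))" by (intro mult_left_mono sum G) auto
    also have "\<dots> \<le> ennreal (C / c1) * (\<Sum>i<m. ennreal (C1 / c) * ?d (G i))"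
      by (intro mult_left_mono sum_mono nd G) auto
    also have "\<dots> = ennreal (C / c1 * (C1 / c)) * (\<Sum>i<m. ?d (G i))"
      unfolding sum_distrib_left[symmetric] using c c1
      by (subst ennreal_mult[of "C / c1" "C1 / c"]) (auto simp: mult.assoc)
    finally show ?thesis .
  qed
  moreover have "0 < C / c1 * (C1 / c)" using c c1 by simp
  ultimately show "\<exists>A>0. \<forall>(G :: nat \<Rightarrow> 'a \<Rightarrow> ennreal) n. (\<forall>i. G i \<in> borel_measurable R) \<longrightarrow>
      ?d (\<lambda>x. \<Sum>i<n. G i x) \<le> ennreal A * (\<Sum>i<n. ?d (G i))" by blast
  fix E assume E: "E \<in> sets R" "emeasure R E < \<infinity>"
  have "?d (indicator E) \<le> ennreal (C / c1) * n (indicator E)" using E by (intro dn) auto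
  also have "\<dots> < \<infinity>" using fin[OF E] by (simp add: ennreal_mult_less_top)
  finally show "?d (indicator E) < \<infinity>" .
qed

section \<open>Exclusion of q < 1\<close>

lemma rearr_ge_on:
  assumes "g \<in> borel_measurable R" "E \<in> sets R" "\<And>x. x \<in> E \<Longrightarrow> c \<le> g x" "ennreal t < emeasure R E"
  shows "c \<le> rearr R g t"
proof (rule rearr_ge)
  fix s assume "s < c"
  then have "E \<subseteq> {x \<in> space R. g x > s}"
    using assms sets.sets_into_space[of E R] by (auto intro: order_less_le_trans)
  moreover have "{x \<in> space R. g x > s} \<in> sets R" using assms(1) by measurable
  ultimately have "emeasure R E \<le> emeasure R {x \<in> space R. g x > s}" by (rule emeasure_mono)
  with assms(4) show "ennreal t < emeasure R {x \<in> space R. g x > s}" by (rule order_less_le_trans)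
qed

lemma dyadic_norm_indicator_ge:
  assumes q: "0 < q" and E: "E \<in> sets R" "emeasure R E = ennreal (2 powr (real_of_int m))"
  shows "lq q (\<lambda>k. ennreal (w k) * indicator {..<m} k) \<le> dyadic_norm R q w (indicator E)"
  unfolding dyadic_norm_def
proof (intro lq_mono[OF q] mult_left_mono)
  fix k
  show "indicator {..<m} k \<le> rearr R (indicator E) (2 powr k)"
  proof (cases "k < m")
    case True
    then have "1 \<le> rearr R (indicator E) (2 powr k)"
      using E by (intro rearr_ge_on[of _ _ E]) (auto simp: ennreal_less_iff)
    then show ?thesis using True by simp
  qed simp
qed simp

text \<open>For \<open>q < 1\<close> characteristic functions of sets with rapidly decreasing measures, normalized in
  the functional, behave like the unit vectors of \<open>\<ell>\<^sup>q\<close>.\<close>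
lemma not_convex_q_less_1:
  assumes na: "non_atomic R" and inf: "emeasure R (space R) = \<infinity>"
    and q: "0 < q" "q < 1" and w: "\<And>k. 0 < w k" and A: "0 < A"
    and conv: "\<And>(G :: nat \<Rightarrow> 'a \<Rightarrow> ennreal) n. (\<And>i. G i \<in> borel_measurable R) \<Longrightarrow>
      dyadic_norm R q w (\<lambda>x. \<Sum>i<n. G i x) \<le> ennreal A * (\<Sum>i<n. dyadic_norm R q w (G i))"
    and fin: "\<And>E. E \<in> sets R \<Longrightarrow> emeasure R E < \<infinity> \<Longrightarrow> dyadic_norm R q w (indicator E) < \<infinity>"
  shows False
proof -
  define r where "r = enn2real q"
  have qt: "q \<noteq> \<infinity>" using q by auto
  have r: "0 < r" "r < 1" using q unfolding r_def by (cases q; auto simp: ennreal_less_iff)+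
  \<comment> \<open>The r-th power of the size of a characteristic function of a set of measure 2^m;
    unlike the size itself, it is additive over blocks of indices.\<close>
  define V where "V m = (\<integral>\<^sup>+k. ennreal (w k powr r) * indicator {..<m} k \<partial>count_space UNIV)" for m :: int
  have lqV: "lq q (\<lambda>k. ennreal (w k) * indicator {..<m} k) = epowr (V m) (1 / r)" for m
  proof -
    have "epowr (ennreal (w k) * indicator {..<m} k) r = ennreal (w k powr r) * indicator {..<m} k" for k
      using w[of k] by (cases "k < m") (auto simp: epowr_ennreal)
    then show ?thesis using qt by (simp add: lq_def r_def[symmetric] V_def)
  qed
  have "\<exists>E\<in>sets R. emeasure R E = ennreal (2 powr (real_of_int m))" for m
    using non_atomic_subset_emeasure[OF na, of "space R" "2 powr (real_of_int m)"] inf by auto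
  then obtain E where E: "\<And>m. E m \<in> sets R" "\<And>m. emeasure R (E m) = ennreal (2 powr (real_of_int m))" by metis
  have "V m \<noteq> \<infinity>" for m
  proof
    assume "V m = \<infinity>"
    then have "lq q (\<lambda>k. ennreal (w k) * indicator {..<m} k) = \<infinity>" by (simp add: lqV)
    then show False
      using dyadic_norm_indicator_ge[OF q(1) E(1) E(2), of w m] fin[OF E(1), of m] E(2)[of m] by simp
  qed
  define v where "v m = enn2real (V m)" for m
  have Vv: "V m = ennreal (v m)" for m using \<open>V m \<noteq> \<infinity>\<close> by (simp add: v_def less_top)
  have Vsum: "V m = (\<Sum>i. ennreal (w (m - 1 - int i) powr r))" for m
  proof -
    have "{..<m} = {..m - 1}" by auto
    then show ?thesis unfolding V_def by (simp only: nn_integral_int_atMost)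
  qed
  have v0: "0 < v m" for m
  proof -
    have "0 < ennreal (w (m - 1) powr r)" using w[of "m - 1"] by simp
    also have "\<dots> \<le> V m" unfolding Vsum using ennreal_le_suminf[of "\<lambda>i. ennreal (w (m - 1 - int i) powr r)" 0] by simp
    finally show ?thesis by (simp add: Vv)
  qed
  \<comment> \<open>The next set is so small that the indices between the two already carry half of
    \<open>v m\<close>. Successive blocks are disjoint.\<close>
  have "\<exists>m'\<le>m. v m / 2 \<le> (\<Sum>k\<in>{m'..<m}. w k powr r)" for m
  proof -
    have "ennreal (v m / 2) < V m" unfolding Vv using v0[of m] by (intro ennreal_lessI) auto
    then obtain n :: nat where "ennreal (v m / 2) < (\<Sum>i<n. ennreal (w (m - 1 - int i) powr r))"
      unfolding Vsum suminf_eq_SUP less_SUP_iff by blast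
    also have "\<dots> = ennreal (\<Sum>i<n. w (m - 1 - int i) powr r)" by simp
    also have "(\<Sum>i<n. w (m - 1 - int i) powr r) = (\<Sum>k\<in>{m - int n..<m}. w k powr r)"
      by (rule sum.reindex_bij_witness[where i="\<lambda>k. nat (m - 1 - k)" and j="\<lambda>i. m - 1 - int i"]) auto
    finally have "v m / 2 \<le> (\<Sum>k\<in>{m - int n..<m}. w k powr r)"
      using v0[of m] by (simp add: ennreal_less_iff)
    then show ?thesis by (intro exI[of _ "m - int n"]) simp
  qed
  then obtain nx where nx: "\<And>m. nx m \<le> m" "\<And>m. v m / 2 \<le> (\<Sum>k\<in>{nx m..<m}. w k powr r)" by metis
  define m where "m i = (nx ^^ i) 0" for i :: nat
  have mS: "m (Suc i) = nx (m i)" for i by (simp add: m_def)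
  have m0: "m i \<le> m 0" for i
  proof (induction i)
    case (Suc i)
    then show ?case using nx(1)[of "m i"] mS[of i] by simp
  qed simp
  define c where "c i = v (m i) powr (- (1 / r))" for i
  have c0: "0 < c i" for i using v0[of "m i"] by (simp add: c_def)
  have cr: "c i powr r = 1 / v (m i)" for i
  proof -
    have "c i powr r = v (m i) powr (- 1)" unfolding c_def powr_powr using r by simp
    then show ?thesis using v0[of "m i"] by (simp add: powr_minus_divide)
  qed
  define G where "G i = (\<lambda>x. ennreal (c i) * indicator (E (m i)) x)" for i
  have G: "G i \<in> borel_measurable R" for i unfolding G_def using E(1) by measurable
  have Gn: "dyadic_norm R q w (G i) \<le> 1" for i
  proof -
    have "dyadic_norm R q w (G i) \<le> ennreal (c i) * epowr (V (m i)) (1 / r)"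
      unfolding G_def lqV[symmetric] using E by (intro dyadic_norm_indicator_le q) auto
    also have "\<dots> = ennreal (c i * v (m i) powr (1 / r))"
      unfolding Vv using v0[of "m i"] c0[of i] by (subst epowr_ennreal) (auto simp: ennreal_mult less_imp_le)
    also have "c i * v (m i) powr (1 / r) = 1"
      using v0[of "m i"] unfolding c_def powr_add[symmetric] by simp
    finally show ?thesis by simp
  qed
  have main: "real n / 2 \<le> (A * n) powr r" for n :: nat
  proof -
    let ?f = "\<lambda>x. \<Sum>i<n. G i x"
    have fm: "?f \<in> borel_measurable R" using G by measurable
    have "dyadic_norm R q w ?f \<le> ennreal A * (\<Sum>i<n. dyadic_norm R q w (G i))" by (rule conv[OF G])
    also have "\<dots> \<le> ennreal A * (\<Sum>i<n. 1)" by (intro mult_left_mono sum_mono Gn) auto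
    also have "\<dots> = ennreal (A * n)" using A by (simp add: ennreal_mult ennreal_of_nat_eq_real_of_nat)
    finally have up: "epowr (dyadic_norm R q w ?f) r \<le> ennreal ((A * n) powr r)"
      using A r by (subst epowr_ennreal[symmetric]) (auto intro: epowr_mono)
    have eq: "epowr (dyadic_norm R q w ?f) r =
        (\<integral>\<^sup>+k. epowr (ennreal (w k) * rearr R ?f (2 powr k)) r \<partial>count_space UNIV)"
      unfolding dyadic_norm_def lq_def if_not_P[OF qt] r_def[symmetric] using r by (simp add: epowr_inverse_epowr)
    \<comment> \<open>On block l the whole sum dominates its summand l, so the rearrangement is at
      least \<open>c l\<close> there and the block contributes at least 1/2.\<close>
    have blocks: "ennreal (real l / 2) \<le> (\<Sum>k\<in>{m l..<m 0}. epowr (ennreal (w k) * rearr R ?f (2 powr k)) r)"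
      if "l \<le> n" for l using that
    proof (induction l)
      case (Suc l)
      have "1 / 2 = (1 / v (m l)) * (v (m l) / 2)" using v0[of "m l"] by simp
      also have "\<dots> \<le> (1 / v (m l)) * (\<Sum>k\<in>{m (Suc l)..<m l}. w k powr r)"
        unfolding mS using v0[of "m l"] by (intro mult_left_mono nx) auto
      also have "\<dots> = (\<Sum>k\<in>{m (Suc l)..<m l}. (w k * c l) powr r)"
        using w by (simp add: sum_distrib_left powr_mult cr mult.commute)
      finally have "ennreal (1 / 2) \<le> ennreal (\<Sum>k\<in>{m (Suc l)..<m l}. (w k * c l) powr r)"
        by (rule ennreal_leI)
      also have "\<dots> = (\<Sum>k\<in>{m (Suc l)..<m l}. ennreal ((w k * c l) powr r))"
        by (rule sum_ennreal[symmetric]) simp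
      also have "\<dots> \<le> (\<Sum>k\<in>{m (Suc l)..<m l}. epowr (ennreal (w k) * rearr R ?f (2 powr k)) r)"
      proof (rule sum_mono)
        fix k assume k: "k \<in> {m (Suc l)..<m l}"
        have "ennreal (c l) \<le> rearr R ?f (2 powr k)"
        proof (rule rearr_ge_on[OF fm E(1)])
          show "ennreal (c l) \<le> ?f x" if "x \<in> E (m l)" for x
          proof -
            have "G l x \<le> ?f x" using Suc.prems by (intro member_le_sum) auto
            then show ?thesis using that by (simp add: G_def)
          qed
          show "ennreal (2 powr k) < emeasure R (E (m l))" using k E(2) by (simp add: ennreal_less_iff)
        qed
        then have "ennreal (w k) * ennreal (c l) \<le> ennreal (w k) * rearr R ?f (2 powr k)" by (rule mult_left_mono) simp
        then have "epowr (ennreal (w k * c l)) r \<le> epowr (ennreal (w k) * rearr R ?f (2 powr k)) r"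
          using r w[of k] c0[of l] by (intro epowr_mono) (auto simp: ennreal_mult)
        then show "ennreal ((w k * c l) powr r) \<le> epowr (ennreal (w k) * rearr R ?f (2 powr k)) r"
          using w[of k] c0[of l] by (subst (asm) epowr_ennreal) auto
      qed
      finally have 1: "ennreal (1 / 2) \<le> (\<Sum>k\<in>{m (Suc l)..<m l}. epowr (ennreal (w k) * rearr R ?f (2 powr k)) r)" .
      have "real (Suc l) / 2 = 1 / 2 + real l / 2" by (simp add: field_simps)
      then have "ennreal (real (Suc l) / 2) = ennreal (1 / 2) + ennreal (real l / 2)"
        by (simp only: ennreal_plus zero_le_divide_1_iff zero_le_numeral divide_nonneg_nonneg of_nat_0_le_iff)
      also have "\<dots> \<le> (\<Sum>k\<in>{m (Suc l)..<m l}. epowr (ennreal (w k) * rearr R ?f (2 powr k)) r)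
           + (\<Sum>k\<in>{m l..<m 0}. epowr (ennreal (w k) * rearr R ?f (2 powr k)) r)"
        using 1 Suc by (intro add_mono) auto
      also have "\<dots> = (\<Sum>k\<in>{m (Suc l)..<m l} \<union> {m l..<m 0}. epowr (ennreal (w k) * rearr R ?f (2 powr k)) r)"
        by (intro sum.union_disjoint[symmetric]) auto
      also have "{m (Suc l)..<m l} \<union> {m l..<m 0} = {m (Suc l)..<m 0}"
        using nx(1)[of "m l"] m0[of l] mS[of l] by auto
      finally show ?case .
    qed simp
    have finite_le: "(\<Sum>k\<in>F. y k) \<le> (\<integral>\<^sup>+k. y k \<partial>count_space UNIV)" if "finite F" for F and y :: "int \<Rightarrow> ennreal"
    proof -
      have "(\<Sum>k\<in>F. y k) = (\<integral>\<^sup>+k. y k * indicator F k \<partial>count_space UNIV)"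
        using that by (subst nn_integral_count_space'[of F]) (auto simp: indicator_def)
      also have "\<dots> \<le> (\<integral>\<^sup>+k. y k \<partial>count_space UNIV)" by (intro nn_integral_mono) (auto simp: indicator_def)
      finally show ?thesis .
    qed
    have "ennreal (real n / 2) \<le> ennreal ((A * n) powr r)"
      by (rule order_trans[OF order_trans[OF blocks[OF order_refl] finite_le] up[unfolded eq]]) simp
    then show ?thesis by simp
  qed
  \<comment> \<open>Makes n^(1 - r) exceed 2 A^r, against \<open>main\<close>; the maximum with 1
    keeps n positive.\<close>
  obtain n :: nat where n: "max 1 ((2 * A powr r) powr (1 / (1 - r))) < n" using reals_Archimedean2 by blast
  have "(2 * A powr r) = ((2 * A powr r) powr (1 / (1 - r))) powr (1 - r)"
    using r A by (simp add: powr_powr)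
  also have "\<dots> < real n powr (1 - r)" using n r by (intro powr_less_mono2) auto
  also have "\<dots> = real n / real n powr r" using n by (simp add: powr_diff)
  finally have "2 * A powr r * real n powr r < n" using n by (simp add: field_simps)
  with main[of n] A show False by (simp add: powr_mult)
qed

section \<open>Partitions into equal pieces: growth of the weight and harmonic sums\<close>

lemma disjoint_sets_of_measure:
  fixes R :: "'a measure"
  assumes na: "non_atomic R" and inf: "emeasure R (space R) = \<infinity>" and d: "0 \<le> d"
  shows "\<exists>E :: nat \<Rightarrow> 'a set. (\<forall>i. E i \<in> sets R) \<and> (\<forall>i<L. emeasure R (E i) = ennreal d) \<and> disjoint_family E"
proof (induction L)
  case 0
  show ?case by (intro exI[of _ "\<lambda>_. {}"]) (auto simp: disjoint_family_on_def)
next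
  case (Suc L)
  then obtain E :: "nat \<Rightarrow> 'a set" where E: "\<And>i. E i \<in> sets R" "\<And>i. i < L \<Longrightarrow> emeasure R (E i) = ennreal d"
    and disj: "disjoint_family E" by blast
  let ?U = "\<Union>i<L. E i"
  have U: "?U \<in> sets R" using E by auto
  have "emeasure R ?U \<le> (\<Sum>i<L. emeasure R (E i))"
    using E by (intro emeasure_subadditive_finite) auto
  also have "\<dots> = (\<Sum>i<L. ennreal d)" using E by (intro sum.cong) auto
  also have "\<dots> < \<infinity>" by (simp add: ennreal_mult_less_top ennreal_of_nat_eq_real_of_nat)
  finally have Ufin: "emeasure R ?U < \<infinity>" .
  have "\<infinity> \<le> emeasure R (space R - ?U) + emeasure R ?U"
    using inf U emeasure_subadditive[of "space R - ?U" R ?U] sets.sets_into_space[OF U]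
    by (simp add: Un_absorb2)
  with Ufin have "emeasure R (space R - ?U) = \<infinity>" by (auto simp: top_unique ennreal_add_eq_top)
  then obtain D where D: "D \<in> sets R" "D \<subseteq> space R - ?U" "emeasure R D = ennreal d"
    using non_atomic_subset_emeasure[OF na, of "space R - ?U" d] d U by auto
  \<comment> \<open>Sets with index above \<open>L\<close> are replaced by the empty set, since
    disjointness is claimed for the whole family and \<open>D\<close> was chosen only off the first
    \<open>L\<close> sets.\<close>
  define E' where "E' i = (if i < L then E i else if i = L then D else {})" for i
  have "disjoint_family E'"
    using disj D unfolding disjoint_family_on_def E'_def by auto
  then show ?case using E D by (intro exI[of _ E'] conjI \<open>disjoint_family E'\<close>) (auto simp: E'_def)
qed

text \<open>A set of measure about 2^m is cut into about 2^(m - k) pieces of measure 2^k, each of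
  size at most a constant times the weight at k. This single bound excludes p < 1 and, at p = 1,
  makes b almost non-increasing.\<close>

lemma convex_weight_growth:
  assumes na: "non_atomic R" and inf: "emeasure R (space R) = \<infinity>"
    and sv: "slowly_varying b" and q: "1 \<le> q" and \<alpha>: "0 < \<alpha>" and A: "0 < A"
    and conv: "\<And>(G :: nat \<Rightarrow> 'a \<Rightarrow> ennreal) n. (\<And>i. G i \<in> borel_measurable R) \<Longrightarrow>
      dyadic_norm R q (dyadic_weight \<alpha> b) (\<lambda>x. \<Sum>i<n. G i x)
        \<le> ennreal A * (\<Sum>i<n. dyadic_norm R q (dyadic_weight \<alpha> b) (G i))"
  shows "\<exists>D>0. \<forall>k m. k \<le> m \<longrightarrow>
    dyadic_weight \<alpha> b m \<le> D * 2 powr (real_of_int (m - k)) * dyadic_weight \<alpha> b k"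
proof -
  let ?w = "dyadic_weight \<alpha> b"
  have q0: "0 < q" by (rule exponent_pos_of_ge_1[OF q])
  have w0: "0 < ?w k" for k by (rule dyadic_weight_pos[OF sv])
  obtain C where C: "0 < C" "\<And>m. lq q (\<lambda>k. ennreal (?w k) * indicator {..<m} k) \<le> ennreal (C * ?w m)"
    using lq_dyadic_weight_lessThan[OF sv q \<alpha>] by blast
  have "?w m \<le> (2 * A * C) * 2 powr (real_of_int (m - k)) * ?w k" if km: "k \<le> m" for k m
  proof -
    \<comment> \<open>One doubling beyond 2^(m - k): the union has measure 2 * 2^m, strictly above
      2^m, so that the rearrangement at 2^m is at least 1.\<close>
    define L :: nat where "L = 2 ^ nat (m + 1 - k)"
    have L: "real L = 2 * 2 powr (real_of_int (m - k))"
    proof -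
      have "real L = 2 powr real (nat (m + 1 - k))" unfolding L_def by (simp add: powr_realpow)
      also have "real (nat (m + 1 - k)) = 1 + real_of_int (m - k)" using km by simp
      finally show ?thesis by (simp add: powr_add)
    qed
    obtain E :: "nat \<Rightarrow> 'a set" where E: "\<And>i. E i \<in> sets R"
        "\<And>i. i < L \<Longrightarrow> emeasure R (E i) = ennreal (2 powr (real_of_int k))" "disjoint_family E"
      using disjoint_sets_of_measure[OF na inf, of "2 powr (real_of_int k)" L] by auto
    let ?f = "\<lambda>x. \<Sum>i<L. indicator (E i) x :: ennreal"
    let ?U = "\<Union>i<L. E i"
    have "emeasure R ?U = (\<Sum>i<L. emeasure R (E i))"
      using E by (intro sum_emeasure[symmetric]) (auto simp: disjoint_family_on_def)
    also have "\<dots> = (\<Sum>i<L. ennreal (2 powr (real_of_int k)))" using E by (intro sum.cong) auto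
    also have "\<dots> = ennreal (real L * 2 powr (real_of_int k))"
      by (simp add: ennreal_mult ennreal_of_nat_eq_real_of_nat)
    also have "real L * 2 powr (real_of_int k) = 2 * 2 powr (real_of_int m)"
      unfolding L by (simp flip: powr_add)
    finally have U: "emeasure R ?U = ennreal (2 * 2 powr (real_of_int m))" .
    have "1 \<le> rearr R ?f (2 powr m)"
    proof (rule rearr_ge_on[where E="?U"])
      show "1 \<le> ?f x" if x: "x \<in> ?U" for x
      proof -
        obtain i where i: "i < L" "x \<in> E i" using x by blast
        then have "indicator (E i) x \<le> ?f x" by (intro member_le_sum) auto
        then show ?thesis using i by simp
      qed
      show "ennreal (2 powr m) < emeasure R ?U" unfolding U by (intro ennreal_lessI) auto
      show "?f \<in> borel_measurable R" using E by measurable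
      show "?U \<in> sets R" using E by auto
    qed
    then have "ennreal (?w m) * 1 \<le> ennreal (?w m) * rearr R ?f (2 powr m)" by (rule mult_left_mono) simp
    also have "\<dots> \<le> dyadic_norm R q ?w ?f" unfolding dyadic_norm_def by (rule lq_ge[OF q0])
    also have "\<dots> \<le> ennreal A * (\<Sum>i<L. dyadic_norm R q ?w (indicator (E i)))"
      using E by (intro conv) auto
    also have "\<dots> \<le> ennreal A * (\<Sum>i<L. ennreal (C * ?w k))"
    proof (intro mult_left_mono sum_mono)
      fix i assume "i \<in> {..<L}"
      then have "dyadic_norm R q ?w (\<lambda>x. 1 * indicator (E i) x) \<le> 1 * lq q (\<lambda>j. ennreal (?w j) * indicator {..<k} j)"
        using E by (intro dyadic_norm_indicator_le[OF q0]) auto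
      then show "dyadic_norm R q ?w (indicator (E i)) \<le> ennreal (C * ?w k)"
        using C(2)[of k] by simp
    qed simp
    also have "\<dots> = ennreal (A * (real L * (C * ?w k)))"
      using A C(1) w0[of k] by (simp add: ennreal_mult ennreal_of_nat_eq_real_of_nat)
    finally have "ennreal (?w m) \<le> ennreal (A * (real L * (C * ?w k)))" by simp
    then have "?w m \<le> A * (real L * (C * ?w k))"
      using A C(1) w0[of k] by (subst (asm) ennreal_le_iff) auto
    then show ?thesis unfolding L by (simp add: mult_ac)
  qed
  then show ?thesis using A C(1) by (intro exI[of _ "2 * A * C"]) auto
qed

text \<open>Between -n and 0 the weight grows at least like 2^((\<alpha> - d) n), while
  \<open>growth\<close> allows 2^n; for \<alpha> > 1 and d half of the excess these are incompatible
  for large n.\<close>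

lemma weight_growth_imp_recip_le_1:
  assumes sv: "slowly_varying b" and D: "0 < D"
    and growth: "\<And>k m. k \<le> m \<Longrightarrow> dyadic_weight \<alpha> b m \<le> D * 2 powr (real_of_int (m - k)) * dyadic_weight \<alpha> b k"
  shows "\<alpha> \<le> 1"
proof (rule ccontr)
  assume "\<not> \<alpha> \<le> 1"
  define d where "d = (\<alpha> - 1) / 2"
  have d: "0 < d" using \<open>\<not> \<alpha> \<le> 1\<close> by (simp add: d_def)
  let ?w = "dyadic_weight \<alpha> b"
  obtain C where C: "0 < C" "\<And>k m :: int. ?w k \<le> C * 2 powr (\<alpha> * (k - m) + d * \<bar>k - m\<bar>) * ?w m"
    using dyadic_weight_bound[OF sv d] by blast
  have w0: "0 < ?w 0" by (rule dyadic_weight_pos[OF sv])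
  have "1 \<le> D * C * 2 powr (- (d * real n))" for n :: nat
  proof -
    have "?w 0 \<le> D * 2 powr (real n) * ?w (- int n)" using growth[of "- int n" 0] by simp
    also have "\<dots> \<le> D * 2 powr (real n) * (C * 2 powr (- \<alpha> * n + d * n) * ?w 0)"
      using C(2)[of "- int n" 0] D by (intro mult_left_mono) auto
    also have "\<dots> = D * C * 2 powr (real n + (- \<alpha> * n + d * n)) * ?w 0"
      by (simp only: powr_add mult_ac)
    also have "real n + (- \<alpha> * n + d * n) = - (d * real n)" by (simp add: d_def field_simps)
    finally show ?thesis using w0 by simp
  qed
  moreover have "(\<lambda>n. D * C * 2 powr (- (d * real n))) \<longlonglongrightarrow> 0" using d by real_asymp
  ultimately have "1 \<le> (0::real)" by (intro LIMSEQ_le_const) auto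
  then show False by simp
qed

text \<open>Averaging over cyclic shifts: a function that is roughly \<open>1 / (t b t)\<close> on \<open>[2^(m-n), 2^m]\<close>
  is of size \<open>n^(1/q)\<close>, while the average of its translates is constant on a set of measure \<open>2^m\<close>.\<close>
lemma convex_harmonic_sum:
  assumes na: "non_atomic R" and inf: "emeasure R (space R) = \<infinity>"
    and sv: "slowly_varying b" and q: "1 \<le> q" and A: "0 < A"
    and conv: "\<And>(G :: nat \<Rightarrow> 'a \<Rightarrow> ennreal) n. (\<And>i. G i \<in> borel_measurable R) \<Longrightarrow>
      dyadic_norm R q (dyadic_weight 1 b) (\<lambda>x. \<Sum>i<n. G i x)
        \<le> ennreal A * (\<Sum>i<n. dyadic_norm R q (dyadic_weight 1 b) (G i))"
  shows "\<exists>C>0. \<forall>m (n::nat). 0 < n \<longrightarrow>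
     b (2 powr (real_of_int m)) * (\<Sum>l\<le>n. 1 / b (2 powr (real_of_int m - real n + real l))) \<le> C * real n powr recip q"
proof -
  let ?w = "dyadic_weight 1 b"
  have q0: "0 < q" by (rule exponent_pos_of_ge_1[OF q])
  have bpos: "0 < b (2 powr x)" for x :: real using sv by (simp add: slowly_varying_def)
  have w0: "0 < ?w k" for k by (rule dyadic_weight_pos[OF sv])
  \<comment> \<open>With exponent 1/2 the sequence \<open>y\<close> below, 2^(-l) divided by values
    of b, still has decay of order 2^(-l/2).\<close>
  obtain C0 where C0: "0 < C0" "\<And>k m :: real. b (2 powr k) \<le> C0 * 2 powr (1 / 2 * \<bar>k - m\<bar>) * b (2 powr m)"
    using slowly_varying_dyadic[OF sv, of "1 / 2"] by auto
  obtain C2 where C2: "0 < C2" "\<And>m. lq q (\<lambda>k. ennreal (?w k) * indicator {..<m} k) \<le> ennreal (C2 * ?w m)"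
    using lq_dyadic_weight_lessThan[OF sv q, of 1] by auto
  define C1 where "C1 = C0 / (1 - 2 powr (- (1 / 2)))"
  have "2 powr (- (1 / 2)) < (1::real)" using powr_less_mono[of "- (1/2)" 0 "2::real"] by simp
  then have C1: "0 < C1" using C0 by (simp add: C1_def)
  define C3 where "C3 = C1 * (1 + C2)"
  have C3: "0 < C3" using C1 C2 by (simp add: C3_def)
  \<comment> \<open>The union \<open>U\<close> below has measure exactly 2^m, so the rearrangement
    is evaluated just before, at 2^(m - 1); C4 undoes this shift of the weight.\<close>
  obtain C4 where C4: "0 < C4" "\<And>m. ?w m \<le> C4 * ?w (m - 1)"
  proof -
    obtain C where C: "0 < C" "\<And>k m :: int. ?w k \<le> C * 2 powr (1 * real_of_int (k - m) + 1 * real_of_int \<bar>k - m\<bar>) * ?w m"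
      using dyadic_weight_bound[OF sv zero_less_one] by blast
    have "?w m \<le> C * 4 * ?w (m - 1)" for m using C(2)[of m "m - 1"] by simp
    then show ?thesis using that[of "C * 4"] C(1) by simp
  qed
  have "b (2 powr (real_of_int m)) * (\<Sum>l\<le>n. 1 / b (2 powr (real_of_int m - real n + real l)))
     \<le> C4 * A * C3 * real n powr recip q" if n: "0 < n" for m and n :: nat
  proof -
    define L :: nat where "L = 2 ^ n"
    have L: "real L = 2 powr real n" "0 < L" by (auto simp: L_def powr_realpow)
    define B where "B l = b (2 powr (real_of_int m - real n + real l))" for l :: nat
    have B0: "0 < B l" for l by (simp add: B_def bpos)
    \<comment> \<open>Up to the factor 2^(m - n), this is 1 / (t b(t)) at t = 2^(m - n + l).\<close>
    define y where "y l = 2 powr (- real l) / B l" for l :: nat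
    have y0: "0 < y l" for l using B0 by (simp add: y_def)
    have tail: "(\<Sum>l\<in>{l'..n}. y l) \<le> C1 * y l'" for l'
    proof -
      have "y l \<le> C0 * y l' * 2 powr (- (1 / 2 * real (l - l')))" if l: "l' \<le> l" for l
      proof -
        have "\<bar>(real_of_int m - real n + real l') - (real_of_int m - real n + real l)\<bar> = real l - real l'"
          using l by simp
        then have "B l' \<le> C0 * 2 powr (1 / 2 * (real l - real l')) * B l"
          using C0(2)[of "real_of_int m - real n + real l'" "real_of_int m - real n + real l"]
          by (simp only: B_def)
        then have "1 / B l \<le> C0 * 2 powr (1 / 2 * (real l - real l')) / B l'"
          using B0[of l] B0[of l'] by (simp add: field_simps)
        from mult_left_mono[OF this, of "2 powr (- real l)"]
        have "y l \<le> 2 powr (- real l) * (C0 * 2 powr (1 / 2 * (real l - real l')) / B l')"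
          by (simp add: y_def)
        also have "\<dots> = C0 * (2 powr (- real l) * 2 powr (1 / 2 * (real l - real l'))) / B l'" by simp
        also have "2 powr (- real l) * 2 powr (1 / 2 * (real l - real l')) = 2 powr (- real l') * 2 powr (- (1 / 2 * real (l - l')))"
          using l by (simp add: of_nat_diff field_simps flip: powr_add)
        finally show ?thesis by (simp add: y_def mult_ac)
      qed
      then have "(\<Sum>l\<in>{l'..n}. ennreal (y l)) \<le> (\<Sum>l\<in>{l'..n}. ennreal (C0 * y l' * 2 powr (- (1 / 2 * real (l - l')))))"
        by (intro sum_mono ennreal_leI) auto
      also have "\<dots> = (\<Sum>i\<in>(\<lambda>l. l - l') ` {l'..n}. ennreal (C0 * y l' * 2 powr (- (1 / 2 * real i))))"
        by (subst sum.reindex) (auto simp: inj_on_def)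
      also have "\<dots> \<le> (\<Sum>i. ennreal (C0 * y l' * 2 powr (- (1 / 2 * real i))))"
        by (intro sum_le_suminf) auto
      also have "\<dots> = ennreal (C0 * y l' / (1 - 2 powr (- (1 / 2))))"
        using C0 y0[of l'] by (intro suminf_geometric_ennreal) auto
      also have "C0 * y l' / (1 - 2 powr (- (1 / 2))) = C1 * y l'" by (simp add: C1_def)
      finally have "ennreal (\<Sum>l\<in>{l'..n}. y l) \<le> ennreal (C1 * y l')"
        using y0 by (subst sum_ennreal[symmetric]) (auto simp: less_imp_le)
      then show ?thesis using C1 y0[of l'] by simp
    qed
    define \<delta> where "\<delta> = 2 powr (real_of_int m - real n)"
    obtain E :: "nat \<Rightarrow> 'a set" where E: "\<And>i. E i \<in> sets R"
        "\<And>i. i < L \<Longrightarrow> emeasure R (E i) = ennreal \<delta>" "disjoint_family E"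
      using disjoint_sets_of_measure[OF na inf, of \<delta> L] by (auto simp: \<delta>_def)
    have inj: "inj_on (\<lambda>i. (i + s) mod L) {..<L}" for s
    proof (rule linorder_inj_onI)
      fix i j assume ij: "i < j" "i \<in> {..<L}" "j \<in> {..<L}"
      show "(i + s) mod L \<noteq> (j + s) mod L"
      proof
        assume "(i + s) mod L = (j + s) mod L"
        then have "L dvd (j + s) - (i + s)"
          using ij by (intro mod_eq_dvd_iff_nat[THEN iffD1]) auto
        then show False using ij by (auto dest: dvd_imp_le)
      qed
    qed auto
    \<comment> \<open>An arc of 2^l consecutive pieces on the cycle of length \<open>L\<close>,
      starting at s; the arcs grow with l, and the one with l = n is the whole union.\<close>
    define F where "F l s = (\<Union>i<2 ^ l. E ((i + s) mod L))" for l s :: nat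
    have F[measurable]: "F l s \<in> sets R" for l s unfolding F_def using E(1) by auto
    have lL: "(2::nat) ^ l \<le> L" if "l \<le> n" for l unfolding L_def using that by (intro power_increasing) auto
    have disjF: "disjoint_family_on (\<lambda>i. E ((i + s) mod L)) {..<2 ^ l}" if "l \<le> n" for l s
      unfolding disjoint_family_on_def
    proof (intro ballI impI)
      fix i j :: nat assume ij: "i \<in> {..<2 ^ l}" "j \<in> {..<2 ^ l}" "i \<noteq> j"
      then have "(i + s) mod L \<noteq> (j + s) mod L"
        using inj[of s] lL[OF that] unfolding inj_on_def by (metis lessThan_iff order_less_le_trans)
      then show "E ((i + s) mod L) \<inter> E ((j + s) mod L) = {}"
        using E(3) unfolding disjoint_family_on_def by blast
    qed
    have Fm: "emeasure R (F l s) = ennreal (2 powr (real_of_int m - real n + real l))" if "l \<le> n" for l s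
    proof -
      have "emeasure R (F l s) = (\<Sum>i<2 ^ l. emeasure R (E ((i + s) mod L)))"
        unfolding F_def using disjF[OF that] E(1) by (intro sum_emeasure[symmetric]) auto
      also have "\<dots> = (\<Sum>i<(2::nat) ^ l. ennreal \<delta>)" using L by (intro sum.cong refl E(2)) simp
      also have "\<dots> = ennreal (real (2 ^ l) * \<delta>)"
        by (simp add: \<delta>_def ennreal_mult ennreal_of_nat_eq_real_of_nat del: of_nat_power)
      also have "real (2 ^ l) * \<delta> = 2 powr (real_of_int m - real n + real l)"
        unfolding \<delta>_def by (simp add: powr_add powr_realpow mult.commute)
      finally show ?thesis .
    qed
    have Fmono: "F l s \<subseteq> F l' s" if "l \<le> l'" for l l' s
    proof -
      have "(2::nat) ^ l \<le> 2 ^ l'" using that by (intro power_increasing) auto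
      then show ?thesis unfolding F_def by (intro UN_mono) auto
    qed
    \<comment> \<open>Summing over nested arcs lets the average over shifts be computed arc by arc,
      while \<open>tail\<close> keeps \<open>f s\<close> below \<open>C1 * y l\<close> off
      \<open>F l s\<close>.\<close>
    define f where "f s x = (\<Sum>l\<le>n. ennreal (y l) * indicator (F l s) x)" for s :: nat and x
    have fm[measurable]: "f s \<in> borel_measurable R" for s unfolding f_def by measurable
    define U where "U = (\<Union>i<L. E i)"
    have US: "U \<in> sets R" unfolding U_def using E(1) by auto
    have Um: "emeasure R U = ennreal (2 powr (real_of_int m))"
      using Fm[of n 0] by (simp add: F_def U_def L_def)
    define S where "S = (\<Sum>l\<le>n. 1 / B l)"
    have S0: "0 \<le> S" unfolding S_def using B0 by (intro sum_nonneg) (auto simp: less_imp_le)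
    \<comment> \<open>Each point of \<open>U\<close> lies in the arc of 2^l pieces for exactly 2^l
      of the \<open>L\<close> shifts, so level l contributes 2^l y l = 1 / B l at every
      point.\<close>
    have total: "(\<Sum>s<L. f s x) = ennreal S" if x: "x \<in> U" for x
    proof -
      have cyc: "(\<Sum>s<L. indicator (E ((i + s) mod L)) x) = (1::ennreal)" for i
      proof -
        have "(\<lambda>s. (i + s) mod L) ` {..<L} \<subseteq> {..<L}" using L by auto
        moreover have "inj_on (\<lambda>s. (i + s) mod L) {..<L}" using inj[of i] by (simp add: add.commute)
        ultimately have "bij_betw (\<lambda>s. (i + s) mod L) {..<L} {..<L}"
          by (simp add: bij_betw_def endo_inj_surj)
        then have "(\<Sum>s<L. indicator (E ((i + s) mod L)) x) = (\<Sum>j<L. indicator (E j) x :: ennreal)"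
          by (rule sum.reindex_bij_betw)
        also have "\<dots> = indicator U x"
          unfolding U_def using E(3) by (intro indicator_UN_disjoint[symmetric]) (auto simp: disjoint_family_on_def)
        finally show ?thesis using x by simp
      qed
      have "(\<Sum>s<L. f s x) = (\<Sum>l\<le>n. \<Sum>s<L. ennreal (y l) * indicator (F l s) x)"
        unfolding f_def by (rule sum.swap)
      also have "\<dots> = (\<Sum>l\<le>n. ennreal (1 / B l))"
      proof (intro sum.cong refl)
        fix l assume "l \<in> {..n}"
        then have l: "l \<le> n" by simp
        have "(\<Sum>s<L. indicator (F l s) x) = (\<Sum>s<L. \<Sum>i<2 ^ l. indicator (E ((i + s) mod L)) x :: ennreal)"
          unfolding F_def by (intro sum.cong refl indicator_UN_disjoint disjF l) auto
        also have "\<dots> = (\<Sum>i<(2::nat) ^ l. \<Sum>s<L. indicator (E ((i + s) mod L)) x)" by (rule sum.swap)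
        also have "\<dots> = ennreal (2 powr (real l))" unfolding cyc by (simp add: powr_realpow ennreal_of_nat_eq_real_of_nat)
        finally have "(\<Sum>s<L. ennreal (y l) * indicator (F l s) x) = ennreal (y l) * ennreal (2 powr (real l))"
          by (simp only: sum_distrib_left[symmetric])
        also have "\<dots> = ennreal (y l * 2 powr (real l))" using y0[of l] by (intro ennreal_mult[symmetric]) auto
        also have "y l * 2 powr (real l) = 1 / B l" by (simp add: y_def powr_minus)
        finally show "(\<Sum>s<L. ennreal (y l) * indicator (F l s) x) = ennreal (1 / B l)" .
      qed
      also have "\<dots> = ennreal S" unfolding S_def using B0 by (intro sum_ennreal) (auto simp: less_imp_le)
      finally show ?thesis .
    qed
    have low: "ennreal (?w (m - 1) * S) \<le> dyadic_norm R q ?w (\<lambda>x. \<Sum>s<L. f s x)"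
    proof -
      have "ennreal S \<le> rearr R (\<lambda>x. \<Sum>s<L. f s x) (2 powr (real_of_int (m - 1)))"
        using total US by (intro rearr_ge_on[where E=U]) (auto simp: Um ennreal_less_iff)
      then have "ennreal (?w (m - 1)) * ennreal S
         \<le> ennreal (?w (m - 1)) * rearr R (\<lambda>x. \<Sum>s<L. f s x) (2 powr (real_of_int (m - 1)))"
        by (rule mult_left_mono) simp
      also have "\<dots> \<le> dyadic_norm R q ?w (\<lambda>x. \<Sum>s<L. f s x)" unfolding dyadic_norm_def by (rule lq_ge[OF q0])
      finally show ?thesis using w0[of "m - 1"] S0 by (simp add: ennreal_mult less_imp_le)
    qed
    have up: "dyadic_norm R q ?w (f s) \<le> ennreal (C3 * \<delta> * real n powr recip q)" for s
    proof -
      \<comment> \<open>\<open>nat\<close> sends indices below m - n to 0, where the bound becomes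
        the uniform bound \<open>C1 * y 0\<close> of \<open>f s\<close>.\<close>
      have rearr_f: "rearr R (f s) (2 powr k) \<le> ennreal (C1 * y (nat (k - (m - int n)))) * indicator {..<m} k" for k
      proof (cases "k < m")
        case False
        have "{x \<in> space R. f s x > 0} \<subseteq> F n s"
        proof
          fix x assume "x \<in> {x \<in> space R. f s x > 0}"
          then have "f s x \<noteq> 0" by auto
          then obtain l where "l \<le> n" "x \<in> F l s" unfolding f_def by (auto simp: indicator_def split: if_splits)
          then show "x \<in> F n s" using Fmono by blast
        qed
        then have "emeasure R {x \<in> space R. f s x > 0} \<le> emeasure R (F n s)" by (intro emeasure_mono) auto
        also have "\<dots> \<le> ennreal (2 powr k)" using Fm[of n s] False by (auto intro!: ennreal_leI powr_mono)
        finally have "rearr R (f s) (2 powr k) \<le> 0" by (rule rearr_le)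
        then show ?thesis by simp
      next
        case True
        define l' where "l' = nat (k - (m - int n))"
        have l': "l' \<le> n" using True by (simp add: l'_def)
        have "emeasure R {x \<in> space R. f s x > ennreal (C1 * y l')} \<le> ennreal (2 powr k)"
        proof (cases "m - int n \<le> k")
          case ge: True
          have "{x \<in> space R. f s x > ennreal (C1 * y l')} \<subseteq> F l' s"
          proof (intro subsetI, rule ccontr)
            fix x assume x: "x \<in> {x \<in> space R. f s x > ennreal (C1 * y l')}" "x \<notin> F l' s"
            have "f s x \<le> (\<Sum>l\<in>{l'..n}. ennreal (y l))"
            proof -
              have "f s x = (\<Sum>l\<in>{l'..n}. ennreal (y l) * indicator (F l s) x)"
                unfolding f_def
              proof (rule sum.mono_neutral_right)
                show "\<forall>l\<in>{..n} - {l'..n}. ennreal (y l) * indicator (F l s) x = 0"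
                proof
                  fix l assume "l \<in> {..n} - {l'..n}"
                  then have "l \<le> l'" by auto
                  then have "x \<notin> F l s" using Fmono[of l l' s] x(2) by blast
                  then show "ennreal (y l) * indicator (F l s) x = 0" by simp
                qed
              qed auto
              also have "\<dots> \<le> (\<Sum>l\<in>{l'..n}. ennreal (y l))" by (intro sum_mono) (auto simp: indicator_def)
              finally show ?thesis .
            qed
            also have "\<dots> = ennreal (\<Sum>l\<in>{l'..n}. y l)" using y0 by (intro sum_ennreal) (auto simp: less_imp_le)
            also have "\<dots> \<le> ennreal (C1 * y l')" by (intro ennreal_leI tail)
            finally show False using x(1) by auto
          qed
          then have "emeasure R {x \<in> space R. f s x > ennreal (C1 * y l')} \<le> emeasure R (F l' s)"
            by (intro emeasure_mono) auto
          also have "\<dots> = ennreal (2 powr k)"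
          proof -
            have "real_of_int m - real n + real l' = k" using ge by (simp add: l'_def)
            then show ?thesis using Fm[OF l'] by simp
          qed
          finally show ?thesis .
        next
          case False
          then have l0: "l' = 0" by (simp add: l'_def)
          have "f s x \<le> ennreal (C1 * y l')" for x
          proof -
            have "f s x \<le> (\<Sum>l\<le>n. ennreal (y l))" unfolding f_def by (intro sum_mono) (auto simp: indicator_def)
            also have "\<dots> = ennreal (\<Sum>l\<le>n. y l)" using y0 by (intro sum_ennreal) (auto simp: less_imp_le)
            also have "\<dots> \<le> ennreal (C1 * y l')"
              using tail[of 0] by (intro ennreal_leI) (simp add: l0 atLeast0AtMost)
            finally show ?thesis .
          qed
          then have "{x \<in> space R. f s x > ennreal (C1 * y l')} = {}" by (auto simp: not_less)
          then show ?thesis by (simp only: emeasure_empty zero_le)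
        qed
        then have "rearr R (f s) (2 powr k) \<le> ennreal (C1 * y l')" by (rule rearr_le)
        then show ?thesis using True by (simp add: l'_def)
      qed
      \<comment> \<open>On these n indices weight times bound is constantly
        \<open>C1 * \<delta>\<close>, whence the factor n^(1/q). The indices below add a multiple of
        \<delta>, absorbed because n^(1/q) is at least 1.\<close>
      let ?I = "{m - int n..<m}"
      have "dyadic_norm R q ?w (f s) \<le> lq q (\<lambda>k. ennreal (C1 * \<delta>) * indicator ?I k +
          ennreal (C1 * y 0) * (ennreal (?w k) * indicator {..<m - int n} k))"
        unfolding dyadic_norm_def
      proof (rule lq_mono[OF q0])
        fix k
        have "ennreal (?w k) * rearr R (f s) (2 powr k)
            \<le> ennreal (?w k) * (ennreal (C1 * y (nat (k - (m - int n)))) * indicator {..<m} k)"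
          by (intro mult_left_mono rearr_f) simp
        also have "\<dots> \<le> ennreal (C1 * \<delta>) * indicator ?I k +
          ennreal (C1 * y 0) * (ennreal (?w k) * indicator {..<m - int n} k)"
        proof (cases "k < m - int n")
          case True
          then show ?thesis by (simp add: mult_ac)
        next
          case False
          show ?thesis
          proof (cases "k < m")
            case True
            define l where "l = nat (k - (m - int n))"
            have k: "real_of_int k = real_of_int m - real n + real l" using False by (simp add: l_def)
            have "?w k * (C1 * y l) = C1 * \<delta>"
            proof -
              have "?w k = 2 powr (real_of_int m - real n) * 2 powr (real l) * B l"
                unfolding dyadic_weight_def B_def k by (simp add: powr_add)
              then show ?thesis using B0[of l] by (simp add: y_def \<delta>_def powr_minus field_simps)
            qed
            then have "ennreal (?w k) * ennreal (C1 * y l) = ennreal (C1 * \<delta>)"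
              using w0[of k] C1 y0[of l] by (subst ennreal_mult[symmetric]) (auto simp: less_imp_le)
            then show ?thesis using True False by (simp add: l_def)
          qed simp
        qed
        finally show "ennreal (?w k) * rearr R (f s) (2 powr k) \<le> ennreal (C1 * \<delta>) * indicator ?I k +
          ennreal (C1 * y 0) * (ennreal (?w k) * indicator {..<m - int n} k)" .
      qed
      also have "\<dots> \<le> lq q (\<lambda>k. ennreal (C1 * \<delta>) * indicator ?I k) +
          lq q (\<lambda>k. ennreal (C1 * y 0) * (ennreal (?w k) * indicator {..<m - int n} k))"
        by (rule lq_triangle[OF q])
      also have "\<dots> \<le> ennreal (C1 * \<delta>) * ennreal (real n powr recip q) + ennreal (C1 * y 0) * ennreal (C2 * ?w (m - int n))"
        unfolding lq_cmult[OF q0] using n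
        by (intro add_mono mult_left_mono C2) (auto simp: lq_indicator_finite[OF q0])
      also have "\<dots> = ennreal (C1 * \<delta> * real n powr recip q + C1 * y 0 * (C2 * ?w (m - int n)))"
        using C1 C2(1) y0[of 0] w0[of "m - int n"]
        by (simp add: \<delta>_def less_imp_le ennreal_mult)
      also have "\<dots> \<le> ennreal (C3 * \<delta> * real n powr recip q)"
      proof (rule ennreal_leI)
        have "y 0 * ?w (m - int n) = \<delta>"
          using B0[of 0] by (simp add: y_def B_def dyadic_weight_def \<delta>_def)
        then have "C1 * y 0 * (C2 * ?w (m - int n)) = C1 * C2 * \<delta>" by (simp add: mult_ac)
        also have "\<dots> \<le> C1 * C2 * \<delta> * real n powr recip q"
          using C1 C2 n ge_one_powr_ge_zero[of "real n" "recip q"] by (simp add: \<delta>_def recip_def)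
        finally show "C1 * \<delta> * real n powr recip q + C1 * y 0 * (C2 * ?w (m - int n)) \<le> C3 * \<delta> * real n powr recip q"
          by (simp add: C3_def algebra_simps)
      qed
      finally show ?thesis .
    qed
    have "ennreal (?w (m - 1) * S) \<le> ennreal A * (\<Sum>s<L. dyadic_norm R q ?w (f s))"
      by (rule order_trans[OF low conv]) (rule fm)
    also have "\<dots> \<le> ennreal A * (\<Sum>s<L. ennreal (C3 * \<delta> * real n powr recip q))"
      by (intro mult_left_mono sum_mono up) auto
    also have "\<dots> = ennreal (A * (real L * (C3 * \<delta> * real n powr recip q)))"
      using A C3 by (simp add: \<delta>_def ennreal_mult ennreal_of_nat_eq_real_of_nat)
    finally have "?w (m - 1) * S \<le> A * (real L * (C3 * \<delta> * real n powr recip q))"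
      using A C3 by (subst (asm) ennreal_le_iff) (auto simp: \<delta>_def)
    also have "\<dots> = A * C3 * 2 powr (real_of_int m) * real n powr recip q"
      unfolding L \<delta>_def by (simp add: powr_diff)
    finally have 1: "?w (m - 1) * S \<le> A * C3 * 2 powr (real_of_int m) * real n powr recip q" .
    have "2 powr (real_of_int m) * (b (2 powr (real_of_int m)) * S) = ?w m * S"
      by (simp add: dyadic_weight_def)
    also have "\<dots> \<le> C4 * ?w (m - 1) * S" by (intro mult_right_mono C4 S0)
    also have "\<dots> \<le> C4 * (A * C3 * 2 powr (real_of_int m) * real n powr recip q)"
      using mult_left_mono[OF 1, of C4] C4(1) by (simp add: mult.assoc)
    also have "\<dots> = 2 powr (real_of_int m) * (C4 * A * C3 * real n powr recip q)" by (simp only: mult_ac)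
    finally have "b (2 powr (real_of_int m)) * S \<le> C4 * A * C3 * real n powr recip q"
      by simp
    then show ?thesis by (simp add: S_def B_def)
  qed
  then show ?thesis using A C3 C4(1) by (intro exI[of _ "C4 * A * C3"]) auto
qed

text \<open>For n large the right side is below n / 2, so every window of n dyadic steps to the left
  of 2^m contains a point where b has at least doubled. Iteration makes b grow like a negative power
  of t near 0, against slow variation.\<close>

lemma no_harmonic_sum_bound:
  assumes sv: "slowly_varying b" and C: "0 < C" and r: "r < 1"
    and le: "\<And>m (n::nat). 0 < n \<Longrightarrow>
     b (2 powr (real_of_int m)) * (\<Sum>l\<le>n. 1 / b (2 powr (real_of_int m - real n + real l))) \<le> C * real n powr r"
  shows False
proof -
  have bpos: "0 < b (2 powr x)" for x :: real using sv by (simp add: slowly_varying_def)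
  have "filterlim (\<lambda>n. real n powr (1 - r)) at_top at_top" using r by real_asymp
  then have "eventually (\<lambda>n. 2 * C < real n powr (1 - r)) at_top" by (simp add: filterlim_at_top_dense)
  then have "eventually (\<lambda>n. 0 < n \<and> 2 * C < real n powr (1 - r)) at_top"
    using eventually_gt_at_top[of "0::nat"] by eventually_elim simp
  then obtain n :: nat where n: "0 < n" "2 * C < real n powr (1 - r)"
    by (metis (no_types, lifting) eventually_at_top_linorder order_refl)
  have "C * real n powr r < n / 2" using n by (simp add: powr_diff field_simps)
  \<comment> \<open>If b stayed below twice its value at 2^m on the window, each of the n + 1 terms
    would exceed 1/2.\<close>
  have step: "\<exists>m'. m - int n \<le> m' \<and> m' \<le> m \<and> 2 * b (2 powr (real_of_int m)) \<le> b (2 powr (real_of_int m'))" for m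
  proof (rule ccontr)
    assume neg: "\<not> ?thesis"
    have half: "1 / 2 \<le> b (2 powr (real_of_int m)) * (1 / b (2 powr (real_of_int m - real n + real l)))" if "l \<le> n" for l
    proof -
      have "m - int n \<le> m - int n + int l \<and> m - int n + int l \<le> m" using that by simp
      then have "\<not> 2 * b (2 powr (real_of_int m)) \<le> b (2 powr (real_of_int (m - int n + int l)))"
        using neg by blast
      then show ?thesis using bpos by (simp add: field_simps)
    qed
    have "real n / 2 \<le> (\<Sum>l\<le>n. 1 / 2)" by (simp add: field_simps)
    also have "\<dots> \<le> (\<Sum>l\<le>n. b (2 powr (real_of_int m)) * (1 / b (2 powr (real_of_int m - real n + real l))))"
      by (intro sum_mono half) auto
    also have "\<dots> \<le> C * real n powr r" using le[OF n(1), of m] by (simp add: sum_distrib_left)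
    finally show False using \<open>C * real n powr r < n / 2\<close> by simp
  qed
  then obtain nx where nx: "\<And>m. m - int n \<le> nx m" "\<And>m. nx m \<le> m"
     "\<And>m. 2 * b (2 powr (real_of_int m)) \<le> b (2 powr (real_of_int (nx m)))" by metis
  \<comment> \<open>Reaching i doublings takes at most n i dyadic steps, over which this exponent
    permits growth of order 2^(i/2) only.\<close>
  define e where "e = 1 / (2 * real n)"
  have e: "0 < e" using n by (simp add: e_def)
  obtain D where D: "0 < D" "\<And>k m :: real. b (2 powr k) \<le> D * 2 powr (e * \<bar>k - m\<bar>) * b (2 powr m)"
    using slowly_varying_dyadic[OF sv e] by blast
  have it: "- (int n * int i) \<le> (nx ^^ i) 0 \<and> (nx ^^ i) 0 \<le> 0 \<and>
      2 ^ i * b (2 powr 0) \<le> b (2 powr (real_of_int ((nx ^^ i) 0)))" for i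
  proof (induction i)
    case (Suc i)
    let ?m = "(nx ^^ i) 0"
    have "2 ^ Suc i * b (2 powr 0) \<le> 2 * b (2 powr (real_of_int ?m))" using Suc by simp
    also have "\<dots> \<le> b (2 powr (real_of_int (nx ?m)))" by (rule nx)
    finally show ?case using Suc nx(1)[of ?m] nx(2)[of ?m] by (simp add: algebra_simps)
  qed simp
  have "1 \<le> D * 2 powr (- (1 / 2 * real i))" for i :: nat
  proof -
    let ?m = "(nx ^^ i) 0"
    have "2 ^ i * b (2 powr 0) \<le> D * 2 powr (e * \<bar>real_of_int ?m - 0\<bar>) * b (2 powr 0)"
      using it[of i] D(2)[of "real_of_int ?m" 0] by linarith
    also have "\<dots> \<le> D * 2 powr (1 / 2 * real i) * b (2 powr 0)"
    proof -
      have "\<bar>real_of_int ?m\<bar> \<le> real n * real i"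
      proof -
        have "\<bar>?m\<bar> \<le> int n * int i" using it[of i] by linarith
        then have "real_of_int \<bar>?m\<bar> \<le> real_of_int (int n * int i)" by (simp only: of_int_le_iff)
        then show ?thesis by simp
      qed
      then have "e * \<bar>real_of_int ?m\<bar> \<le> e * (real n * real i)" using e by (intro mult_left_mono) auto
      also have "\<dots> = 1 / 2 * real i" using n by (simp add: e_def)
      finally show ?thesis using D(1) bpos[of 0] by (intro mult_right_mono mult_left_mono powr_mono) auto
    qed
    finally have "2 powr (real i) \<le> D * 2 powr (1 / 2 * real i)"
      using bpos[of 0] by (simp add: powr_realpow)
    then have "2 powr (real i) * 2 powr (- real i) \<le> D * 2 powr (1 / 2 * real i) * 2 powr (- real i)"
      by (intro mult_right_mono) auto
    also have "\<dots> = D * 2 powr (1 / 2 * real i + (- real i))" by (simp only: powr_add mult.assoc)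
    also have "1 / 2 * real i + (- real i) = - (1 / 2 * real i)" by simp
    finally show ?thesis by (simp flip: powr_add)
  qed
  moreover have "(\<lambda>i. D * 2 powr (- (1 / 2 * real i))) \<longlonglongrightarrow> 0" by real_asymp
  ultimately have "1 \<le> (0::real)" by (intro LIMSEQ_le_const) auto
  then show False by simp
qed

section \<open>The conditions of the theorem in dyadic form\<close>

lemma Lq_norm_unit_interval_finite_iff:
  assumes sv: "slowly_varying b" and q: "0 < q"
  shows "Lq_norm q (\<lambda>t. ennreal (t powr (- recip q) * b t) * indicator {0<..<1} t) < \<infinity> \<longleftrightarrow>
    lq q (\<lambda>k. ennreal (dyadic_weight 0 b k) * indicator {..<0} k) < \<infinity>"
    (is "?L < \<infinity> \<longleftrightarrow> ?D < \<infinity>")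
proof -
  obtain c C where c: "0 < c" "0 < C" and *: "\<And>u. antimono_on {0<..} u \<Longrightarrow>
    ennreal c * lq q (\<lambda>k. ennreal (2 powr (0 * real_of_int k) * b (2 powr k)) * u (2 powr k))
      \<le> Lq_norm q (\<lambda>t. ennreal (t powr (0 - recip q) * b t) * u t) \<and>
    Lq_norm q (\<lambda>t. ennreal (t powr (0 - recip q) * b t) * u t)
      \<le> ennreal C * lq q (\<lambda>k. ennreal (2 powr (0 * real_of_int k) * b (2 powr k)) * u (2 powr k))"
    using Lq_norm_dyadic[OF sv q, of 0] by blast
  \<comment> \<open>On the open half-line the characteristic function of (0, 1) is non-increasing,
    so the discretization applies to it with exponent 0; 2^k < 1 means k < 0.\<close>
  have u: "antimono_on {0<..} (indicator {0<..<1} :: real \<Rightarrow> ennreal)"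
    by (rule monotone_onI) (auto simp: indicator_def)
  have "indicator {0<..<1} (2 powr (real_of_int k)) = (indicator {..<0} k :: ennreal)" for k
    using powr_less_cancel_iff[of 2 "real_of_int k" 0] by (auto simp: indicator_def)
  then have 1: "ennreal c * ?D \<le> ?L" and 2: "?L \<le> ennreal C * ?D"
    using *[OF u] by (simp_all add: dyadic_weight_def)
  show ?thesis
  proof
    assume "?L < \<infinity>"
    with 1 have "ennreal c * ?D < \<infinity>" by (rule order_le_less_trans)
    then show "?D < \<infinity>" using c by (auto simp: ennreal_mult_less_top)
  next
    assume "?D < \<infinity>"
    then have "ennreal C * ?D < \<infinity>" by (simp add: ennreal_mult_less_top)
    with 2 show "?L < \<infinity>" by (rule order_le_less_trans)
  qed
qed

text \<open>The least non-increasing majorant, the supremum of b over [t, \<infinity>), works: both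
  points are moved to the dyadic points below them, which costs \<open>C\<close> twice, and
  \<open>growth\<close> compares those.\<close>

lemma equivalent_antimono_of_dyadic:
  assumes sv: "slowly_varying b" and D: "0 < D"
    and growth: "\<And>k m. k \<le> m \<Longrightarrow> b (2 powr (real_of_int m)) \<le> D * b (2 powr (real_of_int k))"
  shows "\<exists>g. antimono_on {0<..} g \<and> equivalent_on {0<..} (\<lambda>t. ennreal (b t)) g"
proof -
  have pos: "0 < b t" if "0 < t" for t using sv that by (simp add: slowly_varying_def)
  obtain C where C: "1 \<le> C" "\<And>s t. 0 < s \<Longrightarrow> 0 < t \<Longrightarrow> s \<le> 2 * t \<Longrightarrow> t \<le> 2 * s \<Longrightarrow>
      s powr 0 * b s \<le> C * (t powr 0 * b t)"
    using slowly_varying_doubling[OF sv, of 0] by blast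
  define g where "g t = (SUP s\<in>{t..}. ennreal (b s))" for t
  define C' where "C' = max 1 (C * D * C)"
  have "antimono_on {0<..} g"
    unfolding g_def by (intro monotone_onI SUP_subset_mono) auto
  moreover have "ennreal 1 * ennreal (b t) \<le> g t" for t
    unfolding g_def by (auto intro: SUP_upper2[of t])
  moreover have "g t \<le> ennreal C' * ennreal (b t)" if t: "0 < t" for t
    unfolding g_def
  proof (rule SUP_least)
    fix s assume s: "s \<in> {t..}"
    then have s0: "0 < s" using t by simp
    have fl: "\<lfloor>log 2 t\<rfloor> \<le> \<lfloor>log 2 s\<rfloor>" using s t s0 by (intro floor_mono) simp
    have "b s \<le> C * b (2 powr \<lfloor>log 2 s\<rfloor>)"
      using C(2)[of s "2 powr \<lfloor>log 2 s\<rfloor>"] log_floor_dyadic[OF s0] s0 by (simp add: powr_add)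
    also have "\<dots> \<le> C * (D * b (2 powr \<lfloor>log 2 t\<rfloor>))"
      using C(1) by (intro mult_left_mono growth[OF fl]) auto
    also have "\<dots> \<le> C * (D * (C * b t))"
      using C(1) D C(2)[of "2 powr \<lfloor>log 2 t\<rfloor>" t] log_floor_dyadic[OF t] t
      by (intro mult_left_mono) (auto simp: powr_add)
    also have "\<dots> = C * D * C * b t" by simp
    also have "\<dots> \<le> C' * b t" using pos[OF t] unfolding C'_def by (intro mult_right_mono) auto
    finally have "ennreal (b s) \<le> ennreal (C' * b t)" by (rule ennreal_leI)
    also have "\<dots> = ennreal C' * ennreal (b t)" using pos[OF t] by (intro ennreal_mult) (auto simp: C'_def)
    finally show "ennreal (b s) \<le> ennreal C' * ennreal (b t)" .
  qed
  ultimately show ?thesis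
    unfolding equivalent_on_def by (intro exI[of _ g] conjI exI[of _ 1] exI[of _ C']) (auto simp: C'_def)
qed

lemma recip_less_1: "1 < p \<Longrightarrow> recip p < 1"
proof (cases "p = \<infinity>")
  case False
  moreover assume "1 < p"
  ultimately have "1 < enn2real p" "0 < p" by (cases p; auto simp: ennreal_less_iff)+
  then show ?thesis using False by (simp add: recip_eq)
qed (simp add: recip_def)

lemma recip_pos: "0 < p \<Longrightarrow> p \<noteq> \<infinity> \<Longrightarrow> 0 < recip p"
  using exponent_pos[of p] by (simp add: recip_eq)

lemma recip_le_1D: "0 < p \<Longrightarrow> p \<noteq> \<infinity> \<Longrightarrow> recip p \<le> 1 \<Longrightarrow> 1 \<le> p"
  using exponent_pos[of p] by (cases p) (auto simp: recip_eq)

lemma recip_1 [simp]: "recip 1 = 1"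
  by (simp add: recip_def)

theorem theorem3p33:
  fixes R :: "'a measure" and p q :: ennreal and b :: "real \<Rightarrow> real"
  assumes "sigma_finite_measure R" and "non_atomic R" and "emeasure R (space R) = \<infinity>"
    and "0 < p" and "0 < q" and "slowly_varying b"
  shows "(\<exists>N. banach_function_norm R N \<and>
              LK_space R p q b = {f \<in> Mfun R. N f < \<infinity>} \<and>
              equivalent_on (Mfun R) N (LK_norm R p q b))
         \<longleftrightarrow>
         1 \<le> q \<and>
         ((1 < p \<and> p < \<infinity>) \<or>
          (p = \<infinity> \<and>
             Lq_norm q (\<lambda>t. ennreal (t powr (- recip q) * b t) * indicator {0<..<1} t) < \<infinity>) \<or>
          (p = 1 \<and> q = 1 \<and>
             (\<exists>g. antimono_on {0<..} g \<and> equivalent_on {0<..} (\<lambda>t. ennreal (b t)) g)))"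
    (is "?normable \<longleftrightarrow> 1 \<le> q \<and> (?i \<or> ?ii \<or> ?iii)")
proof
  note sf = assms(1) and na = assms(2) and inf = assms(3) and p0 = assms(4) and q0 = assms(5) and sv = assms(6)
  let ?w = "dyadic_weight (recip p) b"
  {
    assume ?normable
    then obtain N where N: "banach_function_norm R N" "equivalent_on (Mfun R) N (LK_norm R p q b)" by blast
    obtain A where A: "0 < A" and conv: "\<And>(G :: nat \<Rightarrow> 'a \<Rightarrow> ennreal) n. (\<And>i. G i \<in> borel_measurable R) \<Longrightarrow>
        dyadic_norm R q ?w (\<lambda>x. \<Sum>i<n. G i x) \<le> ennreal A * (\<Sum>i<n. dyadic_norm R q ?w (G i))"
      using necessary_dyadic(1)[OF sv q0 N] by blast
    have fin: "dyadic_norm R q ?w (indicator E) < \<infinity>" if "E \<in> sets R" "emeasure R E < \<infinity>" for E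
      by (rule necessary_dyadic(2)[OF sv q0 N that])
    have q: "1 \<le> q"
      using not_convex_q_less_1[OF na inf q0 _ dyadic_weight_pos[OF sv] A conv fin] by (meson not_less)
    moreover have "?i \<or> ?ii \<or> ?iii"
    proof (cases "p = \<infinity>")
      case True
      \<comment> \<open>A set of measure 2^0 = 1: finiteness of the size of its characteristic
        function is condition (ii) after discretization.\<close>
      obtain E where E: "E \<in> sets R" "emeasure R E = ennreal (2 powr (real_of_int 0))"
        using non_atomic_subset_emeasure[OF na, of "space R" 1] inf by auto
      have "lq q (\<lambda>k. ennreal (?w k) * indicator {..<0} k) < \<infinity>"
        using dyadic_norm_indicator_ge[OF q0 E, of ?w] fin[OF E(1)] E(2) by (auto intro: order_le_less_trans)
      moreover have "recip p = 0" using True by (simp add: recip_def)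
      ultimately have ?ii using True Lq_norm_unit_interval_finite_iff[OF sv q0] by simp
      then show ?thesis by blast
    next
      case False
      \<comment> \<open>Finite p makes the exponent of the weight positive, which
        \<open>convex_weight_growth\<close> needs to bound characteristic functions by single
        weights.\<close>
      have rp: "0 < recip p" by (rule recip_pos[OF p0 False])
      obtain D where D: "0 < D" and growth: "\<And>k m. k \<le> m \<Longrightarrow> ?w m \<le> D * 2 powr (real_of_int (m - k)) * ?w k"
        using convex_weight_growth[OF na inf sv q rp A conv] by blast
      have "recip p \<le> 1" by (rule weight_growth_imp_recip_le_1[OF sv D growth])
      then have "1 \<le> p" by (rule recip_le_1D[OF p0 False])
      show ?thesis
      proof (cases "p = 1")
        case False
        with \<open>1 \<le> p\<close> have "1 < p" by (metis order_le_imp_less_or_eq)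
        moreover have "p < \<infinity>" using \<open>p \<noteq> \<infinity>\<close> by (simp add: less_top)
        ultimately show ?thesis by blast
      next
        case True
        have r1: "recip p = 1" using True by simp
        have "q = 1"
        proof (rule ccontr)
          assume "q \<noteq> 1"
          with q have "recip q < 1" by (intro recip_less_1) simp
          moreover obtain C where "0 < C" "\<And>m (n::nat). 0 < n \<Longrightarrow>
             b (2 powr (real_of_int m)) * (\<Sum>l\<le>n. 1 / b (2 powr (real_of_int m - real n + real l))) \<le> C * real n powr recip q"
            using convex_harmonic_sum[OF na inf sv q A conv[unfolded r1]] by blast
          ultimately show False using no_harmonic_sum_bound[OF sv] by blast
        qed
        \<comment> \<open>With exponent 1 the powers of 2 in the weight cancel those in
          \<open>growth\<close>, leaving b almost non-increasing along dyadic points.\<close>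
        have mono: "b (2 powr m) \<le> D * b (2 powr k)" if "k \<le> m" for k m :: int
        proof -
          have "2 powr (real_of_int m) * b (2 powr m) \<le> D * (2 powr (real_of_int (m - k)) * 2 powr (real_of_int k)) * b (2 powr k)"
            using growth[OF that] by (simp add: r1 dyadic_weight_def mult_ac)
          also have "2 powr (real_of_int (m - k)) * 2 powr (real_of_int k) = 2 powr (real_of_int m)"
            by (simp flip: powr_add)
          finally show ?thesis by (simp add: mult.left_commute)
        qed
        have "\<exists>g. antimono_on {0<..} g \<and> equivalent_on {0<..} (\<lambda>t. ennreal (b t)) g"
          by (intro equivalent_antimono_of_dyadic[OF sv D mono])
        with \<open>q = 1\<close> show ?thesis using True by blast
      qed
    qed
    ultimately show "1 \<le> q \<and> (?i \<or> ?ii \<or> ?iii)" by blast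
  next
    assume R: "1 \<le> q \<and> (?i \<or> ?ii \<or> ?iii)"
    then have q: "1 \<le> q" by blast
    from R consider ?i | ?ii | ?iii by blast
    then show ?normable
    proof cases
      case 1
      then have "0 < recip p" using p0 by (intro recip_pos) auto
      then have "lq q (\<lambda>k. ennreal (?w k) * indicator {..<0} k) < \<infinity>"
        using lq_dyadic_weight_lessThan[OF sv q] by (metis ennreal_less_top infinity_ennreal_def order_le_less_trans)
      then show ?thesis using 1 by (intro normable_recip_less_1[OF sf na inf sv q]) (auto intro: recip_less_1)
    next
      case 2
      then have "recip p = 0" by (simp add: recip_def)
      then show ?thesis
        using 2 Lq_norm_unit_interval_finite_iff[OF sv q0] by (intro normable_recip_less_1[OF sf na inf sv q]) auto
    next
      case 3
      then show ?thesis using normable_1[OF sf na inf sv, of p] by simp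
    qed
  }
qed

end
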